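(* Let $N\ge2$, $\mathsf{A}=(A_1,\ldots,A_N)\in GL_2(\mathbb{R})^N$ be irreducible, $s>0$, and let $\mu$ be an equilibrium state for $\Phi^s$. Then the following three statements are equivalent: (1) $\mu$ is a Gibbs measure for some H\"older continuous potential; (2) $\{A_1,\dots,A_N\}$ has a strongly invariant multicone or is strongly conformal; (3) there exist a constant $C>0$ and a H\"older continuous potential $f:\Sigma\to\mathbb{R}$ such that $\bigl|\sum_{k=0}^{n-1}f(\sigma^k\mathtt{i})-\log\|A_{\mathtt{i}|_n}\|\bigr|\le C$ for all $\mathtt{i}\in\Sigma$ and $n\in\mathbb{N}$.
   Context: $\|\cdot\|$ is the operator norm. $\Sigma=\{1,\ldots,N\}^{\mathbb{N}}$ with left shift $\sigma$; $\Sigma_n$ the words of length $n$, $\mathtt{i}|_n$ the first $n$ symbols, $[\mathtt{i}]$ the cylinder of a finite word, $\mathtt{i}\wedge\mathtt{j}$ the longest common prefix, $A_{i_1\cdots i_n}=A_{i_1}\cdots A_{i_n}$. $\Phi^s=(\phi_n^s)$ with $\phi^s_n(\mathtt{i})=\log\|A_{\mathtt{i}|_n}\|^s$; for any sequence $\Phi=(\phi_n)$ the pressure is $P(\Phi)=\lim_n\frac1n\log\sum_{\mathtt{i}\in\Sigma_n}\exp\max_{\mathtt{j}\in[\mathtt{i}]}\phi_n(\mathtt{j})$; an equilibrium state for $\Phi^s$ is a $\sigma$-invariant probability measure $\mu$ with $P(\Phi^s)=h_\mu+\lim_n\frac1n\int\phi^s_n d\mu$. A potential $\phi:\Sigma\to\mathbb{R}$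 is H\"older continuous if $|\phi(\mathtt{i})-\phi(\mathtt{j})|\le C\tau^{|\mathtt{i}\wedge\mathtt{j}|}$ for some $C>0$, $0<\tau<1$. A Borel probability measure $\mu$ is a Gibbs measure for $\phi$ if there is $C\ge1$ with $C^{-1}\exp(-nP+\sum_{k=0}^{n-1}\phi(\sigma^k\mathtt{j}))\le\mu([\mathtt{i}])\le C\exp(-nP+\sum_{k=0}^{n-1}\phi(\sigma^k\mathtt{j}))$ for all $\mathtt{i}\in\Sigma_n$, $\mathtt{j}\in[\mathtt{i}]$, $n\in\mathbb{N}$, where $P$ is the pressure of $(\sum_{k=0}^{n-1}\phi\circ\sigma^k)_n$. $\mathsf{A}$ is irreducible if no 1-dimensional subspace is invariant under all $A_i$. A set of matrices is strongly conformal if there is a single invertible $M$ with $|\det A|^{-1/2}MAM^{-1}\in O(2)$ for all $A$ in the set. A multicone is a proper subset of $\mathbb{RP}^1$ that is a finite union of closed projective intervals; it is strongly invariant for a set $\mathsf{B}$ if $A\mathcal{C}\subset\mathcal{C}^o$ for all $A\in\mathsf{B}$. *)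

theory Defs
  imports "HOL-Probability.Probability"
begin

definition Sig :: "nat \<Rightarrow> (nat \<Rightarrow> nat) set" where
  "Sig N = {x. \<forall>k. x k \<in> {1..N}}"

definition shift :: "(nat \<Rightarrow> nat) \<Rightarrow> (nat \<Rightarrow> nat)" where
  "shift x = (\<lambda>k. x (Suc k))"

definition words :: "nat \<Rightarrow> nat \<Rightarrow> nat list set" where
  "words N n = {w. length w = n \<and> set w \<subseteq> {1..N}}"

definition cyl :: "nat \<Rightarrow> nat list \<Rightarrow> (nat \<Rightarrow> nat) set" where
  "cyl N w = {x \<in> Sig N. \<forall>k<length w. x k = w ! k}"

definition prefix :: "(nat \<Rightarrow> nat) \<Rightarrow> nat \<Rightarrow> nat list" where
  "prefix x n = map x [0..<n]"

text \<open>Length of the longest common prefix (for distinct sequences).\<close>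
definition common_len :: "(nat \<Rightarrow> nat) \<Rightarrow> (nat \<Rightarrow> nat) \<Rightarrow> nat" where
  "common_len x y = (LEAST k. x k \<noteq> y k)"

definition matword :: "(nat \<Rightarrow> real^2^2) \<Rightarrow> nat list \<Rightarrow> real^2^2" where
  "matword A w = foldr (\<lambda>a M. A a ** M) w (mat 1)"

definition opnorm :: "real^2^2 \<Rightarrow> real" where
  "opnorm M = onorm (\<lambda>x. M *v x)"

definition birkhoff :: "((nat \<Rightarrow> nat) \<Rightarrow> real) \<Rightarrow> nat \<Rightarrow> (nat \<Rightarrow> nat) \<Rightarrow> real" where
  "birkhoff f n x = (\<Sum>k<n. f ((shift ^^ k) x))"

definition pressure :: "nat \<Rightarrow> (nat \<Rightarrow> (nat \<Rightarrow> nat) \<Rightarrow> real) \<Rightarrow> real" where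
  "pressure N \<phi> = lim (\<lambda>n. ln (\<Sum>w\<in>words N n. exp (SUP j\<in>cyl N w. \<phi> n j)) / real n)"

definition Phi :: "(nat \<Rightarrow> real^2^2) \<Rightarrow> real \<Rightarrow> nat \<Rightarrow> (nat \<Rightarrow> nat) \<Rightarrow> real" where
  "Phi A s n x = ln (opnorm (matword A (prefix x n)) powr s)"

definition holder :: "nat \<Rightarrow> ((nat \<Rightarrow> nat) \<Rightarrow> real) \<Rightarrow> bool" where
  "holder N f \<longleftrightarrow> (\<exists>C \<tau>. C > 0 \<and> 0 < \<tau> \<and> \<tau> < 1 \<and>
     (\<forall>x\<in>Sig N. \<forall>y\<in>Sig N. x \<noteq> y \<longrightarrow> \<bar>f x - f y\<bar> \<le> C * \<tau> ^ common_len x y))"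

text \<open>Shift-invariant Borel probability measure on Sigma (Sigma carries the
  product topology, as a subspace of nat => nat with nat discrete).\<close>
definition inv_prob :: "nat \<Rightarrow> (nat \<Rightarrow> nat) measure \<Rightarrow> bool" where
  "inv_prob N \<mu> \<longleftrightarrow> prob_space \<mu> \<and> sets \<mu> = sets borel \<and> emeasure \<mu> (Sig N) = 1 \<and>
     distr \<mu> borel shift = \<mu>"

text \<open>Kolmogorov-Sinai entropy, computed with the generating partition into
  cylinders of length one (standard formula for the full shift).\<close>
definition ks_entropy :: "nat \<Rightarrow> (nat \<Rightarrow> nat) measure \<Rightarrow> real" where
  "ks_entropy N \<mu> = lim (\<lambda>n. (\<Sum>w\<in>words N n.
       - measure \<mu> (cyl N w) * ln (measure \<mu> (cyl N w))) / real n)"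

definition equilibrium :: "nat \<Rightarrow> (nat \<Rightarrow> real^2^2) \<Rightarrow> real \<Rightarrow> (nat \<Rightarrow> nat) measure \<Rightarrow> bool" where
  "equilibrium N A s \<mu> \<longleftrightarrow> inv_prob N \<mu> \<and>
     pressure N (Phi A s) = ks_entropy N \<mu> + lim (\<lambda>n. (\<integral>x. Phi A s n x \<partial>\<mu>) / real n)"

definition gibbs :: "nat \<Rightarrow> (nat \<Rightarrow> nat) measure \<Rightarrow> ((nat \<Rightarrow> nat) \<Rightarrow> real) \<Rightarrow> bool" where
  "gibbs N \<mu> \<phi> \<longleftrightarrow> (\<exists>C\<ge>1. \<forall>n. \<forall>w\<in>words N n. \<forall>j\<in>cyl N w.
     exp (- real n * pressure N (birkhoff \<phi>) + birkhoff \<phi> n j) / C \<le> measure \<mu> (cyl N w) \<and>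
     measure \<mu> (cyl N w) \<le> C * exp (- real n * pressure N (birkhoff \<phi>) + birkhoff \<phi> n j))"

definition irreducible_tuple :: "nat \<Rightarrow> (nat \<Rightarrow> real^2^2) \<Rightarrow> bool" where
  "irreducible_tuple N A \<longleftrightarrow>
     \<not> (\<exists>V :: (real^2) set. subspace V \<and> dim V = 1 \<and> (\<forall>i\<in>{1..N}. (\<lambda>x. A i *v x) ` V \<subseteq> V))"

definition strongly_conformal :: "nat \<Rightarrow> (nat \<Rightarrow> real^2^2) \<Rightarrow> bool" where
  "strongly_conformal N A \<longleftrightarrow> (\<exists>M :: real^2^2. invertible M \<and>
     (\<forall>i\<in>{1..N}. orthogonal_matrix (\<bar>det (A i)\<bar> powr (-1/2) *\<^sub>R (M ** A i ** matrix_inv M))))"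

definition pline :: "real \<Rightarrow> (real^2) set" where
  "pline \<theta> = span {vector [cos \<theta>, sin \<theta>]}"

definition proj_interior :: "(real^2) set set \<Rightarrow> (real^2) set set" where
  "proj_interior C = {l. \<exists>\<theta> e. e > 0 \<and> l = pline \<theta> \<and> pline ` ball \<theta> e \<subseteq> C}"

definition multicone :: "(real^2) set set \<Rightarrow> bool" where
  "multicone C \<longleftrightarrow> C \<subset> range pline \<and> (\<exists>I :: (real \<times> real) set. finite I \<and> I \<noteq> {} \<and>
     (\<forall>(a,b)\<in>I. a < b) \<and> C = (\<Union>(a,b)\<in>I. pline ` {a..b}))"

definition has_strongly_invariant_multicone :: "nat \<Rightarrow> (nat \<Rightarrow> real^2^2) \<Rightarrow> bool" where
  "has_strongly_invariant_multicone N A \<longleftrightarrow> (\<exists>C. multicone C \<and>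
     (\<forall>i\<in>{1..N}. (\<lambda>l. (\<lambda>x. A i *v x) ` l) ` C \<subseteq> proj_interior C))"

end

theory Submission
  imports Defs
begin

text \<open>
  Irreducibility makes the norms of the products quasi-multiplicative, and this determines the
  equilibrium state: on cylinders it is comparable to \<open>B w = exp (- n P) * norm (A w) powr s\<close>. Indeed every
  invariant measure with nonnegative free energy dominates a fixed multiple of \<open>B\<close>; subtracting from it
  an invariant measure comparable to \<open>B\<close> leaves such a measure again, so the two coincide. Hence (1) and (3)
  are equivalent.

  A strongly invariant multicone gives exponential contraction of directions, and the logarithmic growth
  along the limit direction is a Hoelder potential. Conversely, given a potential, the norms are almost
  multiplicative. Let \<open>gap w\<close> be the ratio of the two singular values of the product along \<open>w\<close>. If it tends
  to 0 uniformly in the length, the directions transversal to all contracted directions form an invariant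
  cone. If it is bounded below, the normalised products are bounded and preserve a quadratic form. In the remaining
  case there are arbitrarily long quasi-conformal words; inserting such words between two others decouples
  the Birkhoff sums over periodic orbits, so the spectral radius becomes multiplicative, which
  contradicts irreducibility.
\<close>

section \<open>Subadditive sequences\<close>

text \<open>A potential controls norms only up to a bounded factor, whereas excluding the remaining
  case takes exact identities. They come from periodic sequences: the sum over \<open>k\<close>
  periods is \<open>k\<close> times the sum over one, so on division by \<open>k\<close> the error
  disappears and the sum over one period is the logarithm of a spectral radius. For products
  degenerating to rank one this radius becomes the modulus of a trace. Hoelder continuity makes the
  decoupling error exponentially small in the length of the inserted word, which therefore has to be
  long; and it has to be quasi-conformal, since for an inserted product of rank one the
  multiplicativity obtained holds trivially.

  The equilibrium state enters only through its values on cylinders. Its comparison with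
  \<open>B\<close> needs a lower bound whose constant is the same for all invariant weights of
  nonnegative free energy, so that it applies again to the remainder of the subtraction.
  Quasi-multiplicativity may insert one connecting letter; many constants of that half merely pay
  for this letter.\<close>

lemma subadditive_mult_le:
  fixes x :: "nat \<Rightarrow> real"
  assumes sub: "\<And>n m. x (n + m) \<le> x n + x m"
  shows "x (k * n + r) \<le> real k * x n + x r"
proof (induction k)
  case (Suc k)
  have "x (Suc k * n + r) = x (n + (k * n + r))" by (simp add: algebra_simps)
  also have "\<dots> \<le> x n + x (k * n + r)" by (rule sub)
  also have "\<dots> \<le> x n + (real k * x n + x r)" using Suc by simp
  finally show ?case by (simp add: algebra_simps)
qed simp

text \<open>Along the multiples of \<open>n\<close> the quotients never exceed
  \<open>x n / real n\<close>, so neither does their limit. At \<open>n = 0\<close> the claim is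
  \<open>0 \<le> x 0\<close>, which is subadditivity at \<open>0\<close> and
  \<open>0\<close>.\<close>

lemma subadditive_ge_limit:
  fixes x :: "nat \<Rightarrow> real"
  assumes sub: "\<And>n m. x (n + m) \<le> x n + x m"
    and lim: "(\<lambda>n. x n / real n) \<longlonglongrightarrow> L"
  shows "real n * L \<le> x n"
proof (cases "n = 0")
  case True
  then show ?thesis using sub[of 0 0] by simp
next
  case False
  have "strict_mono (\<lambda>k. Suc k * n)"
    using False by (simp add: strict_mono_def)
  from LIMSEQ_subseq_LIMSEQ[OF lim this]
  have l1: "(\<lambda>k. x (Suc k * n) / real (Suc k * n)) \<longlonglongrightarrow> L"
    by (simp add: o_def)
  have "x (Suc k * n) / real (Suc k * n) \<le> x n / real n" for k
  proof -
    have "x (Suc k * n) \<le> real k * x n + x n"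
      using subadditive_mult_le[of x k n n, OF sub] by (simp add: algebra_simps)
    then have "x (Suc k * n) \<le> real (Suc k) * x n" by (simp add: algebra_simps)
    then have "x (Suc k * n) / real (Suc k * n) \<le> real (Suc k) * x n / real (Suc k * n)"
      by (rule divide_right_mono) simp
    also have "\<dots> = x n / real n" unfolding of_nat_mult by simp
    finally show ?thesis .
  qed
  then have "L \<le> x n / real n"
    by (intro LIMSEQ_le_const2[OF l1]) auto
  then show ?thesis using False by (simp add: field_simps)
qed

text \<open>The limit is the infimum of the quotients, finite by the linear lower bound. This turns
  the \<open>lim\<close> in the definitions of pressure and entropy into an actual limit.\<close>

lemma fekete:
  fixes x :: "nat \<Rightarrow> real"
  assumes sub: "\<And>n m. x (n + m) \<le> x n + x m"
    and low: "\<And>n. - K * real n \<le> x n"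
  shows "convergent (\<lambda>n. x n / real n)"
proof -
  define S where "S = (\<lambda>n. x n / real n) ` {1..}"
  define L where "L = Inf S"
  have ne: "S \<noteq> {}" by (auto simp: S_def)
  have bd: "bdd_below S"
    unfolding S_def
    by (rule bdd_belowI[of _ "-K"]) (use low in \<open>auto simp: field_simps\<close>)
  have lower: "L \<le> x n / real n" if "n \<ge> 1" for n
    unfolding L_def by (rule cInf_lower[OF _ bd]) (use that in \<open>auto simp: S_def\<close>)
  have "(\<lambda>n. x n / real n) \<longlonglongrightarrow> L"
  proof (rule LIMSEQ_I)
    fix e :: real assume e: "e > 0"
    define l where "l = L + e / 2"
    have "Inf S < l" using e by (simp add: l_def L_def)
    then obtain m where m: "m \<ge> 1" "x m / real m < l"
      using cInf_lessD[OF ne] unfolding S_def by auto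
    \<comment> \<open>Absorbs whatever the remainder modulo \<open>m\<close> contributes, uniformly
      in \<open>n\<close>: its value \<open>x r\<close> and the missing
      \<open>real r * l\<close>.\<close>
    define M where "M = (\<Sum>r<m. \<bar>x r\<bar>) + real m * \<bar>l\<bar>"
    have M0: "M \<ge> 0" by (auto simp: M_def intro!: add_nonneg_nonneg sum_nonneg)
    obtain n0 :: nat where n0: "2 * M / e < real n0" using reals_Archimedean2 by blast
    have up: "x n \<le> real n * l + M" for n
    proof -
      define k r where "k = n div m" and "r = n mod m"
      have n: "n = k * m + r" by (simp add: k_def r_def)
      have r: "r < m" using m by (simp add: r_def)
      have xr: "x r \<le> (\<Sum>r<m. \<bar>x r\<bar>)"
        using member_le_sum[of r "{..<m}" "\<lambda>r. \<bar>x r\<bar>"] r by auto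
      have a: "x n \<le> real k * x m + x r" unfolding n by (rule subadditive_mult_le[OF sub])
      have "real k * x m \<le> real k * (real m * l)"
        by (rule mult_left_mono) (use m in \<open>auto simp: field_simps\<close>)
      also have "real k * (real m * l) = real n * l - real r * l"
        unfolding n by (simp add: algebra_simps)
      finally have b: "real k * x m \<le> real n * l - real r * l" .
      have c: "- (real r * l) \<le> real m * \<bar>l\<bar>"
      proof -
        have "- (real r * l) \<le> real r * \<bar>l\<bar>"
          by (metis abs_ge_minus_self abs_mult abs_of_nat)
        also have "\<dots> \<le> real m * \<bar>l\<bar>" using r by (intro mult_right_mono) auto
        finally show ?thesis .
      qed
      show ?thesis using a b c xr unfolding M_def by linarith
    qed
    have "norm (x n / real n - L) < e" if "n \<ge> Suc n0" for n
    proof -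
      have npos: "real n > 0" "n \<ge> 1" using that by auto
      have "2 * M / e < real n" using n0 that by simp
      then have "M / real n < e / 2" using npos e by (simp add: field_simps)
      moreover have "x n / real n \<le> l + M / real n"
        using up[of n] npos by (simp add: field_simps)
      ultimately have "x n / real n < L + e" unfolding l_def by linarith
      moreover have "L \<le> x n / real n" using lower npos by simp
      ultimately show ?thesis by simp
    qed
    then show "\<exists>no. \<forall>n\<ge>no. norm (x n / real n - L) < e" by blast
  qed
  then show ?thesis by (auto simp: convergent_def)
qed

section \<open>Words\<close>

lemma words_0 [simp]: "words N 0 = {[]}"
  by (auto simp: words_def)

lemma words_iff: "w \<in> words N n \<longleftrightarrow> w \<in> lists {1..N} \<and> length w = n"
  by (auto simp: words_def)

lemma finite_words [simp]: "finite (words N n)"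
  unfolding words_def using finite_lists_length_eq[of "{1..N}" n]
  by (simp add: conj_commute)

lemma words_Suc_eq: "words N (Suc 0) = (\<lambda>a. [a]) ` {1..N}"
  by (auto simp: words_def length_Suc_conv)

lemma words_in_lists: "w \<in> words N n \<Longrightarrow> w \<in> lists {1..N}"
  by (simp add: words_iff)

lemma words_appendI: "u \<in> words N n \<Longrightarrow> v \<in> words N m \<Longrightarrow> u @ v \<in> words N (n + m)"
  by (auto simp: words_iff)

lemma sum_words_add:
  "(\<Sum>w\<in>words N (n + m). f w) = (\<Sum>u\<in>words N n. \<Sum>v\<in>words N m. f (u @ v))"
proof -
  have "(\<Sum>u\<in>words N n. \<Sum>v\<in>words N m. f (u @ v))
        = (\<Sum>p\<in>words N n \<times> words N m. f (fst p @ snd p))"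
    by (simp add: sum.cartesian_product case_prod_beta)
  also have "\<dots> = (\<Sum>w\<in>words N (n + m). f w)"
  proof (rule sum.reindex_bij_witness[where j = "\<lambda>p. fst p @ snd p" and i = "\<lambda>w. (take n w, drop n w)"])
    fix w assume w: "w \<in> words N (n + m)"
    show "(take n w, drop n w) \<in> words N n \<times> words N m"
      using w by (auto simp: words_def dest: in_set_takeD in_set_dropD)
  qed (auto simp: words_def)
  finally show ?thesis by simp
qed

lemma sum_words_1: "(\<Sum>w\<in>words N (Suc 0). f w) = (\<Sum>a\<in>{1..N}. f [a])"
  unfolding words_Suc_eq by (subst sum.reindex) (auto simp: inj_on_def)

lemma sum_words_Suc: "(\<Sum>w\<in>words N (Suc n). f w) = (\<Sum>a\<in>{1..N}. \<Sum>v\<in>words N n. f (a # v))"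
  using sum_words_add[of f N "Suc 0" n] by (simp add: sum_words_1)

lemma sum_words_Suc': "(\<Sum>w\<in>words N (Suc n). f w) = (\<Sum>v\<in>words N n. \<Sum>a\<in>{1..N}. f (v @ [a]))"
  using sum_words_add[of f N n "Suc 0"] by (simp add: sum_words_1)

lemma words_nonempty: "N \<ge> 1 \<Longrightarrow> replicate n 1 \<in> words N n"
  by (auto simp: words_def)

section \<open>Invariant weights on words\<close>

text \<open>The values on cylinders of a shift-invariant probability measure.\<close>

definition invariant_weight :: "nat \<Rightarrow> (nat list \<Rightarrow> real) \<Rightarrow> bool" where
  "invariant_weight N m \<longleftrightarrow> (\<forall>w\<in>lists {1..N}. 0 \<le> m w) \<and> m [] = 1 \<and>
     (\<forall>w\<in>lists {1..N}. (\<Sum>a\<in>{1..N}. m (w @ [a])) = m w) \<and>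
     (\<forall>w\<in>lists {1..N}. (\<Sum>a\<in>{1..N}. m (a # w)) = m w)"

lemma invariant_weight_nonneg: "invariant_weight N m \<Longrightarrow> w \<in> lists {1..N} \<Longrightarrow> 0 \<le> m w"
  by (auto simp: invariant_weight_def)

lemma invariant_weight_sum_right:
  assumes "invariant_weight N m" "w \<in> lists {1..N}"
  shows "(\<Sum>v\<in>words N n. m (w @ v)) = m w"
  using assms(2)
proof (induction n)
  case (Suc n)
  have "(\<Sum>v\<in>words N (Suc n). m (w @ v)) = (\<Sum>v\<in>words N n. \<Sum>a\<in>{1..N}. m ((w @ v) @ [a]))"
    by (simp add: sum_words_Suc')
  also have "\<dots> = (\<Sum>v\<in>words N n. m (w @ v))"
  proof (rule sum.cong[OF refl])
    fix v assume "v \<in> words N n"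
    then have "w @ v \<in> lists {1..N}" using Suc.prems by (auto simp: words_iff)
    then show "(\<Sum>a\<in>{1..N}. m ((w @ v) @ [a])) = m (w @ v)"
      using assms(1) unfolding invariant_weight_def by blast
  qed
  finally show ?case using Suc by simp
qed simp

lemma invariant_weight_sum_left:
  assumes "invariant_weight N m" "w \<in> lists {1..N}"
  shows "(\<Sum>v\<in>words N n. m (v @ w)) = m w"
  using assms(2)
proof (induction n)
  case (Suc n)
  have "(\<Sum>v\<in>words N (Suc n). m (v @ w)) = (\<Sum>a\<in>{1..N}. \<Sum>v\<in>words N n. m (a # (v @ w)))"
    by (simp add: sum_words_Suc)
  also have "\<dots> = (\<Sum>v\<in>words N n. \<Sum>a\<in>{1..N}. m (a # (v @ w)))"
    by (rule sum.swap)
  also have "\<dots> = (\<Sum>v\<in>words N n. m (v @ w))"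
  proof (rule sum.cong[OF refl])
    fix v assume "v \<in> words N n"
    then have "v @ w \<in> lists {1..N}" using Suc.prems by (auto simp: words_iff)
    then show "(\<Sum>a\<in>{1..N}. m (a # (v @ w))) = m (v @ w)"
      using assms(1) unfolding invariant_weight_def by blast
  qed
  finally show ?case using Suc by simp
qed simp

lemma invariant_weight_total:
  assumes "invariant_weight N m"
  shows "(\<Sum>v\<in>words N n. m v) = 1"
  using invariant_weight_sum_right[OF assms, of "[]" n] assms by (simp add: invariant_weight_def)

lemma invariant_weight_mono:
  assumes "invariant_weight N m" "u \<in> lists {1..N}" "v \<in> lists {1..N}"
  shows "m (u @ v) \<le> m u" "m (u @ v) \<le> m v"
proof -
  have "m (u @ v) \<le> (\<Sum>v'\<in>words N (length v). m (u @ v'))"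
    using assms by (intro member_le_sum) (auto simp: words_iff intro!: invariant_weight_nonneg)
  then show "m (u @ v) \<le> m u" using invariant_weight_sum_right assms by simp
  have "m (u @ v) \<le> (\<Sum>u'\<in>words N (length u). m (u' @ v))"
    using assms by (intro member_le_sum[where f = "\<lambda>u'. m (u' @ v)"]) (auto simp: words_iff intro!: invariant_weight_nonneg)
  then show "m (u @ v) \<le> m v" using invariant_weight_sum_left assms by simp
qed

text \<open>By invariance both marginals of \<open>m\<close> on concatenations are \<open>m\<close>
  itself, so averaging preserves subadditivity.\<close>

lemma sum_weight_append:
  assumes m: "invariant_weight N m"
    and F: "\<And>u v. u \<in> lists {1..N} \<Longrightarrow> v \<in> lists {1..N} \<Longrightarrow> F (u @ v) \<le> F u + F v"
  shows "(\<Sum>w\<in>words N (n + k). m w * F w) \<le> (\<Sum>w\<in>words N n. m w * F w) + (\<Sum>w\<in>words N k. m w * F w)"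
proof -
  have "(\<Sum>w\<in>words N (n + k). m w * F w)
     \<le> (\<Sum>u\<in>words N n. \<Sum>v\<in>words N k. m (u @ v) * F u + m (u @ v) * F v)"
    unfolding sum_words_add
  proof (intro sum_mono)
    fix u v assume "u \<in> words N n" "v \<in> words N k"
    then have uv: "u \<in> lists {1..N}" "v \<in> lists {1..N}" "u @ v \<in> lists {1..N}" by (auto simp: words_iff)
    have "m (u @ v) * F (u @ v) \<le> m (u @ v) * (F u + F v)"
      using invariant_weight_nonneg[OF m uv(3)] F[OF uv(1,2)] by (rule mult_left_mono[rotated])
    then show "m (u @ v) * F (u @ v) \<le> m (u @ v) * F u + m (u @ v) * F v"
      by (simp add: algebra_simps)
  qed
  also have "\<dots> = (\<Sum>u\<in>words N n. (\<Sum>v\<in>words N k. m (u @ v)) * F u)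
      + (\<Sum>v\<in>words N k. (\<Sum>u\<in>words N n. m (u @ v)) * F v)"
    unfolding sum.distrib sum_distrib_right by (subst (2) sum.swap) simp
  also have "\<dots> = (\<Sum>u\<in>words N n. m u * F u) + (\<Sum>v\<in>words N k. m v * F v)"
    using invariant_weight_sum_left[OF m words_in_lists] invariant_weight_sum_right[OF m words_in_lists]
    by simp
  finally show ?thesis .
qed

definition block_entropy :: "nat \<Rightarrow> (nat list \<Rightarrow> real) \<Rightarrow> nat \<Rightarrow> real" where
  "block_entropy N m n = (\<Sum>w\<in>words N n. - m w * ln (m w))"

text \<open>The difference of the two sides is the relative entropy of \<open>m\<close> on words of
  length \<open>n + k\<close> with respect to the product of its marginals; it is nonnegative by
  \<open>ln x \<le> x - 1\<close>.\<close>

lemma block_entropy_subadditive: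
  assumes inv: "invariant_weight N m"
  shows "block_entropy N m (n + k) \<le> block_entropy N m n + block_entropy N m k"
proof -
  let ?U = "words N n" and ?V = "words N k"
  have H1: "block_entropy N m n = (\<Sum>u\<in>?U. \<Sum>v\<in>?V. - m (u @ v) * ln (m u))"
    unfolding block_entropy_def
  proof (rule sum.cong[OF refl])
    fix u assume "u \<in> ?U"
    then have "(\<Sum>v\<in>?V. m (u @ v)) = m u"
      using invariant_weight_sum_right[OF inv] by (simp add: words_iff)
    then show "- m u * ln (m u) = (\<Sum>v\<in>?V. - m (u @ v) * ln (m u))"
      by (simp add: sum_negf flip: sum_distrib_right)
  qed
  have "block_entropy N m k = (\<Sum>v\<in>?V. \<Sum>u\<in>?U. - m (u @ v) * ln (m v))"
    unfolding block_entropy_def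
  proof (rule sum.cong[OF refl])
    fix v assume "v \<in> ?V"
    then have "(\<Sum>u\<in>?U. m (u @ v)) = m v"
      using invariant_weight_sum_left[OF inv] by (simp add: words_iff)
    then show "- m v * ln (m v) = (\<Sum>u\<in>?U. - m (u @ v) * ln (m v))"
      by (simp add: sum_negf flip: sum_distrib_right)
  qed
  then have H2: "block_entropy N m k = (\<Sum>u\<in>?U. \<Sum>v\<in>?V. - m (u @ v) * ln (m v))"
    by (subst (asm) sum.swap)
  have H12: "block_entropy N m (n + k) = (\<Sum>u\<in>?U. \<Sum>v\<in>?V. - m (u @ v) * ln (m (u @ v)))"
    by (simp add: block_entropy_def sum_words_add)
  have "block_entropy N m (n + k) - block_entropy N m n - block_entropy N m k
     = (\<Sum>u\<in>?U. \<Sum>v\<in>?V. m (u @ v) * (ln (m u) + ln (m v) - ln (m (u @ v))))"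
    unfolding H1 H2 H12 by (simp add: sum_subtractf[symmetric] algebra_simps)
  also have "\<dots> \<le> (\<Sum>u\<in>?U. \<Sum>v\<in>?V. m u * m v - m (u @ v))"
  proof (intro sum_mono)
    fix u v assume "u \<in> ?U" "v \<in> ?V"
    then have uv: "u \<in> lists {1..N}" "v \<in> lists {1..N}" by (auto simp: words_iff)
    note nn = invariant_weight_nonneg[OF inv]
    have nn: "0 \<le> m u" "0 \<le> m v" "0 \<le> m (u @ v)" using nn uv by auto
    show "m (u @ v) * (ln (m u) + ln (m v) - ln (m (u @ v))) \<le> m u * m v - m (u @ v)"
    proof (cases "m (u @ v) = 0")
      case True
      then show ?thesis using nn by simp
    next
      case False
      then have p: "m (u @ v) > 0" using nn by simp
      then have pu: "m u > 0" "m v > 0"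
        using invariant_weight_mono[OF inv uv] by auto
      have "ln (m u) + ln (m v) - ln (m (u @ v)) = ln (m u * m v / m (u @ v))"
        using p pu by (simp add: ln_mult ln_div)
      also have "\<dots> \<le> m u * m v / m (u @ v) - 1"
        using p pu by (intro ln_le_minus_one) simp
      finally have "m (u @ v) * (ln (m u) + ln (m v) - ln (m (u @ v))) \<le> m (u @ v) * (m u * m v / m (u @ v) - 1)"
        using p by (intro mult_left_mono) auto
      also have "\<dots> = m u * m v - m (u @ v)" using p by (simp add: field_simps)
      finally show ?thesis .
    qed
  qed
  also have "\<dots> = (\<Sum>u\<in>?U. m u) * (\<Sum>v\<in>?V. m v) - (\<Sum>w\<in>words N (n + k). m w)"
    by (simp add: sum_subtractf sum_product sum_words_add)
  also have "\<dots> = 0" by (simp add: invariant_weight_total[OF inv])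
  finally show ?thesis by simp
qed

lemma block_entropy_nonneg:
  assumes inv: "invariant_weight N m"
  shows "0 \<le> block_entropy N m n"
  unfolding block_entropy_def
proof (rule sum_nonneg)
  fix w assume w: "w \<in> words N n"
  then have 0: "0 \<le> m w" using inv by (auto simp: words_iff intro: invariant_weight_nonneg)
  have "m w \<le> 1"
    using invariant_weight_mono(1)[OF inv, of "[]" w] w inv
    by (auto simp: words_iff invariant_weight_def)
  then have "m w * ln (m w) \<le> 0"
    using 0 by (cases "m w = 0") (auto intro!: mult_nonneg_nonpos)
  then show "0 \<le> - m w * ln (m w)" by simp
qed

text \<open>Tychonoff gives compactness of the product of intervals; as there are only countably
  many words, compactness yields convergent subsequences.\<close>

lemma pointwise_convergent_subsequence:
  fixes f :: "nat \<Rightarrow> nat list \<Rightarrow> real"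
  assumes "\<And>n w. \<bar>f n w\<bar> \<le> C w"
  obtains r l where "strict_mono (r :: nat \<Rightarrow> nat)" "\<And>w. (\<lambda>n. f (r n) w) \<longlonglongrightarrow> l w"
proof -
  define S where "S = PiE UNIV (\<lambda>w. {- C w..C w})"
  have "compact S"
  proof -
    have "compactin (product_topology (\<lambda>w::nat list. euclideanreal) UNIV) S"
      unfolding S_def compactin_PiE by (auto simp: compactin_euclidean_iff)
    then show ?thesis by (simp add: euclidean_product_topology compactin_euclidean_iff)
  qed
  then have "seq_compact S" by (rule compact_imp_seq_compact)
  moreover have "\<forall>n. f n \<in> S"
    using assms by (auto simp: S_def abs_le_iff) (smt (verit) assms)+
  ultimately obtain l r where lr: "strict_mono r" "(f \<circ> r) \<longlonglongrightarrow> l"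
    unfolding seq_compact_def by metis
  have "(\<lambda>n. f (r n) w) \<longlonglongrightarrow> l w" for w
  proof -
    have "continuous_on UNIV (\<lambda>g :: nat list \<Rightarrow> real. g w)"
      by (rule continuous_on_product_coordinates)
    then have "isCont (\<lambda>g :: nat list \<Rightarrow> real. g w) l"
      by (metis UNIV_I continuous_on_eq_continuous_at open_UNIV)
    from isCont_tendsto_compose[OF this lr(2)] show ?thesis by (simp add: o_def)
  qed
  with lr(1) show ?thesis using that by blast
qed

section \<open>Quasi-multiplicative weights and their equilibrium states\<close>

text \<open>What remains of the weight \<open>B\<close> of the overview once matrices are forgotten.
  \<open>B_quasi\<close> allows one connecting letter, the form in which irreducibility provides it;
  \<open>B_Cons\<close> and \<open>B_snoc\<close> restore a common word length afterwards;
  \<open>Z_lim\<close> says that the pressure is normalised to \<open>0\<close>.\<close>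

locale word_weight =
  fixes N :: nat and B :: "nat list \<Rightarrow> real" and D \<kappa> :: real
  assumes N: "N \<ge> 1" and D: "D > 0" and \<kappa>: "\<kappa> > 0"
    and B_pos: "\<And>w. w \<in> lists {1..N} \<Longrightarrow> 0 < B w"
    and B_append: "\<And>u v. u \<in> lists {1..N} \<Longrightarrow> v \<in> lists {1..N} \<Longrightarrow> B (u @ v) \<le> B u * B v"
    and B_quasi: "\<And>u v. u \<in> lists {1..N} \<Longrightarrow> v \<in> lists {1..N} \<Longrightarrow>
        \<kappa> * B u * B v \<le> B (u @ v) \<or> (\<exists>a\<in>{1..N}. \<kappa> * B u * B v \<le> B (u @ a # v))"
    and B_Cons: "\<And>a w. a \<in> {1..N} \<Longrightarrow> w \<in> lists {1..N} \<Longrightarrow> B w \<le> D * B (a # w)"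
    and B_snoc: "\<And>a w. a \<in> {1..N} \<Longrightarrow> w \<in> lists {1..N} \<Longrightarrow> B w \<le> D * B (w @ [a])"
    and Z_lim: "(\<lambda>n. ln (\<Sum>w\<in>words N n. B w) / real n) \<longlonglongrightarrow> 0"
begin

definition Z :: "nat \<Rightarrow> real" where "Z n = (\<Sum>w\<in>words N n. B w)"

text \<open>Quasi-multiplicativity summed over all pairs of words produces concatenations with and
  without an extra letter; the factor \<open>1 + Z 1\<close> pays for both.\<close>

definition CZ :: real where "CZ = (1 + Z 1) / \<kappa>"

text \<open>The share of \<open>B x\<close> that every extension sum keeps: \<open>D + 1\<close>
  counts the concatenations with the connecting letter and those lengthened by a letter afterwards,
  and the minimum with \<open>1\<close> covers extensions by no letter.\<close>

definition cE :: real where "cE = min 1 (\<kappa> / (D + 1))"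

section \<open>Partition sums and masses of extensions\<close>

lemma one: "1 \<in> {1..N}" using N by simp

lemma Z_pos: "0 < Z n"
  unfolding Z_def
proof (rule sum_pos)
  show "words N n \<noteq> {}" using words_nonempty[OF N, of n] by blast
qed (auto simp del: One_nat_def simp: words_in_lists B_pos)

lemma Z_append: "Z (n + m) \<le> Z n * Z m"
  unfolding Z_def sum_words_add sum_product
  by (intro sum_mono B_append) (auto simp: words_iff)

text \<open>The sequence \<open>ln (Z n)\<close> is subadditive, hence at least \<open>n\<close>
  times its growth rate, which is \<open>0\<close>.\<close>

lemma Z_ge_1: "1 \<le> Z n"
proof -
  have "real n * 0 \<le> ln (Z n)"
  proof (rule subadditive_ge_limit)
    show "ln (Z (n + m)) \<le> ln (Z n) + ln (Z m)" for n m
      using Z_append[of n m] Z_pos by (simp flip: ln_mult_pos)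
    show "(\<lambda>n. ln (Z n) / real n) \<longlonglongrightarrow> 0" using Z_lim by (simp add: Z_def)
  qed
  then show ?thesis using Z_pos[of n] by simp
qed

lemma B_quasi_sum:
  assumes "u \<in> lists {1..N}" "v \<in> lists {1..N}"
  shows "\<kappa> * B u * B v \<le> B (u @ v) + (\<Sum>a\<in>{1..N}. B (u @ a # v))"
proof -
  have p: "0 \<le> B (u @ a # v)" if "a \<in> {1..N}" for a
    using B_pos[of "u @ a # v"] assms that by auto
  have p0: "0 < B (u @ v)" using assms by (intro B_pos) auto
  from B_quasi[OF assms] show ?thesis
  proof
    assume "\<exists>a\<in>{1..N}. \<kappa> * B u * B v \<le> B (u @ a # v)"
    then obtain a where a: "a \<in> {1..N}" "\<kappa> * B u * B v \<le> B (u @ a # v)" by blast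
    have "B (u @ a # v) \<le> (\<Sum>a\<in>{1..N}. B (u @ a # v))"
      using a p by (intro member_le_sum) auto
    then show ?thesis using a p0 by simp
  next
    assume "\<kappa> * B u * B v \<le> B (u @ v)"
    then show ?thesis using sum_nonneg[of "{1..N}" "\<lambda>a. B (u @ a # v)"] p by simp
  qed
qed

lemma CZ_pos: "0 < CZ"
  using Z_pos[of 1] \<kappa> by (simp add: CZ_def)

lemma Z_supermult: "Z n * Z m \<le> CZ * Z (n + m)"
proof -
  have "\<kappa> * (Z n * Z m) = (\<Sum>u\<in>words N n. \<Sum>v\<in>words N m. \<kappa> * B u * B v)"
    unfolding Z_def sum_product by (simp add: sum_distrib_left mult.assoc)
  also have "\<dots> \<le> (\<Sum>u\<in>words N n. \<Sum>v\<in>words N m. B (u @ v) + (\<Sum>a\<in>{1..N}. B (u @ a # v)))"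
    by (intro sum_mono B_quasi_sum) (auto simp: words_iff)
  also have "\<dots> = Z (n + m) + (\<Sum>u\<in>words N n. \<Sum>w\<in>words N (Suc m). B (u @ w))"
  proof -
    have "(\<Sum>v\<in>words N m. \<Sum>a\<in>{1..N}. B (u @ a # v)) = (\<Sum>w\<in>words N (Suc m). B (u @ w))" for u
      unfolding sum_words_Suc by (rule sum.swap)
    then show ?thesis by (simp add: sum.distrib Z_def sum_words_add)
  qed
  also have "\<dots> = Z (n + m) + Z ((n + m) + 1)"
    unfolding Z_def using sum_words_add[of B N n "Suc m"] by simp
  also have "\<dots> \<le> Z (n + m) + Z (n + m) * Z 1" using Z_append[of "n + m" 1] by (intro add_left_mono)
  finally show ?thesis using \<kappa> by (simp add: CZ_def field_simps)
qed

text \<open>By \<open>Z_supermult\<close> the sequence \<open>ln (CZ / Z n)\<close> is subadditive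
  too, again with growth rate \<open>0\<close>, so it is nonnegative. Together with
  \<open>Z_ge_1\<close> the partition sums stay between positive constants.\<close>

lemma Z_le: "Z n \<le> CZ"
proof -
  have "real n * 0 \<le> ln (CZ / Z n)"
  proof (rule subadditive_ge_limit)
    show "ln (CZ / Z (n + m)) \<le> ln (CZ / Z n) + ln (CZ / Z m)" for n m
    proof -
      have "Z n * Z m * CZ \<le> CZ * Z (n + m) * CZ"
        using Z_supermult[of n m] CZ_pos by (intro mult_right_mono) auto
      then have "CZ / Z (n + m) \<le> (CZ / Z n) * (CZ / Z m)"
        using Z_pos by (simp add: divide_simps) (simp add: algebra_simps)
      then have "ln (CZ / Z (n + m)) \<le> ln ((CZ / Z n) * (CZ / Z m))"
        using Z_pos CZ_pos by (subst ln_le_cancel_iff) auto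
      also have "\<dots> = ln (CZ / Z n) + ln (CZ / Z m)" using Z_pos CZ_pos by (intro ln_mult_pos) auto
      finally show ?thesis .
    qed
    have "(\<lambda>n. ln CZ * (1 / real n) - ln (Z n) / real n) \<longlonglongrightarrow> ln CZ * 0 - 0"
      using Z_lim lim_1_over_n by (intro tendsto_intros) (auto simp: Z_def)
    then show "(\<lambda>n. ln (CZ / Z n) / real n) \<longlonglongrightarrow> 0"
      using Z_pos CZ_pos by (simp add: ln_div diff_divide_distrib less_imp_neq[OF Z_pos, symmetric])
  qed
  then show ?thesis using Z_pos[of n] CZ_pos by simp
qed

lemma B_le_CZ:
  assumes "w \<in> lists {1..N}"
  shows "B w \<le> CZ"
proof -
  have "B w \<le> Z (length w)"
    unfolding Z_def using assms
    by (intro member_le_sum) (auto simp del: One_nat_def simp: words_iff intro!: less_imp_le[OF B_pos])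
  then show ?thesis using Z_le by (rule order_trans)
qed

lemma cE_pos: "0 < cE" using \<kappa> D by (simp add: cE_def)

lemma sum_right_le:
  assumes "x \<in> lists {1..N}"
  shows "(\<Sum>y\<in>words N n. B (x @ y)) \<le> B x * CZ"
proof -
  have "(\<Sum>y\<in>words N n. B (x @ y)) \<le> (\<Sum>y\<in>words N n. B x * B y)"
    using assms by (intro sum_mono B_append) (auto simp: words_iff)
  also have "\<dots> = B x * Z n" by (simp add: Z_def sum_distrib_left)
  also have "\<dots> \<le> B x * CZ" using Z_le B_pos assms by (intro mult_left_mono) (auto intro: less_imp_le)
  finally show ?thesis .
qed

lemma sum_left_le:
  assumes "x \<in> lists {1..N}"
  shows "(\<Sum>y\<in>words N n. B (y @ x)) \<le> CZ * B x"
proof -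
  have "(\<Sum>y\<in>words N n. B (y @ x)) \<le> (\<Sum>y\<in>words N n. B y * B x)"
    using assms by (intro sum_mono B_append) (auto simp: words_iff)
  also have "\<dots> = Z n * B x" by (simp add: Z_def sum_distrib_right)
  also have "\<dots> \<le> CZ * B x" using Z_le B_pos assms by (intro mult_right_mono) (auto intro: less_imp_le)
  finally show ?thesis .
qed

lemma cE_mult_le:
  assumes "0 \<le> b" "\<kappa> * b * Z n \<le> (D + 1) * S"
  shows "cE * b \<le> S"
proof -
  have "\<kappa> * b * 1 \<le> \<kappa> * b * Z n" using assms(1) \<kappa> Z_ge_1 by (intro mult_left_mono) auto
  then have "\<kappa> / (D + 1) * b \<le> S" using assms(2) D by (simp add: field_simps)
  moreover have "cE * b \<le> \<kappa> / (D + 1) * b" using assms(1) by (intro mult_right_mono) (auto simp: cE_def)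
  ultimately show ?thesis by simp
qed

text \<open>Joining \<open>x\<close> with words of length \<open>n - 1\<close> through
  \<open>B_quasi\<close> gives extensions by \<open>n\<close> or by \<open>n - 1\<close> letters;
  the short ones are lengthened via \<open>B_snoc\<close>, at the cost of a factor
  \<open>D\<close>.\<close>

lemma sum_right_ge:
  assumes x: "x \<in> lists {1..N}"
  shows "cE * B x \<le> (\<Sum>y\<in>words N n. B (x @ y))"
proof (cases n)
  case 0
  then show ?thesis using B_pos[OF x] by (simp add: cE_def mult_le_cancel_right1)
next
  case (Suc m)
  let ?S = "\<Sum>y\<in>words N n. B (x @ y)"
  have "\<kappa> * B x * Z m = (\<Sum>v\<in>words N m. \<kappa> * B x * B v)"
    by (simp add: Z_def sum_distrib_left)
  also have "\<dots> \<le> (\<Sum>v\<in>words N m. B (x @ v) + (\<Sum>a\<in>{1..N}. B (x @ a # v)))"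
    using x by (intro sum_mono B_quasi_sum) (auto simp: words_iff)
  also have "\<dots> = (\<Sum>v\<in>words N m. B (x @ v)) + ?S"
    unfolding Suc sum_words_Suc by (simp add: sum.distrib) (rule sum.swap)
  also have "(\<Sum>v\<in>words N m. B (x @ v)) \<le> D * ?S"
  proof -
    have "(\<Sum>v\<in>words N m. B (x @ v)) \<le> (\<Sum>v\<in>words N m. D * (\<Sum>a\<in>{1..N}. B (x @ v @ [a])))"
    proof (rule sum_mono)
      fix v assume "v \<in> words N m"
      then have v: "v \<in> lists {1..N}" by (simp add: words_iff)
      have "B (x @ v) \<le> D * B ((x @ v) @ [1])" using x v one by (intro B_snoc) auto
      also have "B ((x @ v) @ [1]) \<le> (\<Sum>a\<in>{1..N}. B (x @ v @ [a]))"
      proof -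
        have "B (x @ v @ [1]) \<le> (\<Sum>a\<in>{1..N}. B (x @ v @ [a]))"
          using one x v by (intro member_le_sum[where f = "\<lambda>a. B (x @ v @ [a])"])
            (auto intro!: less_imp_le[OF B_pos])
        then show ?thesis by simp
      qed
      finally show "B (x @ v) \<le> D * (\<Sum>a\<in>{1..N}. B (x @ v @ [a]))" using D by simp
    qed
    also have "\<dots> = D * ?S" unfolding Suc sum_words_Suc' by (simp add: sum_distrib_left)
    finally show ?thesis .
  qed
  finally have "\<kappa> * B x * Z m \<le> (D + 1) * ?S" by (simp add: algebra_simps)
  then show ?thesis using B_pos[OF x] by (intro cE_mult_le) auto
qed

lemma sum_left_ge:
  assumes x: "x \<in> lists {1..N}"
  shows "cE * B x \<le> (\<Sum>y\<in>words N n. B (y @ x))"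
proof (cases n)
  case 0
  then show ?thesis using B_pos[OF x] by (simp add: cE_def mult_le_cancel_right1)
next
  case (Suc m)
  let ?S = "\<Sum>y\<in>words N n. B (y @ x)"
  have "\<kappa> * B x * Z m = (\<Sum>v\<in>words N m. \<kappa> * B v * B x)"
    by (simp add: Z_def sum_distrib_left algebra_simps)
  also have "\<dots> \<le> (\<Sum>v\<in>words N m. B (v @ x) + (\<Sum>a\<in>{1..N}. B (v @ a # x)))"
    using x by (intro sum_mono B_quasi_sum) (auto simp: words_iff)
  also have "\<dots> = (\<Sum>v\<in>words N m. B (v @ x)) + ?S"
    unfolding Suc sum_words_Suc' by (simp add: sum.distrib)
  also have "(\<Sum>v\<in>words N m. B (v @ x)) \<le> D * ?S"
  proof -
    have "(\<Sum>v\<in>words N m. B (v @ x)) \<le> (\<Sum>v\<in>words N m. D * (\<Sum>a\<in>{1..N}. B (a # v @ x)))"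
    proof (rule sum_mono)
      fix v assume "v \<in> words N m"
      then have v: "v \<in> lists {1..N}" by (simp add: words_iff)
      have "B (v @ x) \<le> D * B (1 # (v @ x))" using x v one by (intro B_Cons) auto
      also have "B (1 # (v @ x)) \<le> (\<Sum>a\<in>{1..N}. B (a # v @ x))"
        using one x v by (intro member_le_sum[where f = "\<lambda>a. B (a # v @ x)"])
            (auto intro!: less_imp_le[OF B_pos])
      finally show "B (v @ x) \<le> D * (\<Sum>a\<in>{1..N}. B (a # v @ x))" using D by simp
    qed
    also have "\<dots> = D * ?S"
      unfolding Suc sum_words_Suc sum_distrib_left[symmetric] by (subst sum.swap) simp
    finally show ?thesis .
  qed
  finally have "\<kappa> * B x * Z m \<le> (D + 1) * ?S" by (simp add: algebra_simps)
  then show ?thesis using B_pos[OF x] by (intro cE_mult_le) auto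
qed

text \<open>Entropy plus mean energy, that is, minus the relative entropy of \<open>m\<close> with
  respect to \<open>B\<close> on words of length \<open>n\<close>.\<close>

definition free_energy :: "(nat list \<Rightarrow> real) \<Rightarrow> nat \<Rightarrow> real" where
  "free_energy m n = (\<Sum>w\<in>words N n. m w * (ln (B w) - ln (m w)))"

lemma free_energy_subadditive:
  assumes inv: "invariant_weight N m"
  shows "free_energy m (n + k) \<le> free_energy m n + free_energy m k"
proof -
  have eq: "free_energy m n = block_entropy N m n + (\<Sum>w\<in>words N n. m w * ln (B w))" for n
    unfolding free_energy_def block_entropy_def
    by (simp add: right_diff_distrib sum.distrib[symmetric] sum_subtractf sum_negf)
  have "(\<Sum>w\<in>words N (n + k). m w * ln (B w))
     \<le> (\<Sum>w\<in>words N n. m w * ln (B w)) + (\<Sum>w\<in>words N k. m w * ln (B w))"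
  proof (rule sum_weight_append[OF inv])
    fix u v assume uv: "u \<in> lists {1..N}" "v \<in> lists {1..N}"
    then have "ln (B (u @ v)) \<le> ln (B u * B v)"
      using B_append B_pos by (subst ln_le_cancel_iff) auto
    also have "\<dots> = ln (B u) + ln (B v)" using B_pos uv by (simp add: ln_mult_pos)
    finally show "ln (B (u @ v)) \<le> ln (B u) + ln (B v)" .
  qed
  then show ?thesis
    using block_entropy_subadditive[OF inv, of n k] unfolding eq by linarith
qed

text \<open>By subadditivity a negative value would grow linearly along the multiples of its block
  length. Hence errors that are bounded in \<open>n\<close> cost nothing when nonnegativity is to be
  shown.\<close>

lemma free_energy_nonneg_of_bounded_below:
  assumes inv: "invariant_weight N m" and K: "\<And>n. - K \<le> free_energy m n"
  shows "0 \<le> free_energy m n"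
proof (rule ccontr)
  assume neg: "\<not> ?thesis"
  define x where "x = - free_energy m n"
  have x: "x > 0" using neg by (simp add: x_def)
  obtain k :: nat where k: "(K + free_energy m 0) / x < real k" using reals_Archimedean2 by blast
  have "- K \<le> free_energy m (k * n + 0)" by (rule K)
  also have "\<dots> \<le> real k * free_energy m n + free_energy m 0"
    by (rule subadditive_mult_le) (rule free_energy_subadditive[OF inv])
  finally have "real k * x \<le> K + free_energy m 0" by (simp add: x_def)
  then show False using k x by (simp add: field_simps)
qed

text \<open>Each term is estimated by \<open>ln x \<le> x - 1\<close> after scaling by
  \<open>l\<close>. Taking \<open>l\<close> near the \<open>B\<close>-mass of \<open>X\<close> makes
  the bound very negative when \<open>X\<close> is heavy for \<open>m\<close> but light for
  \<open>B\<close>.\<close>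

lemma log_sum_le:
  assumes inv: "invariant_weight N m" and X: "finite X" "X \<subseteq> lists {1..N}" and l: "l > 0"
  shows "(\<Sum>w\<in>X. m w * (ln (B w) - ln (m w))) \<le> (\<Sum>w\<in>X. m w) * ln l + (\<Sum>w\<in>X. B w) / l"
proof -
  have "(\<Sum>w\<in>X. m w * (ln (B w) - ln (m w))) \<le> (\<Sum>w\<in>X. m w * ln l + B w / l)"
  proof (rule sum_mono)
    fix w assume "w \<in> X"
    then have w: "w \<in> lists {1..N}" using X by auto
    then have B: "B w > 0" by (rule B_pos)
    have "0 \<le> m w" using invariant_weight_nonneg[OF inv w] .
    show "m w * (ln (B w) - ln (m w)) \<le> m w * ln l + B w / l"
    proof (cases "m w = 0")
      case True
      then show ?thesis using B l by simp
    next
      case False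
      with \<open>0 \<le> m w\<close> have m: "m w > 0" by simp
      have "ln (B w) - ln (m w) - ln l = ln (B w / (m w * l))"
        using m B l by (simp add: ln_div ln_mult_pos)
      also have "\<dots> \<le> B w / (m w * l) - 1" using m B l by (intro ln_le_minus_one) simp
      finally have "m w * (ln (B w) - ln (m w) - ln l) \<le> m w * (B w / (m w * l) - 1)"
        using m by (intro mult_left_mono) auto
      also have "\<dots> = B w / l - m w" using m l by (simp add: field_simps)
      finally show ?thesis using m by (simp add: algebra_simps)
    qed
  qed
  also have "\<dots> = (\<Sum>w\<in>X. m w) * ln l + (\<Sum>w\<in>X. B w) / l"
    by (simp add: sum.distrib sum_distrib_right sum_divide_distrib)
  finally show ?thesis .
qed

end

text \<open>Only blocks starting at multiples of \<open>L\<close> are tested. The set is then a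
  product, and its masses can be followed one block at a time.\<close>

primrec avoiding :: "nat \<Rightarrow> nat \<Rightarrow> nat list set \<Rightarrow> nat \<Rightarrow> nat list set" where
  "avoiding N L T 0 = {[]}"
| "avoiding N L T (Suc j) = (\<lambda>(x, b). x @ b) ` (avoiding N L T j \<times> (words N L - T))"

lemma avoiding_subset: "avoiding N L T j \<subseteq> words N (j * L)"
proof (induction j)
  case (Suc j)
  then show ?case
    using words_appendI[of _ N "j * L" _ L] by (fastforce simp: add.commute)
qed simp

lemma sum_avoiding_Suc:
  "(\<Sum>x\<in>avoiding N L T (Suc j). f x) = (\<Sum>x\<in>avoiding N L T j. \<Sum>b\<in>words N L - T. f (x @ b))"
proof -
  have "inj_on (\<lambda>(x, b). x @ b) (avoiding N L T j \<times> (words N L - T))"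
    using avoiding_subset[of N L T j] by (fastforce simp: inj_on_def words_iff)
  then show ?thesis
    unfolding avoiding.simps by (subst sum.reindex) (simp_all add: sum.cartesian_product case_prod_beta)
qed

section \<open>The lower bound for weights of nonnegative free energy\<close>

context word_weight
begin

text \<open>The factor \<open>\<kappa> / (1 + D)\<close> pays for joining \<open>w\<close> to a
  prefix and padding it by a letter, \<open>cE\<close> and \<open>1 / CZ\<close> for comparing sums
  over continuations with \<open>B\<close> itself.\<close>

definition cT :: real where "cT = cE * (\<kappa> / (1 + D)) / CZ"

lemma cT_pos: "0 < cT" using cE_pos \<kappa> D CZ_pos by (simp add: cT_def)

text \<open>Blocks containing \<open>w\<close> with one letter of room: either the connecting letter
  of \<open>B_quasi\<close> in front or a padding letter behind, so that all have the same
  length.\<close>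

definition touching :: "nat list \<Rightarrow> nat list set" where
  "touching w = (\<lambda>a. w @ [a]) ` {1..N} \<union> (\<lambda>a. a # w) ` {1..N}"

lemma touching_subset:
  assumes "w \<in> lists {1..N}"
  shows "touching w \<subseteq> words N (Suc (length w))"
  using assms by (auto simp: touching_def words_iff)

lemma touching_weight:
  assumes inv: "invariant_weight N m" and w: "w \<in> lists {1..N}"
  shows "(\<Sum>b\<in>touching w. m b) \<le> 2 * m w"
proof -
  have "(\<Sum>b\<in>touching w. m b) \<le> (\<Sum>b\<in>(\<lambda>a. w @ [a]) ` {1..N}. m b) + (\<Sum>b\<in>(\<lambda>a. a # w) ` {1..N}. m b)"
  proof -
    have "0 \<le> (\<Sum>b\<in>(\<lambda>a. w @ [a]) ` {1..N} \<inter> (\<lambda>a. a # w) ` {1..N}. m b)"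
      using w by (intro sum_nonneg) (auto intro!: invariant_weight_nonneg[OF inv])
    then show ?thesis unfolding touching_def by (subst sum_Un) auto
  qed
  also have "\<dots> = (\<Sum>a\<in>{1..N}. m (w @ [a])) + (\<Sum>a\<in>{1..N}. m (a # w))"
    by (subst (1 2) sum.reindex) (auto simp: inj_on_def)
  also have "\<dots> = 2 * m w"
    using inv w unfolding invariant_weight_def by simp
  finally show ?thesis .
qed

text \<open>After any prefix \<open>x\<close>, \<open>B_quasi\<close> places \<open>w\<close> behind
  it, directly or after a letter. All continuation sums are comparable to \<open>B x\<close>, so
  \<open>l\<close> and \<open>r\<close> may be arbitrary.\<close>

lemma touching_B:
  assumes x: "x \<in> lists {1..N}" and w: "w \<in> lists {1..N}"
  shows "cT * B w * (\<Sum>y\<in>words N l. B (x @ y))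
    \<le> (\<Sum>b\<in>touching w. \<Sum>y\<in>words N r. B (x @ b @ y))"
proof -
  have Bx: "0 < B x" "0 < B w" using x w B_pos by auto
  have "\<exists>b\<in>touching w. \<kappa> / (1 + D) * B x * B w \<le> B (x @ b)"
    using B_quasi[OF x w]
  proof
    assume "\<kappa> * B x * B w \<le> B (x @ w)"
    also have "\<dots> \<le> D * B ((x @ w) @ [1])" using x w one by (intro B_snoc) auto
    also have "\<dots> \<le> (1 + D) * B ((x @ w) @ [1])"
    proof (rule mult_right_mono)
      have "(x @ w) @ [1] \<in> lists {1..N}" using x w one by auto
      then show "0 \<le> B ((x @ w) @ [1])" by (rule less_imp_le[OF B_pos])
    qed simp
    finally have "\<kappa> / (1 + D) * B x * B w \<le> B (x @ (w @ [1]))"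
      using D by (simp add: field_simps)
    moreover have "w @ [1] \<in> touching w" unfolding touching_def using one by blast
    ultimately show ?thesis by blast
  next
    assume "\<exists>a\<in>{1..N}. \<kappa> * B x * B w \<le> B (x @ a # w)"
    then obtain a where a: "a \<in> {1..N}" "\<kappa> * B x * B w \<le> B (x @ a # w)" by blast
    have "\<kappa> / (1 + D) * B x * B w \<le> \<kappa> * B x * B w"
      using D \<kappa> Bx by (intro mult_right_mono) (auto simp: field_simps)
    with a have "\<kappa> / (1 + D) * B x * B w \<le> B (x @ (a # w))" by simp
    moreover have "a # w \<in> touching w" unfolding touching_def using a by blast
    ultimately show ?thesis by blast
  qed
  then obtain b where b: "b \<in> touching w" "\<kappa> / (1 + D) * B x * B w \<le> B (x @ b)" by blast
  have tl: "b \<in> lists {1..N}" if "b \<in> touching w" for b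
    using touching_subset[OF w] that words_in_lists by blast
  have "cT * B w * (\<Sum>y\<in>words N l. B (x @ y)) \<le> cT * B w * (B x * CZ)"
    using sum_right_le[OF x] cT_pos Bx by (intro mult_left_mono) auto
  also have "\<dots> = cE * (\<kappa> / (1 + D) * B x * B w)"
    using CZ_pos by (simp add: cT_def)
  also have "\<dots> \<le> cE * B (x @ b)" using b cE_pos by (intro mult_left_mono) auto
  also have "\<dots> \<le> (\<Sum>y\<in>words N r. B ((x @ b) @ y))"
    using x tl[OF b(1)] by (intro sum_right_ge) auto
  also have "\<dots> \<le> (\<Sum>b\<in>touching w. \<Sum>y\<in>words N r. B (x @ b @ y))"
  proof -
    have "(\<Sum>y\<in>words N r. B (x @ b @ y)) \<le> (\<Sum>b\<in>touching w. \<Sum>y\<in>words N r. B (x @ b @ y))"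
    proof (rule member_le_sum[where f = "\<lambda>b. \<Sum>y\<in>words N r. B (x @ b @ y)"])
      show "0 \<le> (\<Sum>y\<in>words N r. B (x @ b @ y))" if "b \<in> touching w - {b'}" for b b'
        using that x tl[of b] by (intro sum_nonneg less_imp_le[OF B_pos]) (auto simp: words_iff)
    qed (use b in \<open>auto simp: touching_def\<close>)
    then show ?thesis by simp
  qed
  finally show ?thesis .
qed

text \<open>Every block multiplies the mass by at most \<open>1 - cT * B w\<close>, which is below
  an exponential. The free tail of \<open>r\<close> letters is generalised because removing a block
  turns \<open>r\<close> into \<open>L + r\<close>.\<close>

lemma sum_avoiding_touching_B:
  assumes w: "w \<in> lists {1..N}"
  defines "L \<equiv> Suc (length w)"
  shows "(\<Sum>x\<in>avoiding N L (touching w) j. \<Sum>y\<in>words N r. B (x @ y))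
     \<le> exp (- cT * B w * real j) * CZ"
proof (induction j arbitrary: r)
  case 0
  show ?case using Z_le[of r] by (simp add: Z_def)
next
  case (Suc j)
  let ?T = "touching w" and ?A = "avoiding N L (touching w)"
  have T: "?T \<subseteq> words N L" using touching_subset[OF w] by (simp add: L_def)
  have "(\<Sum>x\<in>?A (Suc j). \<Sum>y\<in>words N r. B (x @ y))
      = (\<Sum>x\<in>?A j. \<Sum>b\<in>words N L - ?T. \<Sum>y\<in>words N r. B (x @ b @ y))"
    unfolding sum_avoiding_Suc by simp
  also have "\<dots> = (\<Sum>x\<in>?A j. (\<Sum>y\<in>words N (L + r). B (x @ y)) - (\<Sum>b\<in>?T. \<Sum>y\<in>words N r. B (x @ b @ y)))"
    using T by (simp add: sum_diff sum_words_add)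
  also have "\<dots> \<le> (\<Sum>x\<in>?A j. exp (- cT * B w) * (\<Sum>y\<in>words N (L + r). B (x @ y)))"
  proof (rule sum_mono)
    fix x assume "x \<in> ?A j"
    then have x: "x \<in> lists {1..N}" using avoiding_subset[of N L ?T j] words_in_lists by blast
    let ?S = "\<Sum>y\<in>words N (L + r). B (x @ y)"
    have S: "0 \<le> ?S" using x by (intro sum_nonneg less_imp_le[OF B_pos]) (auto simp: words_iff)
    have "?S - (\<Sum>b\<in>?T. \<Sum>y\<in>words N r. B (x @ b @ y)) \<le> ?S - cT * B w * ?S"
      using touching_B[OF x w] by simp
    also have "\<dots> = (1 + (- cT * B w)) * ?S" by (simp add: algebra_simps)
    also have "\<dots> \<le> exp (- cT * B w) * ?S"
      using S by (intro mult_right_mono exp_ge_add_one_self)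
    finally show "?S - (\<Sum>b\<in>?T. \<Sum>y\<in>words N r. B (x @ b @ y)) \<le> exp (- cT * B w) * ?S" .
  qed
  also have "\<dots> = exp (- cT * B w) * (\<Sum>x\<in>?A j. \<Sum>y\<in>words N (L + r). B (x @ y))"
    by (simp add: sum_distrib_left)
  also have "\<dots> \<le> exp (- cT * B w) * (exp (- cT * B w * real j) * CZ)"
    by (intro mult_left_mono Suc.IH) auto
  also have "\<dots> = exp (- cT * B w * real (Suc j)) * CZ"
    by (simp add: exp_add[symmetric] algebra_simps)
  finally show ?case .
qed

text \<open>Union bound over the \<open>j\<close> blocks: by invariance a block touches
  \<open>w\<close> with probability at most \<open>2 * m w\<close>, wherever it stands.\<close>

lemma sum_avoiding_touching_weight:
  assumes inv: "invariant_weight N m" and w: "w \<in> lists {1..N}"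
  defines "L \<equiv> Suc (length w)"
  shows "1 - 2 * m w * real j \<le> (\<Sum>x\<in>avoiding N L (touching w) j. m x)"
proof (induction j)
  case 0
  show ?case using inv by (simp add: invariant_weight_def)
next
  case (Suc j)
  let ?T = "touching w" and ?A = "avoiding N L (touching w)"
  have T: "?T \<subseteq> words N L" using touching_subset[OF w] by (simp add: L_def)
  have xl: "x \<in> words N (j * L)" if "x \<in> ?A j" for x
    using that avoiding_subset[of N L ?T j] by auto
  have "(\<Sum>x\<in>?A (Suc j). m x) = (\<Sum>x\<in>?A j. (\<Sum>b\<in>words N L. m (x @ b)) - (\<Sum>b\<in>?T. m (x @ b)))"
    unfolding sum_avoiding_Suc using T by (simp add: sum_diff)
  also have "\<dots> = (\<Sum>x\<in>?A j. m x) - (\<Sum>b\<in>?T. \<Sum>x\<in>?A j. m (x @ b))"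
    using invariant_weight_sum_right[OF inv words_in_lists[OF xl]]
    by (subst sum.swap) (simp add: sum_subtractf)
  finally have eq: "(\<Sum>x\<in>?A (Suc j). m x) = (\<Sum>x\<in>?A j. m x) - (\<Sum>b\<in>?T. \<Sum>x\<in>?A j. m (x @ b))" .
  have "(\<Sum>b\<in>?T. \<Sum>x\<in>?A j. m (x @ b)) \<le> (\<Sum>b\<in>?T. m b)"
  proof (rule sum_mono)
    fix b assume "b \<in> ?T"
    then have b: "b \<in> lists {1..N}" using T words_in_lists by blast
    have "(\<Sum>x\<in>?A j. m (x @ b)) \<le> (\<Sum>x\<in>words N (j * L). m (x @ b))"
      using avoiding_subset[of N L ?T j] b
      by (intro sum_mono2) (auto simp: words_iff intro!: invariant_weight_nonneg[OF inv])
    then show "(\<Sum>x\<in>?A j. m (x @ b)) \<le> m b" using invariant_weight_sum_left[OF inv b] by simp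
  qed
  also have "(\<Sum>b\<in>?T. m b) \<le> 2 * m w" by (rule touching_weight[OF inv w])
  finally show ?case using Suc unfolding eq by (simp add: algebra_simps)
qed

text \<open>If \<open>m w\<close> were much smaller than \<open>B w\<close>, then for suitable \<open>J\<close> the words consisting of \<open>J\<close> blocks
  that all avoid \<open>w\<close> would carry most of \<open>m\<close> but little of \<open>B\<close>, making the free energy negative.\<close>

lemma equilibrium_weight_ge:
  obtains c where "c > 0"
    "\<And>m w. invariant_weight N m \<Longrightarrow> (\<And>n. 0 \<le> free_energy m n) \<Longrightarrow> w \<in> lists {1..N} \<Longrightarrow> c * B w \<le> m w"
proof -
  \<comment> \<open>Chosen such that a set of \<open>m\<close>-mass \<open>1 / 2\<close> loses
    \<open>cT * T / 2 = 2 * CZ + 1\<close>, which is one more than the two terms \<open>CZ\<close>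
    can make up for.\<close>
  define T where "T = (4 * CZ + 2) / cT"
  have T: "T > 0" using CZ_pos cT_pos by (simp add: T_def)
  \<comment> \<open>Makes \<open>m w * real J \<le> 1 / 4\<close> for about \<open>T / B w\<close>
    blocks, so that the union bound leaves mass \<open>1 / 2\<close> to \<open>X\<close>.\<close>
  define c where "c = 1 / (4 * (T + CZ))"
  have c: "c > 0" using T CZ_pos by (simp add: c_def)
  have "c * B w \<le> m w" if inv: "invariant_weight N m" and free: "\<And>n. 0 \<le> free_energy m n"
    and w: "w \<in> lists {1..N}" for m w
  proof (rule ccontr)
    assume "\<not> ?thesis"
    then have less: "m w < c * B w" by simp
    have Bw: "0 < B w" "B w \<le> CZ" using B_pos B_le_CZ w by auto
    have m0: "0 \<le> m w" using invariant_weight_nonneg[OF inv w] .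
    define J where "J = nat \<lceil>T / B w\<rceil>"
    define L where "L = Suc (length w)"
    define X where "X = avoiding N L (touching w) J"
    have TB: "0 < T / B w" using T Bw by simp
    have J1: "T / B w \<le> real J" using TB unfolding J_def by linarith
    have J2: "real J \<le> T / B w + 1" using TB unfolding J_def by linarith
    have "m w * real J \<le> (c * B w) * (T / B w + 1)"
      using less m0 J2 by (intro mult_mono) auto
    also have "\<dots> = c * (T + B w)" using Bw by (simp add: field_simps)
    also have "\<dots> \<le> c * (T + CZ)" using Bw c by (intro mult_left_mono) auto
    also have "\<dots> = 1 / 4" using T CZ_pos by (simp add: c_def field_simps)
    finally have mJ: "m w * real J \<le> 1 / 4" .
    have XW: "X \<subseteq> words N (J * L)" unfolding X_def by (rule avoiding_subset)
    have mX: "1 / 2 \<le> (\<Sum>x\<in>X. m x)"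
      using sum_avoiding_touching_weight[OF inv w, where j = J] mJ unfolding X_def L_def by linarith
    define l where "l = exp (- (cT * T))"
    have BX: "(\<Sum>x\<in>X. B x) \<le> l * CZ"
    proof -
      have "(\<Sum>x\<in>X. B x) \<le> exp (- cT * B w * real J) * CZ"
        using sum_avoiding_touching_B[OF w, where j = J and r = 0] unfolding X_def L_def by simp
      also have "\<dots> \<le> l * CZ"
      proof -
        have "T \<le> B w * real J" using J1 Bw by (simp add: field_simps)
        then have "cT * T \<le> cT * (B w * real J)" using cT_pos by (intro mult_left_mono) auto
        then show ?thesis unfolding l_def using CZ_pos by (intro mult_right_mono) (auto simp: mult.assoc)
      qed
      finally show ?thesis .
    qed
    have XL: "X \<subseteq> lists {1..N}" using XW words_in_lists by blast
    have fX: "finite X" using XW finite_subset finite_words by metis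
    have "0 \<le> free_energy m (J * L)" by (rule free)
    also have "free_energy m (J * L) = (\<Sum>w\<in>X. m w * (ln (B w) - ln (m w)))
        + (\<Sum>w\<in>words N (J * L) - X. m w * (ln (B w) - ln (m w)))"
      unfolding free_energy_def using XW by (simp add: sum.subset_diff add.commute)
    \<comment> \<open>The scale is \<open>l\<close> on the light set \<open>X\<close> and
      \<open>1\<close> on its complement.\<close>
    also have "\<dots> \<le> ((\<Sum>w\<in>X. m w) * ln l + (\<Sum>w\<in>X. B w) / l)
       + ((\<Sum>w\<in>words N (J * L) - X. m w) * ln 1 + (\<Sum>w\<in>words N (J * L) - X. B w) / 1)"
      using XL fX by (intro add_mono log_sum_le[OF inv]) (auto simp: l_def words_iff)
    also have "\<dots> \<le> ((\<Sum>w\<in>X. m w) * (- (cT * T)) + CZ) + CZ"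
    proof -
      have "(\<Sum>w\<in>X. B w) / l \<le> CZ" using BX by (simp add: l_def field_simps)
      moreover have "(\<Sum>w\<in>words N (J * L) - X. B w) \<le> (\<Sum>w\<in>words N (J * L). B w)"
        by (intro sum_mono2) (auto simp del: One_nat_def simp: words_iff intro!: less_imp_le[OF B_pos] dest: subsetD[OF XW])
      ultimately show ?thesis using Z_le[of "J * L"] by (simp add: Z_def l_def)
    qed
    also have "\<dots> \<le> (1 / 2) * (- (cT * T)) + 2 * CZ"
      using mult_right_mono[OF mX, of "cT * T"] cT_pos T by simp
    also have "\<dots> = -1" using cT_pos by (simp add: T_def field_simps)
    finally show False by simp
  qed
  with c that show ?thesis by blast
qed

section \<open>An invariant weight below a multiple of \<open>B\<close>\<close>

definition two_sided :: "nat \<Rightarrow> nat \<Rightarrow> nat list \<Rightarrow> real" where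
  "two_sided j l w = (\<Sum>x\<in>words N j. \<Sum>y\<in>words N l. B (x @ w @ y))"

lemma two_sided_bounds:
  assumes w: "w \<in> lists {1..N}"
  shows "cE * cE * B w \<le> two_sided j l w" "two_sided j l w \<le> CZ * CZ * B w"
proof -
  have "cE * (cE * B w) \<le> cE * (\<Sum>x\<in>words N j. B (x @ w))"
    using sum_left_ge[OF w] cE_pos by (intro mult_left_mono) auto
  also have "\<dots> = (\<Sum>x\<in>words N j. cE * B (x @ w))" by (rule sum_distrib_left)
  also have "\<dots> \<le> (\<Sum>x\<in>words N j. \<Sum>y\<in>words N l. B ((x @ w) @ y))"
    using w by (intro sum_mono sum_right_ge) (auto simp: words_iff)
  finally show "cE * cE * B w \<le> two_sided j l w" by (simp add: two_sided_def mult.assoc)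
  have "two_sided j l w = (\<Sum>x\<in>words N j. \<Sum>y\<in>words N l. B ((x @ w) @ y))"
    by (simp add: two_sided_def)
  also have "\<dots> \<le> (\<Sum>x\<in>words N j. B (x @ w) * CZ)"
    using w by (intro sum_mono sum_right_le) (auto simp: words_iff)
  also have "\<dots> = (\<Sum>x\<in>words N j. B (x @ w)) * CZ" by (rule sum_distrib_right[symmetric])
  also have "\<dots> \<le> CZ * B w * CZ" using sum_left_le[OF w] CZ_pos by (intro mult_right_mono) auto
  finally show "two_sided j l w \<le> CZ * CZ * B w" by (simp add: algebra_simps)
qed

lemma two_sided_snoc: "(\<Sum>a\<in>{1..N}. two_sided j l (w @ [a])) = two_sided j (Suc l) w"
  unfolding two_sided_def sum_words_Suc by (subst sum.swap) simp

lemma two_sided_Cons: "(\<Sum>a\<in>{1..N}. two_sided j l (a # w)) = two_sided (Suc j) l w"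
  unfolding two_sided_def sum_words_Suc' by (subst sum.swap) simp

text \<open>A Krylov-Bogolyubov argument: the masses that \<open>B\<close> gives to occurrences of
  \<open>w\<close> at position \<open>j\<close> in words of length \<open>2 * n\<close> are averaged
  over \<open>j < n\<close>. Appending a letter is exactly consistent; prepending one shifts
  \<open>j\<close>, so the average changes only by boundary terms divided by \<open>n\<close>. The
  limit along a subsequence is normalised at the empty word.\<close>

lemma exists_gibbs_weight:
  obtains \<nu> c where "invariant_weight N \<nu>" "c > 0"
    "\<And>w. w \<in> lists {1..N} \<Longrightarrow> \<nu> w \<le> c * B w"
proof -
  \<comment> \<open>For \<open>length w < n\<close> and \<open>j < n\<close> the subtraction is not
    truncated, even after appending a letter, and the total length is \<open>2 * n\<close>.\<close>
  define g where "g n j w = two_sided j (2 * n - j - length w) w" for n j w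
  define f where "f n w = (if w \<in> lists {1..N} then (\<Sum>j<n. g n j w) / real n else 0)" for n w
  have gb: "cE * cE * B w \<le> g n j w" "g n j w \<le> CZ * CZ * B w" if "w \<in> lists {1..N}" for n j w
    unfolding g_def using two_sided_bounds[OF that] by auto
  have g0: "0 \<le> g n j w" if "w \<in> lists {1..N}" for n j w
    using gb(1)[OF that, of n j] B_pos[OF that] cE_pos by (smt (verit) mult_pos_pos)
  have f0: "0 \<le> f n w" for n w
    unfolding f_def using g0 by (auto intro!: divide_nonneg_nonneg sum_nonneg)
  have f1: "f n w \<le> CZ * CZ * B w" if w: "w \<in> lists {1..N}" for n w
  proof (cases "n = 0")
    case True
    then show ?thesis using B_pos[OF w] CZ_pos by (simp add: f_def)
  next
    case False
    have "(\<Sum>j<n. g n j w) \<le> (\<Sum>j<n. CZ * CZ * B w)" by (intro sum_mono gb w)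
    then show ?thesis using w False by (simp add: f_def field_simps)
  qed
  have fb: "\<bar>f n w\<bar> \<le> CZ * CZ * \<bar>B w\<bar>" for n w
  proof (cases "w \<in> lists {1..N}")
    case True
    then show ?thesis using f0 f1[OF True] B_pos[OF True] by (simp add: abs_of_nonneg)
  next
    case False
    then show ?thesis by (simp add: f_def)
  qed
  obtain r h where rh: "strict_mono (r :: nat \<Rightarrow> nat)" "\<And>w. (\<lambda>n. f (r n) w) \<longlonglongrightarrow> h w"
    using pointwise_convergent_subsequence[of f "\<lambda>w. CZ * CZ * \<bar>B w\<bar>", OF fb] by metis
  have h0: "0 \<le> h w" for w
    by (rule LIMSEQ_le_const[OF rh(2)]) (use f0 in auto)
  have h1: "h w \<le> CZ * CZ * B w" if "w \<in> lists {1..N}" for w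
    by (rule LIMSEQ_le_const2[OF rh(2)]) (use f1[OF that] in auto)
  have hpos: "0 < h []"
  proof -
    have "cE * cE * B [] \<le> f n []" if "n \<ge> 1" for n
    proof -
      have "(\<Sum>j<n. cE * cE * B []) \<le> (\<Sum>j<n. g n j [])" by (intro sum_mono gb) auto
      then show ?thesis using that by (simp add: f_def field_simps)
    qed
    then have "cE * cE * B [] \<le> h []"
      using seq_suble[OF rh(1)]
      by (intro LIMSEQ_le_const[OF rh(2)] exI[of _ 1]) (meson order_trans)
    moreover have "0 < cE * cE * B []" using cE_pos B_pos[of "[]"] by simp
    ultimately show ?thesis by linarith
  qed
  have right: "(\<Sum>a\<in>{1..N}. h (w @ [a])) = h w" if w: "w \<in> lists {1..N}" for w
  proof -
    have "(\<lambda>n. \<Sum>a\<in>{1..N}. f (r n) (w @ [a])) \<longlonglongrightarrow> (\<Sum>a\<in>{1..N}. h (w @ [a]))"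
      by (intro tendsto_sum rh)
    moreover have "\<forall>\<^sub>F n in sequentially. (\<Sum>a\<in>{1..N}. f (r n) (w @ [a])) = f (r n) w"
    proof (rule eventually_sequentiallyI)
      fix k assume "Suc (length w) \<le> k"
      then have k: "length w < r k" using seq_suble[OF rh(1), of k] by simp
      define n where "n = r k"
      have "(\<Sum>a\<in>{1..N}. f n (w @ [a])) = (\<Sum>a\<in>{1..N}. \<Sum>j<n. g n j (w @ [a])) / real n"
        unfolding sum_divide_distrib using w by (intro sum.cong) (auto simp: f_def sum_divide_distrib)
      also have "(\<Sum>a\<in>{1..N}. \<Sum>j<n. g n j (w @ [a])) = (\<Sum>j<n. \<Sum>a\<in>{1..N}. g n j (w @ [a]))"
        by (rule sum.swap)
      also have "\<dots> = (\<Sum>j<n. g n j w)"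
      proof (rule sum.cong[OF refl])
        fix j assume "j \<in> {..<n}"
        then have "2 * n - j - length w = Suc (2 * n - j - length (w @ [a]))" for a
          using k by (simp add: n_def)
        then show "(\<Sum>a\<in>{1..N}. g n j (w @ [a])) = g n j w"
          unfolding g_def using two_sided_snoc[of j "2 * n - j - Suc (length w)" w] by simp
      qed
      finally show "(\<Sum>a\<in>{1..N}. f (r k) (w @ [a])) = f (r k) w"
        using w by (simp add: f_def n_def)
    qed
    ultimately have "(\<lambda>n. f (r n) w) \<longlonglongrightarrow> (\<Sum>a\<in>{1..N}. h (w @ [a]))"
      by (rule Lim_transform_eventually)
    then show ?thesis using rh(2) LIMSEQ_unique by blast
  qed
  have left: "(\<Sum>a\<in>{1..N}. h (a # w)) = h w" if w: "w \<in> lists {1..N}" for w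
  proof -
    have "(\<lambda>n. (\<Sum>a\<in>{1..N}. f (r n) (a # w)) - f (r n) w) \<longlonglongrightarrow> (\<Sum>a\<in>{1..N}. h (a # w)) - h w"
      by (intro tendsto_diff tendsto_sum rh)
    moreover have "(\<lambda>n. (\<Sum>a\<in>{1..N}. f (r n) (a # w)) - f (r n) w) \<longlonglongrightarrow> 0"
    proof -
      have bd: "\<bar>(\<Sum>a\<in>{1..N}. f n (a # w)) - f n w\<bar> \<le> CZ * CZ * B w * (1 / real n)" for n
      proof -
        have "(\<Sum>a\<in>{1..N}. f n (a # w)) = (\<Sum>a\<in>{1..N}. \<Sum>j<n. g n j (a # w)) / real n"
          unfolding sum_divide_distrib using w by (intro sum.cong) (auto simp: f_def sum_divide_distrib)
        also have "(\<Sum>a\<in>{1..N}. \<Sum>j<n. g n j (a # w)) = (\<Sum>j<n. \<Sum>a\<in>{1..N}. g n j (a # w))"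
          by (rule sum.swap)
        also have "\<dots> = (\<Sum>j<n. g n (Suc j) w)"
          unfolding g_def using two_sided_Cons[of _ _ w] by simp
        finally have "(\<Sum>a\<in>{1..N}. f n (a # w)) - f n w = (\<Sum>j<n. g n (Suc j) w - g n j w) / real n"
          using w by (simp add: f_def sum_subtractf diff_divide_distrib)
        also have "(\<Sum>j<n. g n (Suc j) w - g n j w) = g n n w - g n 0 w"
          by (rule sum_lessThan_telescope)
        finally have e: "(\<Sum>a\<in>{1..N}. f n (a # w)) - f n w = (g n n w - g n 0 w) / real n" .
        have "\<bar>g n n w - g n 0 w\<bar> \<le> CZ * CZ * B w"
          using gb(2)[OF w, of n n] gb(2)[OF w, of n 0] g0[OF w, of n n] g0[OF w, of n 0] by linarith
        then show ?thesis unfolding e by (simp add: divide_right_mono)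
      qed
      have "(\<lambda>n. CZ * CZ * B w * (1 / real (r n))) \<longlonglongrightarrow> CZ * CZ * B w * 0"
        using LIMSEQ_subseq_LIMSEQ[OF lim_1_over_n rh(1)] by (intro tendsto_mult tendsto_const) (simp add: o_def)
      then have "(\<lambda>n. CZ * CZ * B w * (1 / real (r n))) \<longlonglongrightarrow> 0" by simp
      then show ?thesis by (rule Lim_null_comparison[rotated]) (use bd in auto)
    qed
    ultimately show ?thesis using LIMSEQ_unique by fastforce
  qed
  define \<nu> where "\<nu> w = h w / h []" for w
  have "invariant_weight N \<nu>"
    unfolding invariant_weight_def \<nu>_def using h0 hpos right left
    by (simp add: sum_divide_distrib[symmetric])
  moreover have "0 < CZ * CZ / h []" using CZ_pos hpos by simp
  moreover have "\<nu> w \<le> CZ * CZ / h [] * B w" if "w \<in> lists {1..N}" for w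
    unfolding \<nu>_def using divide_right_mono[OF h1[OF that], of "h []"] hpos by simp
  ultimately show ?thesis using that by blast
qed

text \<open>Entropy is affine up to a bounded error, so removing a multiple of \<open>\<nu>\<close> from an equilibrium
  weight leaves an equilibrium weight, to which the universal lower bound applies again.\<close>

lemma free_energy_remainder:
  assumes m: "invariant_weight N m" and \<nu>: "invariant_weight N \<nu>" and t: "0 < t" "t < 1"
    and le: "\<And>w. w \<in> lists {1..N} \<Longrightarrow> t * \<nu> w \<le> m w" and free: "\<And>n. 0 \<le> free_energy m n"
  defines "m' \<equiv> \<lambda>w. (m w - t * \<nu> w) / (1 - t)"
  shows "invariant_weight N m'" "0 \<le> free_energy m' n"
proof -
  show inv: "invariant_weight N m'"
    unfolding invariant_weight_def
  proof (intro conjI ballI)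
    fix w assume w: "w \<in> lists {1..N}"
    show "0 \<le> m' w" using le[OF w] t by (simp add: m'_def)
    show "(\<Sum>a\<in>{1..N}. m' (w @ [a])) = m' w" "(\<Sum>a\<in>{1..N}. m' (a # w)) = m' w"
      using m \<nu> w unfolding m'_def invariant_weight_def
      by (simp_all only: sum_divide_distrib[symmetric] sum_subtractf sum_distrib_left[symmetric])
  next
    show "m' [] = 1" using m \<nu> t by (simp add: m'_def invariant_weight_def)
  qed
  \<comment> \<open>Entropy of the two-point distribution with masses \<open>t\<close> and
    \<open>1 - t\<close>, the most by which the entropy of a mixture exceeds the mixture of the
    entropies.\<close>
  define H where "H = - t * ln t - (1 - t) * ln (1 - t)"
  have "- ((t * CZ + H) / (1 - t)) \<le> free_energy m' n" for n
  proof -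
    have "0 \<le> free_energy m n" by (rule free)
    also have "free_energy m n \<le> (\<Sum>w\<in>words N n. t * (\<nu> w * (ln (B w) - ln (\<nu> w)))
        + (1 - t) * (m' w * (ln (B w) - ln (m' w))) + (\<nu> w * (- (t * ln t)) + m' w * (- ((1 - t) * ln (1 - t)))))"
      unfolding free_energy_def
    proof (rule sum_mono)
      fix w assume "w \<in> words N n"
      then have w: "w \<in> lists {1..N}" by (simp add: words_iff)
      define p q b where "p = t * \<nu> w" and "q = (1 - t) * m' w" and "b = ln (B w)"
      have mw: "m w = p + q" using t by (simp add: p_def q_def m'_def field_simps)
      have \<nu>0: "0 \<le> \<nu> w" "0 \<le> m' w" using \<nu> inv w by (auto intro: invariant_weight_nonneg)
      have p0: "0 \<le> p" "0 \<le> q" using \<nu>0 t by (auto simp: p_def q_def)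
      \<comment> \<open>Monotonicity of \<open>ln\<close> bounds the term of \<open>p + q\<close> by
        the sum of the terms of \<open>p\<close> and \<open>q\<close>.\<close>
      have *: "x * ln x \<le> x * ln (x + y)" if "0 \<le> x" "0 \<le> y" for x y :: real
        using that by (cases "x = 0") (auto intro!: mult_left_mono)
      have "m w * (b - ln (m w)) \<le> p * (b - ln p) + q * (b - ln q)"
        unfolding mw using *[OF p0] *[OF p0(2,1)] by (simp add: algebra_simps)
      moreover have "p * (b - ln p) = t * (\<nu> w * (b - ln (\<nu> w))) + \<nu> w * (- (t * ln t))"
      proof (cases "\<nu> w = 0")
        case False
        then have "ln p = ln t + ln (\<nu> w)" using \<nu>0 t by (simp add: p_def ln_mult_pos)
        then show ?thesis by (simp add: p_def algebra_simps)
      qed (simp add: p_def)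
      moreover have "q * (b - ln q) = (1 - t) * (m' w * (b - ln (m' w))) + m' w * (- ((1 - t) * ln (1 - t)))"
      proof (cases "m' w = 0")
        case False
        then have "ln q = ln (1 - t) + ln (m' w)" using \<nu>0 t by (simp add: q_def ln_mult_pos)
        then show ?thesis by (simp add: q_def algebra_simps)
      qed (simp add: q_def)
      ultimately show "m w * (ln (B w) - ln (m w)) \<le> t * (\<nu> w * (ln (B w) - ln (\<nu> w)))
        + (1 - t) * (m' w * (ln (B w) - ln (m' w))) + (\<nu> w * (- (t * ln t)) + m' w * (- ((1 - t) * ln (1 - t))))"
        by (simp add: b_def)
    qed
    also have "\<dots> = t * free_energy \<nu> n + (1 - t) * free_energy m' n + H"
      unfolding sum.distrib free_energy_def H_def sum_distrib_left[symmetric] sum_distrib_right[symmetric]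
        invariant_weight_total[OF \<nu>] invariant_weight_total[OF inv] by simp
    also have "t * free_energy \<nu> n \<le> t * CZ"
    proof (rule mult_left_mono)
      have "free_energy \<nu> n \<le> (\<Sum>w\<in>words N n. \<nu> w) * ln 1 + (\<Sum>w\<in>words N n. B w) / 1"
        unfolding free_energy_def by (rule log_sum_le[OF \<nu>]) (auto simp: words_iff)
      then show "free_energy \<nu> n \<le> CZ" using Z_le[of n] by (simp add: Z_def)
    qed (use t in auto)
    finally show ?thesis using t by (simp add: field_simps)
  qed
  then show "0 \<le> free_energy m' n" by (rule free_energy_nonneg_of_bounded_below[OF inv])
qed

text \<open>Let \<open>t\<close> be the largest number with \<open>t * \<nu> w \<le> m w\<close> for
  all \<open>w\<close>. If \<open>t < 1\<close>, the normalised remainder again dominates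
  \<open>e * \<nu>\<close>, so \<open>t + (1 - t) * e\<close> would do as well. Hence
  \<open>t = 1\<close>, and equal total masses force \<open>m = \<nu>\<close> on words, which
  carries the upper bound over to \<open>m\<close>.\<close>

theorem equilibrium_weight_comparable:
  assumes m: "invariant_weight N m" and free: "\<And>n. 0 \<le> free_energy m n"
  obtains C where "C > 0" "\<And>w. w \<in> lists {1..N} \<Longrightarrow> B w / C \<le> m w \<and> m w \<le> C * B w"
proof -
  obtain c where c: "c > 0" "\<And>m w. invariant_weight N m \<Longrightarrow> (\<And>n. 0 \<le> free_energy m n) \<Longrightarrow> w \<in> lists {1..N} \<Longrightarrow> c * B w \<le> m w"
    using equilibrium_weight_ge by blast
  obtain \<nu> d where \<nu>: "invariant_weight N \<nu>" "d > 0" "\<And>w. w \<in> lists {1..N} \<Longrightarrow> \<nu> w \<le> d * B w"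
    using exists_gibbs_weight by blast
  define e where "e = c / d"
  have e: "e > 0" using c \<nu> by (simp add: e_def)
  have ge: "e * \<nu> w \<le> m w" if "invariant_weight N m" "\<And>n. 0 \<le> free_energy m n" "w \<in> lists {1..N}" for m w
  proof -
    have "e * \<nu> w \<le> e * (d * B w)" using \<nu>(3)[OF that(3)] e by (intro mult_left_mono) auto
    also have "\<dots> = c * B w" using \<nu>(2) by (simp add: e_def)
    also have "\<dots> \<le> m w" by (rule c(2)[OF that])
    finally show ?thesis .
  qed
  define S where "S = {t. 0 \<le> t \<and> (\<forall>w\<in>lists {1..N}. t * \<nu> w \<le> m w)}"
  have S1: "t \<le> 1" if "t \<in> S" for t
    using that m \<nu>(1) by (force simp: S_def invariant_weight_def dest: bspec[of _ _ "[]"])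
  have eS: "e \<in> S" using ge[OF m free] e by (auto simp: S_def)
  have bdd: "bdd_above S" using S1 by (auto simp: bdd_above_def)
  define t where "t = Sup S"
  have te: "e \<le> t" unfolding t_def by (rule cSup_upper[OF eS bdd])
  have t1: "t \<le> 1" unfolding t_def using eS S1 by (intro cSup_least) auto
  have tS: "t \<in> S"
  proof -
    have "closed S"
    proof -
      have "S = {0..} \<inter> (\<Inter>w\<in>lists {1..N}. {t. t * \<nu> w \<le> m w})" by (auto simp: S_def)
      also have "closed \<dots>"
        by (intro closed_Int closed_INT ballI closed_Collect_le continuous_intros closed_atLeast)
      finally show ?thesis .
    qed
    then show ?thesis unfolding t_def using eS bdd by (intro closed_contains_Sup) auto
  qed
  have "t = 1"
  proof (rule ccontr)
    assume "t \<noteq> 1"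
    then have t: "0 < t" "t < 1" using te e t1 by auto
    have le: "t * \<nu> w \<le> m w" if "w \<in> lists {1..N}" for w using tS that by (auto simp: S_def)
    note rem = free_energy_remainder[OF m \<nu>(1) t le free]
    have "t + (1 - t) * e \<in> S"
      unfolding S_def
    proof (intro CollectI conjI ballI)
      show "0 \<le> t + (1 - t) * e" using t e by simp
      fix w assume w: "w \<in> lists {1..N}"
      have "e * \<nu> w \<le> (m w - t * \<nu> w) / (1 - t)" by (rule ge[OF rem w])
      then show "(t + (1 - t) * e) * \<nu> w \<le> m w" using t by (simp add: field_simps)
    qed
    then have "t + (1 - t) * e \<le> t" unfolding t_def using bdd by (intro cSup_upper) (auto simp: t_def)
    then show False using t e by (simp add: mult_le_0_iff)
  qed
  then have le: "\<nu> w \<le> m w" if "w \<in> lists {1..N}" for w using tS that by (auto simp: S_def)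
  have eq: "m w = \<nu> w" if w: "w \<in> lists {1..N}" for w
  proof -
    have "(\<Sum>w\<in>words N (length w). m w - \<nu> w) = 0"
      using invariant_weight_total[OF m] invariant_weight_total[OF \<nu>(1)] by (simp add: sum_subtractf)
    then have "\<forall>w\<in>words N (length w). m w - \<nu> w = 0"
      by (subst (asm) sum_nonneg_eq_0_iff) (auto simp del: One_nat_def simp: words_iff le)
    then show ?thesis using w by (auto simp: words_iff)
  qed
  define C where "C = max d (1 / c)"
  have "C > 0" using \<nu> by (simp add: C_def)
  moreover have "B w / C \<le> m w \<and> m w \<le> C * B w" if w: "w \<in> lists {1..N}" for w
  proof
    have "1 / c \<le> C" by (simp add: C_def)
    then have "1 / C \<le> c" using c(1) \<open>C > 0\<close> by (simp add: field_simps)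
    then have "B w * (1 / C) \<le> B w * c" using B_pos[OF w] by (intro mult_left_mono) auto
    then show "B w / C \<le> m w" using c(2)[OF m free w] by (simp add: mult.commute)
    have "d * B w \<le> C * B w" using B_pos[OF w] by (intro mult_right_mono) (auto simp: C_def)
    then show "m w \<le> C * B w" using eq[OF w] \<nu>(3)[OF w] by simp
  qed
  ultimately show ?thesis using that by blast
qed

end

section \<open>Two-by-two matrices\<close>

lemma bounded_linear_mv: "bounded_linear ((*v) (M :: real^2^2))"
  by (rule matrix_vector_mul_bounded_linear)

lemma norm_mv_le: "norm (M *v x) \<le> opnorm M * norm (x :: real^2)"
  unfolding opnorm_def by (rule onorm[OF bounded_linear_mv])

lemma opnorm_nonneg [simp]: "0 \<le> opnorm M"
  unfolding opnorm_def by (rule onorm_pos_le[OF bounded_linear_mv])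

lemma opnorm_leI: "0 \<le> b \<Longrightarrow> (\<And>x. norm (M *v x) \<le> b * norm x) \<Longrightarrow> opnorm M \<le> b"
  unfolding opnorm_def by (rule onorm_bound)

lemma opnorm_mult: "opnorm (A ** B) \<le> opnorm A * opnorm B"
proof (rule opnorm_leI)
  fix x
  have "norm ((A ** B) *v x) = norm (A *v (B *v x))" by (simp add: matrix_vector_mul_assoc)
  also have "\<dots> \<le> opnorm A * norm (B *v x)" by (rule norm_mv_le)
  also have "\<dots> \<le> opnorm A * (opnorm B * norm x)" by (intro mult_left_mono norm_mv_le) simp
  finally show "norm ((A ** B) *v x) \<le> opnorm A * opnorm B * norm x" by (simp add: mult.assoc)
qed simp

lemma opnorm_id [simp]: "opnorm (mat 1) = 1"
proof -
  have "((*v) (mat 1 :: real^2^2)) = (\<lambda>x. x)" by (rule ext) simp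
  then show ?thesis unfolding opnorm_def by (simp add: onorm_id)
qed

lemma scaleR_mv: "(c *\<^sub>R M) *v x = c *\<^sub>R (M *v (x :: real^2))"
  by (simp add: scaleR_matrix_vector_assoc)

lemma opnorm_scaleR [simp]: "opnorm (c *\<^sub>R M) = \<bar>c\<bar> * opnorm M"
  unfolding opnorm_def scaleR_mv using onorm_scaleR[OF bounded_linear_mv] by simp

lemma opnorm_diff_le: "\<bar>opnorm A - opnorm B\<bar> \<le> opnorm (A - B)"
proof -
  have *: "opnorm A \<le> opnorm B + opnorm (A - B)" for A B
  proof -
    have "opnorm (B + (A - B)) \<le> opnorm B + opnorm (A - B)"
      unfolding opnorm_def matrix_vector_mult_add_rdistrib
      by (rule onorm_triangle) (rule bounded_linear_mv)+
    then show ?thesis by simp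
  qed
  have "opnorm (B - A) = opnorm (A - B)"
    using opnorm_scaleR[of "-1" "A - B"] by simp
  then show ?thesis using *[of A B] *[of B A] by linarith
qed

lemma entry_le_opnorm: "\<bar>M $ i $ j\<bar> \<le> opnorm M"
  unfolding opnorm_def by (rule matrix_component_le_onorm)

lemma opnorm_le_norm: "opnorm M \<le> 4 * norm M"
proof -
  have "opnorm M \<le> (\<Sum>i\<in>UNIV. \<Sum>j\<in>UNIV. \<bar>M $ i $ j\<bar>)"
    unfolding opnorm_def by (rule onorm_le_matrix_component_sum)
  also have "\<dots> \<le> (\<Sum>i\<in>(UNIV :: 2 set). \<Sum>j\<in>(UNIV :: 2 set). norm M)"
  proof (intro sum_mono)
    fix i j
    have "\<bar>M $ i $ j\<bar> \<le> norm (M $ i)" by (rule component_le_norm_cart)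
    also have "\<dots> \<le> norm M" by (rule Finite_Cartesian_Product.norm_nth_le)
    finally show "\<bar>M $ i $ j\<bar> \<le> norm M" .
  qed
  finally show ?thesis by (simp add: sum_2)
qed

lemma norm_le_opnorm: "norm M \<le> 4 * opnorm M"
proof -
  have "norm M \<le> (\<Sum>i\<in>UNIV. norm (M $ i))" unfolding norm_vec_def by (rule L2_set_le_sum) simp
  also have "\<dots> \<le> (\<Sum>i\<in>UNIV. \<Sum>j\<in>UNIV. \<bar>M $ i $ j\<bar>)" by (intro sum_mono norm_le_l1_cart)
  also have "\<dots> \<le> (\<Sum>i\<in>(UNIV :: 2 set). \<Sum>j\<in>(UNIV :: 2 set). opnorm M)"
    by (intro sum_mono entry_le_opnorm)
  finally show ?thesis by (simp add: sum_2)
qed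

lemma tendsto_opnorm [tendsto_intros]:
  assumes "(f \<longlongrightarrow> M) F"
  shows "((\<lambda>x. opnorm (f x)) \<longlongrightarrow> opnorm M) F"
proof -
  have "((\<lambda>x. 4 * norm (f x - M)) \<longlongrightarrow> 0) F"
    using tendsto_mult_left[OF tendsto_norm_zero[OF LIM_zero[OF assms]], of 4] by simp
  then have "((\<lambda>x. opnorm (f x) - opnorm M) \<longlongrightarrow> 0) F"
  proof (rule Lim_null_comparison[rotated])
    show "\<forall>\<^sub>F x in F. norm (opnorm (f x) - opnorm M) \<le> 4 * norm (f x - M)"
      using order_trans[OF opnorm_diff_le opnorm_le_norm] by simp
  qed
  then show ?thesis by (rule LIM_zero_cancel)
qed

lemma tendsto_matrix_mult [tendsto_intros]:
  fixes f g :: "'a \<Rightarrow> real^2^2"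
  assumes "(f \<longlongrightarrow> A) F" "(g \<longlongrightarrow> B) F"
  shows "((\<lambda>x. f x ** g x) \<longlongrightarrow> A ** B) F"
  unfolding matrix_matrix_mult_def using assms
  by (intro tendsto_vec_lambda tendsto_sum tendsto_mult tendsto_vec_nth)

lemma tendsto_mv [tendsto_intros]:
  fixes f :: "'a \<Rightarrow> real^2^2"
  assumes "(f \<longlongrightarrow> A) F" "(g \<longlongrightarrow> x) F"
  shows "((\<lambda>y. f y *v g y) \<longlongrightarrow> A *v x) F"
  unfolding matrix_vector_mult_def using assms
  by (intro tendsto_vec_lambda tendsto_sum tendsto_mult tendsto_vec_nth)

lemma tendsto_det [tendsto_intros]:
  fixes f :: "'a \<Rightarrow> real^2^2"
  assumes "(f \<longlongrightarrow> A) F"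
  shows "((\<lambda>x. det (f x)) \<longlongrightarrow> det A) F"
  unfolding det_2 using assms by (intro tendsto_intros)

lemma continuous_on_opnorm [continuous_intros]:
  "continuous_on S f \<Longrightarrow> continuous_on S (\<lambda>x. opnorm (f x))"
  unfolding continuous_on_def using tendsto_opnorm by blast

lemma continuous_on_matrix_mult [continuous_intros]:
  fixes f g :: "_ \<Rightarrow> real^2^2"
  shows "continuous_on S f \<Longrightarrow> continuous_on S g \<Longrightarrow> continuous_on S (\<lambda>x. f x ** g x)"
  unfolding continuous_on_def using tendsto_matrix_mult by blast

section \<open>Coordinates, signed area and singular values\<close>

lemma mv_components:
  fixes M :: "real^2^2"
  shows "(M *v x) $ 1 = M$1$1 * x$1 + M$1$2 * x$2" "(M *v x) $ 2 = M$2$1 * x$1 + M$2$2 * x$2"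
  by (simp_all add: matrix_vector_mult_def sum_2)

lemma mm_components:
  fixes M P :: "real^2^2"
  shows "(M ** P) $ i $ j = M$i$1 * P$1$j + M$i$2 * P$2$j"
  by (simp add: matrix_matrix_mult_def sum_2)

lemma scaleR_mm:
  fixes M P :: "real^2^2"
  shows "(c *\<^sub>R M) ** P = c *\<^sub>R (M ** P)" "M ** (c *\<^sub>R P) = c *\<^sub>R (M ** P)"
  by (simp_all add: vec_eq_iff mm_components algebra_simps)

lemma vec2_eq_iff: "(x :: 'a^2) = y \<longleftrightarrow> x $ 1 = y $ 1 \<and> x $ 2 = y $ 2"
  by (auto simp: vec_eq_iff forall_2)

lemma norm2_sq: "(norm (x :: real^2))\<^sup>2 = (x $ 1)\<^sup>2 + (x $ 2)\<^sup>2"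
  by (simp add: norm_vec_def L2_set_def sum_2)

text \<open>The signed area of a parallelogram. For unit vectors its modulus is the sine of the
  angle between their lines; it serves as the distance of directions throughout, because a linear
  map multiplies it by the determinant.\<close>

definition cross2 :: "real^2 \<Rightarrow> real^2 \<Rightarrow> real" where
  "cross2 x y = x $ 1 * y $ 2 - x $ 2 * y $ 1"

lemma cross2_mv: "cross2 (M *v x) (M *v y) = det M * cross2 x y"
  unfolding cross2_def mv_components det_2 by algebra

lemma cross2_sq: "(cross2 x y)\<^sup>2 + (x \<bullet> y)\<^sup>2 = (norm x)\<^sup>2 * (norm y)\<^sup>2"
  unfolding cross2_def norm2_sq inner_vec_def sum_2 by (simp add: power2_eq_square algebra_simps)

lemma abs_cross2_le: "\<bar>cross2 x y\<bar> \<le> norm x * norm y"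
proof -
  have "(cross2 x y)\<^sup>2 \<le> (norm x * norm y)\<^sup>2"
    using cross2_sq[of x y] by (simp add: power_mult_distrib) (metis le_add_same_cancel1 zero_le_power2)
  then show ?thesis using abs_le_square_iff[of "cross2 x y" "norm x * norm y"] by simp
qed

lemma cross2_scaleR [simp]: "cross2 (c *\<^sub>R x) y = c * cross2 x y" "cross2 x (c *\<^sub>R y) = c * cross2 x y"
  by (simp_all add: cross2_def algebra_simps)

lemma cross2_add: "cross2 (x + y) z = cross2 x z + cross2 y z" "cross2 z (x + y) = cross2 z x + cross2 z y"
  by (simp_all add: cross2_def algebra_simps)

lemma cross2_self [simp]: "cross2 x x = 0"
  by (simp add: cross2_def)

lemma cross2_commute: "cross2 x y = - cross2 y x"
  by (simp add: cross2_def)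

text \<open>Cramer's rule, cleared of the denominator so that it holds for all vectors.\<close>

lemma cramer2: "cross2 v w *\<^sub>R x = cross2 x w *\<^sub>R v + cross2 v x *\<^sub>R w"
  unfolding vec2_eq_iff cross2_def by (simp add: algebra_simps)

lemma cross2_eq_0D:
  assumes "cross2 v w = 0" "v \<noteq> 0"
  shows "\<exists>k. w = k *\<^sub>R v"
proof -
  have "(v \<bullet> v) *\<^sub>R w = (v \<bullet> w) *\<^sub>R v"
    using assms(1) unfolding vec2_eq_iff cross2_def inner_vec_def sum_2 by (simp add: algebra_simps)
  then have "(1 / (v \<bullet> v)) *\<^sub>R ((v \<bullet> v) *\<^sub>R w) = ((v \<bullet> w) / (v \<bullet> v)) *\<^sub>R v" by simp
  then have "w = ((v \<bullet> w) / (v \<bullet> v)) *\<^sub>R v" using assms(2) by simp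
  then show ?thesis by blast
qed

definition perp :: "real^2 \<Rightarrow> real^2" where
  "perp x = vector [- (x $ 2), x $ 1]"

lemma perp_nth [simp]: "perp x $ 1 = - (x $ 2)" "perp x $ 2 = x $ 1"
  by (simp_all add: perp_def)

lemma norm_perp [simp]: "norm (perp x) = norm x"
proof -
  have "(norm (perp x))\<^sup>2 = (norm x)\<^sup>2" by (simp add: norm2_sq)
  then show ?thesis by (simp add: power2_eq_iff_nonneg)
qed

lemma cross2_perp: "cross2 x (perp y) = x \<bullet> y"
  by (simp add: cross2_def inner_vec_def sum_2)

lemma abs_det_le: "\<bar>det M\<bar> \<le> (opnorm (M :: real^2^2))\<^sup>2"
proof -
  define e :: "real^2" where "e = axis 1 1"
  have e: "norm e = 1" by (simp add: e_def)
  have "\<bar>det M\<bar> = \<bar>cross2 (M *v e) (M *v perp e)\<bar>"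
    using e by (simp add: cross2_mv cross2_perp abs_mult dot_square_norm)
  also have "\<dots> \<le> norm (M *v e) * norm (M *v perp e)" by (rule abs_cross2_le)
  also have "\<dots> \<le> (opnorm M * norm e) * (opnorm M * norm (perp e))"
    by (intro mult_mono norm_mv_le) auto
  finally show ?thesis using e by (simp add: power2_eq_square)
qed

text \<open>The smaller singular value is \<open>\<bar>det M\<bar> / opnorm M\<close>: the images of
  \<open>x\<close> and \<open>perp x\<close> span the area
  \<open>\<bar>det M\<bar> * (norm x)\<^sup>2\<close>.\<close>

lemma norm_mv_ge: "\<bar>det M\<bar> * norm x \<le> opnorm M * norm (M *v x)"
proof (cases "x = 0")
  case False
  have "\<bar>det M\<bar> * (norm x * norm x) = \<bar>cross2 (M *v x) (M *v perp x)\<bar>"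
    by (simp add: cross2_mv cross2_perp abs_mult dot_square_norm power2_eq_square)
  also have "\<dots> \<le> norm (M *v x) * norm (M *v perp x)" by (rule abs_cross2_le)
  also have "\<dots> \<le> norm (M *v x) * (opnorm M * norm (perp x))"
    by (intro mult_left_mono norm_mv_le) auto
  finally show ?thesis using False by (simp add: algebra_simps)
qed simp

lemma opnorm_attained:
  obtains x where "norm (x :: real^2) = 1" "norm (M *v x) = opnorm M"
proof -
  have "compact (sphere (0 :: real^2) 1)" by simp
  moreover have "sphere (0 :: real^2) 1 \<noteq> {}" by simp
  moreover have "continuous_on (sphere 0 1) (\<lambda>x. norm (M *v x))" by (intro continuous_intros)
  ultimately obtain x where x: "x \<in> sphere 0 1" "\<And>y. y \<in> sphere 0 1 \<Longrightarrow> norm (M *v y) \<le> norm (M *v x)"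
    using continuous_attains_sup by metis
  have "opnorm M \<le> norm (M *v x)"
  proof (rule opnorm_leI)
    fix y
    show "norm (M *v y) \<le> norm (M *v x) * norm y"
    proof (cases "y = 0")
      case False
      have "norm (M *v ((1 / norm y) *\<^sub>R y)) \<le> norm (M *v x)" using False by (intro x(2)) simp
      then show ?thesis using False by (simp add: matrix_vector_mult_scaleR field_simps)
    qed simp
  qed simp
  moreover have "norm (M *v x) \<le> opnorm M" using norm_mv_le[of M x] x(1) by simp
  ultimately show ?thesis using x(1) that by force
qed

lemma opnorm_pos: "M \<noteq> 0 \<Longrightarrow> 0 < opnorm M"
  using norm_le_opnorm[of M] by (smt (verit) zero_less_norm_iff)

lemma invertible_opnorm_pos: "invertible (M :: real^2^2) \<Longrightarrow> 0 < opnorm M"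
  by (rule opnorm_pos) (auto simp: invertible_det_nz det_2)

lemma invertible_mv_eq_0: "invertible (M :: real^2^2) \<Longrightarrow> M *v x = 0 \<longleftrightarrow> x = 0"
  using norm_mv_ge[of M x] by (auto simp: invertible_det_nz mult_le_0_iff)

lemma
  assumes "invertible (M :: real^2^2)"
  shows matrix_inv_right: "M ** matrix_inv M = mat 1" and matrix_inv_left: "matrix_inv M ** M = mat 1"
  using someI_ex[OF assms[unfolded invertible_def]] unfolding matrix_inv_def by auto

lemma det_scaleR2: "det (c *\<^sub>R (M :: real^2^2)) = c\<^sup>2 * det M"
  by (simp add: det_2 power2_eq_square algebra_simps)

text \<open>A line has two unit vectors, hence the alternative. With
  \<open>c = p \<bullet> r\<close> the square of the smaller distance is
  \<open>2 * (1 - \<bar>c\<bar>)\<close>, at most \<open>4 * (1 - c\<^sup>2)\<close>.\<close>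

lemma unit_vectors_close:
  assumes "norm (p :: real^2) = 1" "norm r = 1"
  shows "norm (p - r) \<le> 2 * \<bar>cross2 p r\<bar> \<or> norm (p + r) \<le> 2 * \<bar>cross2 p r\<bar>"
proof -
  define c where "c = p \<bullet> r"
  have s: "(cross2 p r)\<^sup>2 = 1 - c\<^sup>2" using cross2_sq[of p r] assms by (simp add: c_def)
  have c1: "\<bar>c\<bar> \<le> 1" using Cauchy_Schwarz_ineq2[of p r] assms by (simp add: c_def)
  have n: "(norm (p - r))\<^sup>2 = 2 - 2 * c" "(norm (p + r))\<^sup>2 = 2 + 2 * c"
    using assms dot_norm[of p r] dot_norm_neg[of p r] by (simp_all add: c_def field_simps)
  show ?thesis
  proof (cases "c \<ge> 0")
    case True
    have "(1 - c) * 1 \<le> (1 - c) * (2 * (1 + c))" using True c1 by (intro mult_left_mono) auto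
    then have "(norm (p - r))\<^sup>2 \<le> (2 * \<bar>cross2 p r\<bar>)\<^sup>2"
      by (simp add: n power_mult_distrib s) (simp add: power2_eq_square algebra_simps)
    then have "norm (p - r) \<le> 2 * \<bar>cross2 p r\<bar>" by (rule power2_le_imp_le) simp
    then show ?thesis ..
  next
    case False
    have "(1 + c) * 1 \<le> (1 + c) * (2 * (1 - c))" using False c1 by (intro mult_left_mono) auto
    then have "(norm (p + r))\<^sup>2 \<le> (2 * \<bar>cross2 p r\<bar>)\<^sup>2"
      by (simp add: n power_mult_distrib s) (simp add: power2_eq_square algebra_simps)
    then have "norm (p + r) \<le> 2 * \<bar>cross2 p r\<bar>" by (rule power2_le_imp_le) simp
    then show ?thesis ..
  qed
qed

lemma norm_mv_diff_le:
  assumes "norm (p :: real^2) = 1" "norm r = 1"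
  shows "\<bar>norm (M *v p) - norm (M *v r)\<bar> \<le> 2 * opnorm M * \<bar>cross2 p r\<bar>"
  using unit_vectors_close[OF assms]
proof
  assume a: "norm (p - r) \<le> 2 * \<bar>cross2 p r\<bar>"
  have "\<bar>norm (M *v p) - norm (M *v r)\<bar> \<le> norm (M *v p - M *v r)" by (rule norm_triangle_ineq3)
  also have "\<dots> = norm (M *v (p - r))" by (simp add: matrix_vector_mult_diff_distrib)
  also have "\<dots> \<le> opnorm M * norm (p - r)" by (rule norm_mv_le)
  also have "\<dots> \<le> opnorm M * (2 * \<bar>cross2 p r\<bar>)" using a by (intro mult_left_mono) auto
  finally show ?thesis by simp
next
  assume a: "norm (p + r) \<le> 2 * \<bar>cross2 p r\<bar>"
  have "\<bar>norm (M *v p) - norm (M *v r)\<bar> \<le> norm (M *v p - - (M *v r))"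
    by (metis norm_minus_cancel norm_triangle_ineq3)
  also have "\<dots> = norm (M *v (p + r))" by (simp add: matrix_vector_right_distrib)
  also have "\<dots> \<le> opnorm M * norm (p + r)" by (rule norm_mv_le)
  also have "\<dots> \<le> opnorm M * (2 * \<bar>cross2 p r\<bar>)" using a by (intro mult_left_mono) auto
  finally show ?thesis by simp
qed

section \<open>Products along words\<close>

lemma matword_Nil [simp]: "matword A [] = mat 1"
  and matword_Cons [simp]: "matword A (a # w) = A a ** matword A w"
  by (simp_all add: matword_def)

lemma matword_append: "matword A (u @ v) = matword A u ** matword A v"
  by (induction u) (auto simp: matrix_mul_assoc)

lemma invertible_matword:
  assumes "\<forall>i\<in>{1..N}. invertible (A i)" "w \<in> lists {1..N}"
  shows "invertible (matword A w)"
  using assms(2)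
proof (induction w)
  case Nil
  show ?case by (simp add: invertible_det_nz)
next
  case (Cons a w)
  then show ?case using assms(1) by (auto intro!: invertible_mult)
qed

lemma irreducible_moves:
  assumes irr: "irreducible_tuple N A" and v: "v \<noteq> 0"
  shows "\<exists>a\<in>{1..N}. cross2 v (A a *v v) \<noteq> 0"
proof (rule ccontr)
  assume *: "\<not> ?thesis"
  have "(\<lambda>x. A i *v x) ` span {v} \<subseteq> span {v}" if i: "i \<in> {1..N}" for i
  proof -
    obtain k where "A i *v v = k *\<^sub>R v" using cross2_eq_0D[of v "A i *v v"] * i v by blast
    then show ?thesis by (auto simp: span_singleton matrix_vector_mult_scaleR)
  qed
  moreover have "subspace (span {v})" "dim (span {v}) = 1" using v by auto
  ultimately show False using irr unfolding irreducible_tuple_def by blast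
qed

text \<open>On pairs of matrices of norm \<open>1\<close> the sum \<open>g\<close> of the candidate
  norms is continuous, so by compactness it suffices that it has no zero. At a zero,
  \<open>U0\<close> kills a vector in the image of \<open>V0\<close> and its images under all
  letters, and by irreducibility these span the plane.\<close>

lemma irreducible_quasi_multiplicative:
  assumes irr: "irreducible_tuple N A"
  obtains \<kappa> where "\<kappa> > 0"
    "\<And>U V. \<kappa> * opnorm U * opnorm V \<le> opnorm (U ** V) \<or>
        (\<exists>a\<in>{1..N}. \<kappa> * opnorm U * opnorm V \<le> opnorm (U ** A a ** V))"
proof -
  define S where "S = {M :: real^2^2. opnorm M = 1}"
  have "closed S" unfolding S_def
    by (intro closed_Collect_eq continuous_intros)
  moreover have "bounded S"
    unfolding bounded_iff S_def
  proof (intro exI[of _ 4] ballI)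
    fix M :: "real^2^2" assume "M \<in> {M. opnorm M = 1}"
    then show "norm M \<le> 4" using norm_le_opnorm[of M] by simp
  qed
  ultimately have S: "compact S" by (simp add: compact_eq_bounded_closed)
  have Sne: "S \<noteq> {}" using opnorm_id unfolding S_def by blast
  define g where "g p = opnorm (fst p ** snd p) + (\<Sum>a\<in>{1..N}. opnorm (fst p ** A a ** snd p))" for p
  have "continuous_on (S \<times> S) g" unfolding g_def by (intro continuous_intros)
  then obtain q where q: "q \<in> S \<times> S" "\<And>p. p \<in> S \<times> S \<Longrightarrow> g q \<le> g p"
    using continuous_attains_inf[OF compact_Times[OF S S]] Sne by (metis Times_empty)
  obtain U0 V0 where q_eq: "q = (U0, V0)" by fastforce
  have "g q > 0"
  proof (rule ccontr)
    assume "\<not> ?thesis"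
    then have 0: "opnorm (U0 ** V0) + (\<Sum>a\<in>{1..N}. opnorm (U0 ** A a ** V0)) \<le> 0"
      by (simp add: g_def q_eq)
    have sn: "0 \<le> (\<Sum>a\<in>{1..N}. opnorm (U0 ** A a ** V0))" by (intro sum_nonneg) simp
    have z0: "opnorm (U0 ** V0) = 0" using 0 sn opnorm_nonneg[of "U0 ** V0"] by linarith
    have "(\<Sum>a\<in>{1..N}. opnorm (U0 ** A a ** V0)) = 0" using 0 sn opnorm_nonneg[of "U0 ** V0"] by linarith
    then have za: "opnorm (U0 ** A a ** V0) = 0" if "a \<in> {1..N}" for a
      using that by (subst (asm) sum_nonneg_eq_0_iff) auto
    obtain y where y: "norm y = 1" "norm (V0 *v y) = opnorm V0" by (rule opnorm_attained)
    define v where "v = V0 *v y"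
    have v: "v \<noteq> 0" using y q(1) by (auto simp: v_def q_eq S_def)
    obtain a where a: "a \<in> {1..N}" "cross2 v (A a *v v) \<noteq> 0" using irreducible_moves[OF irr v] by blast
    have Uv: "U0 *v v = 0" using norm_mv_le[of "U0 ** V0" y] z0
      by (simp add: v_def matrix_vector_mul_assoc)
    have UAv: "U0 *v (A a *v v) = 0" using norm_mv_le[of "U0 ** A a ** V0" y] za[OF a(1)]
      by (simp add: v_def matrix_vector_mul_assoc matrix_mul_assoc)
    have "U0 *v x = 0" for x
    proof -
      have "U0 *v (cross2 v (A a *v v) *\<^sub>R x) = 0"
        unfolding cramer2[of v "A a *v v" x]
        by (simp add: matrix_vector_right_distrib matrix_vector_mult_scaleR Uv UAv)
      then show ?thesis using a(2) by (simp add: matrix_vector_mult_scaleR)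
    qed
    then have "opnorm U0 \<le> 0" by (intro opnorm_leI) auto
    then show False using q(1) by (simp add: q_eq S_def)
  qed
  \<comment> \<open>Among the \<open>N + 1\<close> summands of \<open>g\<close> one is at least the
    average.\<close>
  define \<kappa> where "\<kappa> = g q / (real N + 1)"
  have \<kappa>: "\<kappa> > 0" using \<open>g q > 0\<close> by (simp add: \<kappa>_def)
  have "\<kappa> * opnorm U * opnorm V \<le> opnorm (U ** V) \<or>
        (\<exists>a\<in>{1..N}. \<kappa> * opnorm U * opnorm V \<le> opnorm (U ** A a ** V))" for U V
  proof (rule ccontr)
    assume neg: "\<not> ?thesis"
    define x where "x = \<kappa> * opnorm U * opnorm V"
    have lt: "opnorm (U ** V) < x" "\<And>a. a \<in> {1..N} \<Longrightarrow> opnorm (U ** A a ** V) < x"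
      using neg by (auto simp: x_def not_le simp del: One_nat_def)
    have "0 < x" using lt(1) opnorm_nonneg[of "U ** V"] by linarith
    then have "opnorm U * opnorm V \<noteq> 0" by (auto simp: x_def)
    then have pos: "0 < opnorm U" "0 < opnorm V"
      using opnorm_nonneg[of U] opnorm_nonneg[of V] by (auto simp: less_le)
    define U' V' where "U' = (1 / opnorm U) *\<^sub>R U" and "V' = (1 / opnorm V) *\<^sub>R V"
    have "g q \<le> g (U', V')" using pos by (intro q(2)) (auto simp: U'_def V'_def S_def)
    also have "g (U', V') = (opnorm (U ** V) + (\<Sum>a\<in>{1..N}. opnorm (U ** A a ** V))) / (opnorm U * opnorm V)"
      using pos by (simp add: g_def U'_def V'_def scaleR_mm
          sum_divide_distrib add_divide_distrib mult.commute)
    also have "\<dots> < (x + (\<Sum>a\<in>{1..N}. x)) / (opnorm U * opnorm V)"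
      using lt pos by (intro divide_strict_right_mono add_less_le_mono sum_mono less_imp_le) auto
    also have "x + (\<Sum>a\<in>{1..N}. x) = (real N + 1) * \<kappa> * (opnorm U * opnorm V)"
      by (simp add: x_def algebra_simps)
    also have "\<dots> / (opnorm U * opnorm V) = g q" using pos by (simp add: \<kappa>_def)
    finally show False by simp
  qed
  with \<kappa> that show ?thesis by blast
qed

section \<open>Sequences and cylinders\<close>

lemma length_prefix [simp]: "length (prefix x n) = n"
  by (simp add: prefix_def)

lemma prefix_nth [simp]: "k < n \<Longrightarrow> prefix x n ! k = x k"
  by (simp add: prefix_def)

lemma prefix_in_words: "x \<in> Sig N \<Longrightarrow> prefix x n \<in> words N n"
  by (auto simp: Sig_def words_def prefix_def)

lemma cyl_iff: "x \<in> cyl N w \<longleftrightarrow> x \<in> Sig N \<and> prefix x (length w) = w"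
  by (auto simp: cyl_def list_eq_iff_nth_eq)

lemma funpow_shift: "(shift ^^ k) x = (\<lambda>j. x (j + k))"
  by (induction k) (auto simp: shift_def)

lemma shift_Sig: "x \<in> Sig N \<Longrightarrow> (shift ^^ k) x \<in> Sig N"
  by (auto simp: Sig_def funpow_shift)

lemma prefix_add: "prefix x (n + m) = prefix x n @ prefix ((shift ^^ n) x) m"
  by (rule nth_equalityI) (auto simp: prefix_def funpow_shift nth_append)

definition word_seq :: "nat list \<Rightarrow> (nat \<Rightarrow> nat) \<Rightarrow> nat \<Rightarrow> nat" where
  "word_seq w x k = (if k < length w then w ! k else x (k - length w))"

lemma word_seq_in_Sig: "w \<in> lists {1..N} \<Longrightarrow> x \<in> Sig N \<Longrightarrow> word_seq w x \<in> Sig N"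
  by (auto simp: Sig_def word_seq_def dest: nth_mem)

lemma prefix_word_seq [simp]: "prefix (word_seq w x) (length w) = w"
  by (rule nth_equalityI) (auto simp: prefix_def word_seq_def)

lemma shift_word_seq [simp]: "(shift ^^ length w) (word_seq w x) = x"
  by (auto simp: funpow_shift word_seq_def)

lemma ones_in_Sig: "N \<ge> 1 \<Longrightarrow> (\<lambda>_. 1) \<in> Sig N"
  by (simp add: Sig_def)

lemma cyl_nonempty: "N \<ge> 1 \<Longrightarrow> w \<in> lists {1..N} \<Longrightarrow> cyl N w \<noteq> {}"
  using word_seq_in_Sig[of w N "\<lambda>_. 1"] ones_in_Sig[of N] prefix_word_seq[of w "\<lambda>_. 1"] cyl_iff by blast

lemma measurable_coordinate: "(\<lambda>x :: nat \<Rightarrow> nat. x k) \<in> measurable borel borel"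
  by (rule borel_measurable_continuous_onI) (rule continuous_on_product_coordinates)

lemma coordinate_eq_sets: "{x :: nat \<Rightarrow> nat. x k = c} \<in> sets borel"
proof -
  have "(\<lambda>x :: nat \<Rightarrow> nat. x k) -` {c} \<inter> space borel \<in> sets borel"
    by (rule measurable_sets[OF measurable_coordinate]) simp
  also have "(\<lambda>x :: nat \<Rightarrow> nat. x k) -` {c} \<inter> space borel = {x. x k = c}" by auto
  finally show ?thesis .
qed

lemma Sig_sets: "Sig N \<in> sets borel"
proof -
  have "Sig N = (\<Inter>k. \<Union>c\<in>{1..N}. {x. x k = c})" by (auto simp: Sig_def)
  also have "\<dots> \<in> sets borel"
    by (intro sets.countable_INT'' sets.finite_UN coordinate_eq_sets) auto
  finally show ?thesis .
qed

lemma prefix_eq_sets: "{x. prefix x n = w} \<in> sets borel"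
proof (cases "length w = n")
  case True
  then have "{x. prefix x n = w} = (\<Inter>k\<in>{..<n}. {x. x k = w ! k})"
    by (auto simp: list_eq_iff_nth_eq)
  moreover have "\<dots> \<in> sets borel"
  proof (cases "n = 0")
    case False
    then show ?thesis by (intro sets.finite_INT coordinate_eq_sets) auto
  qed auto
  ultimately show ?thesis by simp
next
  case False
  then have "{x. prefix x n = w} = {}" by auto
  then show ?thesis by (simp only: sets.empty_sets)
qed

lemma cyl_sets: "cyl N w \<in> sets borel"
proof -
  have "cyl N w = Sig N \<inter> {x. prefix x (length w) = w}" by (auto simp: cyl_iff)
  then show ?thesis using Sig_sets prefix_eq_sets by simp
qed

lemma measurable_shift: "shift \<in> measurable borel borel"
  unfolding shift_def
  by (intro borel_measurable_continuous_onI continuous_on_coordinatewise_then_product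
      continuous_on_product_coordinates)

lemma measurable_prefix_fun:
  fixes F :: "nat list \<Rightarrow> real"
  shows "(\<lambda>x. F (prefix x n)) \<in> borel_measurable borel"
proof -
  have "(\<lambda>x. prefix x n) \<in> measurable borel (count_space UNIV)"
    unfolding measurable_count_space_eq_countable[OF countableI_type]
    using prefix_eq_sets by (auto simp: vimage_def)
  then show ?thesis by (rule measurable_compose) simp
qed

section \<open>Equilibrium states of matrix cocycles\<close>

locale inv_measure =
  fixes N :: nat and \<mu> :: "(nat \<Rightarrow> nat) measure"
  assumes inv: "inv_prob N \<mu>"
begin

sublocale prob_space \<mu> using inv by (simp add: inv_prob_def)

lemma sets_eq: "sets \<mu> = sets borel" using inv by (simp add: inv_prob_def)

lemma space_eq: "space \<mu> = UNIV" using sets_eq_imp_space_eq[OF sets_eq] by simp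

lemma AE_Sig: "AE x in \<mu>. x \<in> Sig N"
proof -
  have "prob (Sig N) = 1" using inv by (simp add: inv_prob_def measure_def)
  then show ?thesis using prob_eq_1[of "Sig N"] Sig_sets by (simp add: sets_eq)
qed

lemma invariant_weight_cyl: "invariant_weight N (\<lambda>w. prob (cyl N w))"
  unfolding invariant_weight_def
proof (intro conjI ballI)
  fix w assume w: "w \<in> lists {1..N}"
  have cyl_events: "cyl N w \<in> events" for w using cyl_sets by (simp add: sets_eq)
  show "(\<Sum>a\<in>{1..N}. prob (cyl N (w @ [a]))) = prob (cyl N w)"
  proof -
    have "x \<in> cyl N w \<longleftrightarrow> (\<exists>a\<in>{1..N}. x \<in> cyl N (w @ [a]))" for x
      unfolding cyl_iff by (auto simp: prefix_def Sig_def)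
    then have eq: "cyl N w = (\<Union>a\<in>{1..N}. cyl N (w @ [a]))" by blast
    have dis: "disjoint_family_on (\<lambda>a. cyl N (w @ [a])) {1..N}"
      by (auto simp: disjoint_family_on_def cyl_iff)
    have "(\<lambda>a. cyl N (w @ [a])) ` {1..N} \<subseteq> events" using cyl_events by blast
    then show ?thesis unfolding eq by (rule finite_measure_finite_Union[OF finite_atLeastAtMost _ dis, symmetric])
  qed
  show "(\<Sum>a\<in>{1..N}. prob (cyl N (a # w))) = prob (cyl N w)"
  proof -
    have ms: "shift \<in> measurable \<mu> borel" using measurable_shift sets_eq by (simp cong: measurable_cong_sets)
    have "prob (cyl N w) = measure (distr \<mu> borel shift) (cyl N w)"
      using inv by (simp add: inv_prob_def)
    also have "\<dots> = prob (shift -` cyl N w)"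
      using measure_distr[OF ms cyl_sets] by (simp add: space_eq)
    \<comment> \<open>The preimage under the shift also contains sequences whose first entry is no
      letter, so the two sets agree only up to a null set.\<close>
    also have "\<dots> = prob (\<Union>a\<in>{1..N}. cyl N (a # w))"
    proof (rule finite_measure_eq_AE)
      show "AE x in \<mu>. (x \<in> shift -` cyl N w) = (x \<in> (\<Union>a\<in>{1..N}. cyl N (a # w)))"
        using AE_Sig
      proof eventually_elim
        case (elim x)
        show ?case
        proof
          assume "x \<in> shift -` cyl N w"
          then have "x \<in> cyl N (x 0 # w)"
            using elim by (auto simp: cyl_def shift_def nth_Cons split: nat.split)
          moreover have "x 0 \<in> {1..N}" using elim by (simp add: Sig_def)
          ultimately show "x \<in> (\<Union>a\<in>{1..N}. cyl N (a # w))" by blast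
        next
          assume "x \<in> (\<Union>a\<in>{1..N}. cyl N (a # w))"
          then show "x \<in> shift -` cyl N w"
            by (fastforce simp: cyl_def shift_def Sig_def)
        qed
      qed
      show "shift -` cyl N w \<in> events"
        using measurable_sets[OF ms cyl_sets] by (simp add: space_eq)
      show "(\<Union>a\<in>{1..N}. cyl N (a # w)) \<in> events"
        by (intro sets.finite_UN cyl_events) auto
    qed
    also have "\<dots> = (\<Sum>a\<in>{1..N}. prob (cyl N (a # w)))"
      using cyl_events by (intro finite_measure_finite_Union) (auto simp: disjoint_family_on_def cyl_iff)
    finally show ?thesis by simp
  qed
next
  have "cyl N [] = Sig N" by (simp add: cyl_def)
  then show "prob (cyl N []) = 1"
    using inv by (simp add: inv_prob_def measure_def)
qed simp

lemma integral_prefix: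
  "(\<integral>x. F (prefix x n) \<partial>\<mu>) = (\<Sum>w\<in>words N n. prob (cyl N w) * (F w :: real))"
proof -
  have cyl_events: "cyl N w \<in> events" for w using cyl_sets by (simp add: sets_eq)
  have "(\<integral>x. F (prefix x n) \<partial>\<mu>) = (\<integral>x. (\<Sum>w\<in>words N n. indicator (cyl N w) x * F w) \<partial>\<mu>)"
  proof (rule integral_cong_AE)
    show "(\<lambda>x. F (prefix x n)) \<in> borel_measurable \<mu>"
      using measurable_prefix_fun sets_eq by (simp cong: measurable_cong_sets)
    show "(\<lambda>x. \<Sum>w\<in>words N n. indicator (cyl N w) x * F w) \<in> borel_measurable \<mu>"
      using cyl_events by measurable
    show "AE x in \<mu>. F (prefix x n) = (\<Sum>w\<in>words N n. indicator (cyl N w) x * F w)"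
      using AE_Sig
    proof eventually_elim
      case (elim x)
      have "(\<Sum>w\<in>words N n. indicator (cyl N w) x * F w) = (\<Sum>w\<in>{prefix x n}. indicator (cyl N w) x * F w)"
        using elim prefix_in_words[OF elim]
        by (intro sum.mono_neutral_right) (auto simp: indicator_def cyl_iff words_iff simp del: in_lists_conv_set)
      then show ?case using elim by (simp add: cyl_iff)
    qed
  qed
  also have "\<dots> = (\<Sum>w\<in>words N n. prob (cyl N w) * F w)"
    using cyl_events by (subst Bochner_Integration.integral_sum)
      (auto simp: less_top[symmetric] intro!: integrable_mult_left integrable_real_indicator)
  finally show ?thesis .
qed

end

section \<open>Pressure and equilibrium weights of matrix products\<close>

locale cocycle =
  fixes N :: nat and A :: "nat \<Rightarrow> real^2^2"
  assumes N1: "N \<ge> 1" and inv_A: "\<forall>i\<in>{1..N}. invertible (A i)"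
begin

abbreviation M :: "nat list \<Rightarrow> real^2^2" where "M \<equiv> matword A"

lemma invertible_M: "w \<in> lists {1..N} \<Longrightarrow> invertible (M w)"
  using invertible_matword[OF inv_A] .

lemma opnorm_M_pos: "w \<in> lists {1..N} \<Longrightarrow> 0 < opnorm (M w)"
  using invertible_opnorm_pos[OF invertible_M] .

lemma ln_opnorm_append:
  assumes "u \<in> lists {1..N}" "v \<in> lists {1..N}"
  shows "ln (opnorm (M (u @ v))) \<le> ln (opnorm (M u)) + ln (opnorm (M v))"
proof -
  have "ln (opnorm (M (u @ v))) \<le> ln (opnorm (M u) * opnorm (M v))"
    using opnorm_mult[of "M u" "M v"] opnorm_M_pos[of "u @ v"] assms
    by (simp add: matword_append)
  also have "\<dots> = ln (opnorm (M u)) + ln (opnorm (M v))" using opnorm_M_pos assms by (intro ln_mult_pos)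
  finally show ?thesis .
qed

lemma det_M_lower:
  obtains K where "K \<ge> 0" "\<And>w. w \<in> lists {1..N} \<Longrightarrow> - (K * real (length w)) \<le> ln (opnorm (M w))"
proof -
  define K where "K = (\<Sum>i\<in>{1..N}. \<bar>ln \<bar>det (A i)\<bar>\<bar>)"
  have K0: "K \<ge> 0" by (auto simp: K_def intro!: sum_nonneg)
  have det: "- (K * real (length w)) \<le> ln \<bar>det (M w)\<bar>" if "w \<in> lists {1..N}" for w
    using that
  proof (induction w)
    case (Cons a w)
    have nz: "det (A a) \<noteq> 0" "det (M w) \<noteq> 0"
      using Cons inv_A invertible_M[of w] by (auto simp: invertible_det_nz[symmetric])
    have "\<bar>ln \<bar>det (A a)\<bar>\<bar> \<le> K"
      unfolding K_def using Cons by (intro member_le_sum) auto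
    moreover have "ln \<bar>det (M (a # w))\<bar> = ln \<bar>det (A a)\<bar> + ln \<bar>det (M w)\<bar>"
      using nz by (simp add: det_mul abs_mult ln_mult_pos)
    ultimately show ?case using Cons by (simp add: algebra_simps)
  qed simp
  have "- (K * real (length w)) \<le> ln (opnorm (M w))" if w: "w \<in> lists {1..N}" for w
  proof -
    have "det (M w) \<noteq> 0" using invertible_M[OF w] by (simp add: invertible_det_nz)
    then have "ln \<bar>det (M w)\<bar> \<le> ln ((opnorm (M w))\<^sup>2)"
      using abs_det_le[of "M w"] opnorm_M_pos[OF w] by (subst ln_le_cancel_iff) auto
    also have "\<dots> = 2 * ln (opnorm (M w))" using opnorm_M_pos[OF w] by (simp add: ln_realpow)
    finally have "- (K * real (length w)) \<le> 2 * ln (opnorm (M w))" using det[OF w] by simp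
    moreover have "0 \<le> K * real (length w)" using K0 by simp
    ultimately show ?thesis by linarith
  qed
  with K0 that show ?thesis by blast
qed

text \<open>Keeps the logarithms of the partition sums meaningful.\<close>

lemma partition_pos: "0 < (\<Sum>w\<in>words N n. opnorm (M w) powr s)"
proof (rule sum_pos)
  show "words N n \<noteq> {}" using words_nonempty[OF N1, of n] by blast
  show "0 < opnorm (M w) powr s" if "w \<in> words N n" for w
    using opnorm_M_pos[OF words_in_lists[OF that]] by simp
qed simp

text \<open>\<open>Phi A s n\<close> depends on the first \<open>n\<close> letters only, so the
  supremum over a cylinder is its value there; submultiplicativity and \<open>fekete\<close>, with
  the lower bound from determinants, make the quotients converge.\<close>

lemma pressure_limit:
  assumes s: "s > 0"
  shows "(\<lambda>n. ln (\<Sum>w\<in>words N n. opnorm (M w) powr s) / real n) \<longlonglongrightarrow> pressure N (Phi A s)"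
proof -
  define Z where "Z n = (\<Sum>w\<in>words N n. opnorm (M w) powr s)" for n
  have Zpos: "0 < Z n" for n
    unfolding Z_def by (rule partition_pos)
  have "convergent (\<lambda>n. ln (Z n) / real n)"
  proof -
    obtain K where K: "K \<ge> 0" "\<And>w. w \<in> lists {1..N} \<Longrightarrow> - (K * real (length w)) \<le> ln (opnorm (M w))"
      using det_M_lower by blast
    show ?thesis
    proof (rule fekete[where K = "s * K"])
      show "ln (Z (n + m)) \<le> ln (Z n) + ln (Z m)" for n m
      proof -
        have "Z (n + m) \<le> Z n * Z m"
          unfolding Z_def sum_words_add sum_product matword_append
          by (intro sum_mono) (use s in \<open>auto simp: powr_mult[symmetric] intro!: powr_mono2 opnorm_mult\<close>)
        then show ?thesis using Zpos by (simp flip: ln_mult_pos)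
      qed
      show "- (s * K) * real n \<le> ln (Z n)" for n
      proof -
        define w where "w = replicate n (1 :: nat)"
        have w: "w \<in> words N n" using words_nonempty[OF N1] by (simp add: w_def)
        then have wl: "w \<in> lists {1..N}" "length w = n" by (auto simp: words_iff)
        have "s * - (K * real n) \<le> s * ln (opnorm (M w))" using K(2)[OF wl(1)] wl(2) s by (intro mult_left_mono) auto
        also have "\<dots> = ln (opnorm (M w) powr s)" using opnorm_M_pos[OF wl(1)] by (simp add: ln_powr)
        also have "\<dots> \<le> ln (Z n)"
        proof -
          have "opnorm (M w) powr s \<le> Z n" unfolding Z_def using w by (intro member_le_sum) auto
          then show ?thesis using opnorm_M_pos[OF wl(1)] Zpos by (subst ln_le_cancel_iff) auto
        qed
        finally show ?thesis by simp
      qed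
    qed
  qed
  then have "(\<lambda>n. ln (Z n) / real n) \<longlonglongrightarrow> lim (\<lambda>n. ln (Z n) / real n)" by (simp add: convergent_LIMSEQ_iff)
  moreover have "lim (\<lambda>n. ln (Z n) / real n) = pressure N (Phi A s)"
  proof -
    have "exp (SUP j\<in>cyl N w. Phi A s n j) = opnorm (M w) powr s" if w: "w \<in> words N n" for w n
    proof -
      have wl: "w \<in> lists {1..N}" "length w = n" using w by (auto simp: words_iff)
      have "(SUP j\<in>cyl N w. Phi A s n j) = (SUP j\<in>cyl N w. ln (opnorm (M w) powr s))"
        using wl by (intro SUP_cong) (auto simp: Phi_def cyl_iff)
      also have "\<dots> = ln (opnorm (M w) powr s)" using cyl_nonempty[OF N1 wl(1)] by simp
      finally show ?thesis using opnorm_M_pos[OF wl(1)] by (simp only: exp_ln powr_gt_zero)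
    qed
    then show ?thesis unfolding pressure_def Z_def by simp
  qed
  ultimately show ?thesis by (simp add: Z_def)
qed

text \<open>Both entropy and the integrated potential are subadditive in the block length, hence bounded
  below by their limits; so an equilibrium state has nonnegative free energy at every block length.\<close>

theorem equilibrium_comparable:
  assumes irr: "irreducible_tuple N A" and s: "s > 0" and eq: "equilibrium N A s \<mu>"
  defines "P \<equiv> pressure N (Phi A s)"
  obtains C where "C > 0"
    "\<And>w. w \<in> lists {1..N} \<Longrightarrow> exp (- real (length w) * P) * opnorm (M w) powr s / C \<le> measure \<mu> (cyl N w)
      \<and> measure \<mu> (cyl N w) \<le> C * (exp (- real (length w) * P) * opnorm (M w) powr s)"
proof -
  interpret inv_measure N \<mu> using eq by unfold_locales (simp add: equilibrium_def)
  define m where "m w = prob (cyl N w)" for w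
  have m: "invariant_weight N m" using invariant_weight_cyl unfolding m_def .
  define B where "B w = exp (- real (length w) * P) * opnorm (M w) powr s" for w
  obtain \<kappa> where \<kappa>: "\<kappa> > 0"
    "\<And>U V. \<kappa> * opnorm U * opnorm V \<le> opnorm (U ** V) \<or>
        (\<exists>a\<in>{1..N}. \<kappa> * opnorm U * opnorm V \<le> opnorm (U ** A a ** V))"
    using irreducible_quasi_multiplicative[OF irr] by blast
  \<comment> \<open>Bounds the growth of the norm when a letter is cancelled; the summand
    \<open>1\<close> keeps it positive.\<close>
  define E where "E = 1 + (\<Sum>a\<in>{1..N}. opnorm (matrix_inv (A a)))"
  have E: "E > 0" unfolding E_def by (intro add_pos_nonneg sum_nonneg) auto
  have E_ge: "opnorm (matrix_inv (A a)) \<le> E" if "a \<in> {1..N}" for a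
    unfolding E_def using that member_le_sum[of a "{1..N}" "\<lambda>a. opnorm (matrix_inv (A a))"] by auto
  define D where "D = exp P * E powr s"
  \<comment> \<open>An inserted letter changes the normalisation by \<open>exp (- P)\<close>, which
    may be smaller or larger than \<open>1\<close>; hence the minimum.\<close>
  define \<kappa>' where "\<kappa>' = \<kappa> powr s * min 1 (exp (- P))"
  have ww: "word_weight N B D \<kappa>'"
  proof
    show "1 \<le> N" by (rule N1)
    show "0 < D" using E by (simp add: D_def)
    show "0 < \<kappa>'" using \<kappa> by (simp add: \<kappa>'_def)
    fix u v w assume u: "u \<in> lists {1..N}" and v: "v \<in> lists {1..N}" and w: "w \<in> lists {1..N}"
    show "0 < B w" using opnorm_M_pos[OF w] by (simp add: B_def)
    have "opnorm (M (u @ v)) powr s \<le> opnorm (M u) powr s * opnorm (M v) powr s"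
      using s opnorm_mult[of "M u" "M v"] by (simp add: matword_append powr_mult[symmetric] powr_mono2)
    then have "exp (- real (length (u @ v)) * P) * opnorm (M (u @ v)) powr s
       \<le> exp (- real (length (u @ v)) * P) * (opnorm (M u) powr s * opnorm (M v) powr s)"
      by (intro mult_left_mono) auto
    also have "\<dots> = B u * B v"
    proof -
      have "exp (- real (length (u @ v)) * P) = exp (- real (length u) * P) * exp (- real (length v) * P)"
        by (simp add: exp_add[symmetric] algebra_simps)
      then show ?thesis by (simp add: B_def)
    qed
    finally show "B (u @ v) \<le> B u * B v" unfolding B_def[of "u @ v"] .
    have e0: "exp (- (real (length u) + real (length v)) * P) = exp (- real (length u) * P) * exp (- real (length v) * P)"
      by (simp add: exp_add[symmetric] algebra_simps)
    have BB: "B u * B v = exp (- (real (length u) + real (length v)) * P) * (opnorm (M u) * opnorm (M v)) powr s"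
      unfolding e0 B_def by (simp add: powr_mult)
    show "\<kappa>' * B u * B v \<le> B (u @ v) \<or> (\<exists>a\<in>{1..N}. \<kappa>' * B u * B v \<le> B (u @ a # v))"
      using \<kappa>(2)[of "M u" "M v"]
    proof
      assume "\<kappa> * opnorm (M u) * opnorm (M v) \<le> opnorm (M u ** M v)"
      then have "(\<kappa> * (opnorm (M u) * opnorm (M v))) powr s \<le> opnorm (M (u @ v)) powr s"
        using s \<kappa> by (intro powr_mono2) (auto simp: matword_append mult.assoc)
      then have p: "\<kappa> powr s * (opnorm (M u) * opnorm (M v)) powr s \<le> opnorm (M (u @ v)) powr s"
        using \<kappa> by (simp add: powr_mult)
      have "\<kappa> powr s * min 1 (exp (- P)) \<le> \<kappa> powr s * 1" by (intro mult_left_mono) auto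
      then have "\<kappa>' * (B u * B v) \<le> \<kappa> powr s * (B u * B v)"
        by (intro mult_right_mono) (auto simp: \<kappa>'_def B_def)
      also have "\<dots> = exp (- (real (length u) + real (length v)) * P) * (\<kappa> powr s * (opnorm (M u) * opnorm (M v)) powr s)"
        unfolding BB by (simp add: algebra_simps)
      also have "\<dots> \<le> exp (- (real (length u) + real (length v)) * P) * opnorm (M (u @ v)) powr s"
        using p by (intro mult_left_mono) auto
      also have "\<dots> = B (u @ v)" by (simp add: B_def)
      finally show ?thesis by (simp add: mult.assoc)
    next
      assume "\<exists>a\<in>{1..N}. \<kappa> * opnorm (M u) * opnorm (M v) \<le> opnorm (M u ** A a ** M v)"
      then obtain a where a: "a \<in> {1..N}" "\<kappa> * opnorm (M u) * opnorm (M v) \<le> opnorm (M u ** A a ** M v)" by blast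
      then have "(\<kappa> * (opnorm (M u) * opnorm (M v))) powr s \<le> opnorm (M (u @ a # v)) powr s"
        using s \<kappa> by (intro powr_mono2) (auto simp: matword_append mult.assoc matrix_mul_assoc)
      then have p: "\<kappa> powr s * (opnorm (M u) * opnorm (M v)) powr s \<le> opnorm (M (u @ a # v)) powr s"
        using \<kappa> by (simp add: powr_mult)
      have "\<kappa>' * (B u * B v) \<le> (\<kappa> powr s * exp (- P)) * (B u * B v)"
        unfolding \<kappa>'_def by (intro mult_right_mono mult_left_mono) (auto simp: B_def)
      also have "\<dots> = exp (- P) * exp (- (real (length u) + real (length v)) * P) * (\<kappa> powr s * (opnorm (M u) * opnorm (M v)) powr s)"
        unfolding BB by (simp add: algebra_simps)
      also have "\<dots> \<le> exp (- P) * exp (- (real (length u) + real (length v)) * P) * opnorm (M (u @ a # v)) powr s"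
        using p by (intro mult_left_mono) auto
      also have "\<dots> = B (u @ a # v)" by (simp add: B_def exp_add[symmetric] algebra_simps)
      finally show ?thesis using a(1) by (metis mult.assoc)
    qed
    fix a assume a: "a \<in> {1..N}"
    have ia: "invertible (A a)" using a inv_A by blast
    have BD: "B w \<le> D * B w'"
      if "opnorm (M w) \<le> opnorm (matrix_inv (A a)) * opnorm (M w')" "length w' = Suc (length w)" for w'
    proof -
      have "opnorm (matrix_inv (A a)) * opnorm (M w') \<le> E * opnorm (M w')"
        using E_ge[OF a] by (intro mult_right_mono) auto
      then have "opnorm (M w) powr s \<le> (E * opnorm (M w')) powr s"
        using that s by (intro powr_mono2) auto
      also have "\<dots> = E powr s * opnorm (M w') powr s" using E by (simp add: powr_mult)
      finally have "B w \<le> exp (- real (length w) * P) * (E powr s * opnorm (M w') powr s)"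
        unfolding B_def by (intro mult_left_mono) auto
      also have "exp (- real (length w) * P) = exp P * exp (- real (length w') * P)"
        using that(2) by (simp add: exp_add[symmetric] algebra_simps)
      finally show ?thesis by (simp add: B_def D_def algebra_simps)
    qed
    show "B w \<le> D * B (a # w)"
    proof (rule BD)
      have "M w = matrix_inv (A a) ** M (a # w)"
        using matrix_inv_left[OF ia] by (simp add: matrix_mul_assoc)
      then show "opnorm (M w) \<le> opnorm (matrix_inv (A a)) * opnorm (M (a # w))"
        using opnorm_mult by metis
    qed simp
    show "B w \<le> D * B (w @ [a])"
    proof (rule BD)
      have "M w = M (w @ [a]) ** matrix_inv (A a)"
        using matrix_inv_right[OF ia] by (simp add: matword_append matrix_mul_assoc[symmetric])
      then show "opnorm (M w) \<le> opnorm (matrix_inv (A a)) * opnorm (M (w @ [a]))"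
        using opnorm_mult mult.commute by metis
    qed simp
  next
    define Z where "Z n = (\<Sum>w\<in>words N n. opnorm (M w) powr s)" for n
    have Zpos: "0 < Z n" for n
      unfolding Z_def by (rule partition_pos)
    have "(\<lambda>n. ln (Z n) / real n - P) \<longlonglongrightarrow> P - P"
      using pressure_limit[OF s] unfolding P_def Z_def by (intro tendsto_intros)
    moreover have "\<forall>\<^sub>F n in sequentially. ln (Z n) / real n - P = ln (\<Sum>w\<in>words N n. B w) / real n"
    proof (rule eventually_sequentiallyI)
      fix n :: nat assume n: "1 \<le> n"
      have "(\<Sum>w\<in>words N n. B w) = exp (- real n * P) * Z n"
        unfolding B_def Z_def sum_distrib_left by (intro sum.cong) (auto simp: words_iff)
      then have "ln (\<Sum>w\<in>words N n. B w) = - real n * P + ln (Z n)"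
        using Zpos by (simp add: ln_mult_pos)
      then show "ln (Z n) / real n - P = ln (\<Sum>w\<in>words N n. B w) / real n"
        using n by (simp add: field_simps)
    qed
    ultimately show "(\<lambda>n. ln (\<Sum>w\<in>words N n. B w) / real n) \<longlonglongrightarrow> 0"
      by (simp add: Lim_transform_eventually)
  qed
  interpret W: word_weight N B D \<kappa>' by (rule ww)
  define G where "G n = (\<Sum>w\<in>words N n. m w * ln (opnorm (M w) powr s))" for n
  obtain K where K: "K \<ge> 0" "\<And>w. w \<in> lists {1..N} \<Longrightarrow> - (K * real (length w)) \<le> ln (opnorm (M w))"
    using det_M_lower by blast
  have Gsub: "G (n + k) \<le> G n + G k" for n k
    unfolding G_def
  proof (rule sum_weight_append[OF m])
    fix u v assume uv: "u \<in> lists {1..N}" "v \<in> lists {1..N}"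
    then show "ln (opnorm (M (u @ v)) powr s) \<le> ln (opnorm (M u) powr s) + ln (opnorm (M v) powr s)"
      using mult_left_mono[OF ln_opnorm_append[OF uv], of s] s opnorm_M_pos[of u] opnorm_M_pos[of v] opnorm_M_pos[of "u @ v"]
      by (simp add: ln_powr algebra_simps)
  qed
  have "convergent (\<lambda>n. G n / real n)"
  proof (rule fekete[OF Gsub, where K = "s * K"])
    fix n
    have "- (s * K) * real n = (\<Sum>w\<in>words N n. m w) * (- (s * K) * real n)"
      using invariant_weight_total[OF m] by simp
    also have "\<dots> = (\<Sum>w\<in>words N n. m w * (- (s * K) * real n))" by (rule sum_distrib_right)
    also have "\<dots> \<le> G n"
      unfolding G_def
    proof (rule sum_mono)
      fix w assume "w \<in> words N n"
      then have w: "w \<in> lists {1..N}" "length w = n" by (auto simp: words_iff)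
      have "s * - (K * real n) \<le> s * ln (opnorm (M w))" using K(2)[OF w(1)] w(2) s by (intro mult_left_mono) auto
      then show "m w * (- (s * K) * real n) \<le> m w * ln (opnorm (M w) powr s)"
        using invariant_weight_nonneg[OF m w(1)] opnorm_M_pos[OF w(1)] by (intro mult_left_mono) (auto simp: ln_powr)
    qed
    finally show "- (s * K) * real n \<le> G n" .
  qed
  then have Glim: "(\<lambda>n. G n / real n) \<longlonglongrightarrow> lim (\<lambda>n. G n / real n)" by (simp add: convergent_LIMSEQ_iff)
  have "convergent (\<lambda>n. block_entropy N m n / real n)"
    by (rule fekete[OF block_entropy_subadditive[OF m], where K = 0]) (simp add: block_entropy_nonneg[OF m])
  then have Hlim: "(\<lambda>n. block_entropy N m n / real n) \<longlonglongrightarrow> lim (\<lambda>n. block_entropy N m n / real n)"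
    by (simp add: convergent_LIMSEQ_iff)
  have Peq: "P = lim (\<lambda>n. block_entropy N m n / real n) + lim (\<lambda>n. G n / real n)"
  proof -
    have "(\<integral>x. Phi A s n x \<partial>\<mu>) = G n" for n
      unfolding Phi_def G_def m_def by (rule integral_prefix)
    then show ?thesis
      using eq unfolding equilibrium_def P_def ks_entropy_def block_entropy_def m_def by simp
  qed
  have free: "0 \<le> W.free_energy m n" for n
  proof -
    have 1: "real n * lim (\<lambda>n. block_entropy N m n / real n) \<le> block_entropy N m n"
      by (rule subadditive_ge_limit[OF block_entropy_subadditive[OF m] Hlim])
    have 2: "real n * lim (\<lambda>n. G n / real n) \<le> G n"
      by (rule subadditive_ge_limit[OF Gsub Glim])
    have "W.free_energy m n = (\<Sum>w\<in>words N n. (- m w * ln (m w) + m w * ln (opnorm (M w) powr s)) - m w * (real n * P))"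
      unfolding W.free_energy_def
    proof (rule sum.cong[OF refl])
      fix w assume "w \<in> words N n"
      then have w: "w \<in> lists {1..N}" "length w = n" by (auto simp: words_iff)
      have e: "ln (B w) = - real n * P + ln (opnorm (M w) powr s)"
        using opnorm_M_pos[OF w(1)] w(2) by (simp add: B_def ln_mult_pos)
      show "m w * (ln (B w) - ln (m w)) = (- m w * ln (m w) + m w * ln (opnorm (M w) powr s)) - m w * (real n * P)"
        unfolding e by (simp add: algebra_simps)
    qed
    also have "\<dots> = block_entropy N m n + G n - real n * P"
      unfolding sum_subtractf sum.distrib block_entropy_def G_def sum_distrib_right[symmetric]
        invariant_weight_total[OF m] by simp
    finally show ?thesis using 1 2 Peq by (simp add: algebra_simps)
  qed
  obtain C where C: "C > 0" "\<And>w. w \<in> lists {1..N} \<Longrightarrow> B w / C \<le> m w \<and> m w \<le> C * B w"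
    using W.equilibrium_weight_comparable[OF m free] by blast
  then show ?thesis using that[of C] unfolding B_def m_def by blast
qed

end

section \<open>Invariant cones\<close>

text \<open>A multicone as a set of vectors: the union of its lines without the origin. Compactness
  of its unit vectors stands for closedness in the projective line; a finite union of intervals is
  recovered in \<open>multicone_of_cone\<close>.\<close>

definition invariant_cone :: "nat \<Rightarrow> (nat \<Rightarrow> real^2^2) \<Rightarrow> (real^2) set \<Rightarrow> bool" where
  "invariant_cone N A C \<longleftrightarrow> 0 \<notin> C \<and> (\<forall>x\<in>C. \<forall>c. c \<noteq> 0 \<longrightarrow> c *\<^sub>R x \<in> C) \<and> compact (C \<inter> sphere 0 1) \<and>
     (\<forall>a\<in>{1..N}. \<forall>x\<in>C. A a *v x \<in> interior C) \<and> C \<noteq> {} \<and> (\<exists>z. z \<noteq> 0 \<and> z \<notin> C)"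

section \<open>Eccentricity of products\<close>

context cocycle
begin

definition gap :: "nat list \<Rightarrow> real" where
  "gap w = \<bar>det (M w)\<bar> / (opnorm (M w))\<^sup>2"

lemma gap_pos: "w \<in> lists {1..N} \<Longrightarrow> 0 < gap w"
  using invertible_M[of w] opnorm_M_pos[of w] by (simp add: gap_def invertible_det_nz)

lemma gap_le_1: "gap w \<le> 1"
  using abs_det_le[of "M w"] by (simp add: gap_def divide_le_eq_1)

text \<open>Determinants multiply exactly, and norms up to the factor \<open>c\<close>.\<close>

lemma gap_append:
  assumes c: "c > 0" and am: "c * opnorm (M u) * opnorm (M v) \<le> opnorm (M (u @ v))"
    and w: "u \<in> lists {1..N}" "v \<in> lists {1..N}"
  shows "gap (u @ v) \<le> gap u * gap v / c\<^sup>2"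
proof -
  have p: "0 < opnorm (M u)" "0 < opnorm (M v)" using opnorm_M_pos w by auto
  have "(c * opnorm (M u) * opnorm (M v))\<^sup>2 \<le> (opnorm (M (u @ v)))\<^sup>2"
    using am p c by (intro power_mono) auto
  then have "\<bar>det (M (u @ v))\<bar> / (opnorm (M (u @ v)))\<^sup>2 \<le> \<bar>det (M (u @ v))\<bar> / (c * opnorm (M u) * opnorm (M v))\<^sup>2"
    using p c opnorm_M_pos[of "u @ v"] w by (intro divide_left_mono) auto
  also have "\<dots> = gap u * gap v / c\<^sup>2"
    by (simp add: gap_def matword_append det_mul abs_mult power_mult_distrib)
  finally show ?thesis by (simp add: gap_def)
qed

definition almost_mult :: "real \<Rightarrow> bool" where
  "almost_mult c \<longleftrightarrow> c > 0 \<and> (\<forall>u\<in>lists {1..N}. \<forall>v\<in>lists {1..N}.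
     c * opnorm (M u) * opnorm (M v) \<le> opnorm (M (u @ v)))"

text \<open>Splitting off a block of length \<open>n0\<close> gains \<open>c\<^sup>2 / 2\<close>
  against the loss \<open>1 / c\<^sup>2\<close> of \<open>gap_append\<close>, so each block halves
  the bound. The factor \<open>2\<close> in it covers remainders shorter than \<open>n0\<close>,
  since \<open>\<tau> ^ n0 = 1 / 2\<close>.\<close>

lemma gap_exponential:
  assumes am: "almost_mult c" and n0: "n0 \<ge> 1" "\<And>w. w \<in> words N n0 \<Longrightarrow> gap w \<le> c\<^sup>2 / 2"
  obtains C \<tau> where "C > 0" "0 < \<tau>" "\<tau> < 1" "\<And>w. w \<in> lists {1..N} \<Longrightarrow> gap w \<le> C * \<tau> ^ length w"
proof -
  have c: "c > 0" using am by (simp add: almost_mult_def)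
  define \<tau> :: real where "\<tau> = (1/2) powr (1 / real n0)"
  have \<tau>: "0 < \<tau>" by (simp add: \<tau>_def)
  have "\<tau> < (1/2) powr 0" unfolding \<tau>_def using n0(1) by (intro powr_less_mono') auto
  then have \<tau>1: "\<tau> < 1" by simp
  have \<tau>n: "\<tau> ^ n0 = 1 / 2" using n0(1) by (simp add: \<tau>_def powr_realpow[symmetric] powr_powr)
  have "gap w \<le> 2 * \<tau> ^ length w" if "w \<in> lists {1..N}" for w
    using that
  proof (induction "length w" arbitrary: w rule: less_induct)
    case less
    show ?case
    proof (cases "length w < n0")
      case True
      have "\<tau> ^ n0 \<le> \<tau> ^ length w" using True \<tau> \<tau>1 by (intro power_decreasing) auto
      then show ?thesis using gap_le_1[of w] \<tau>n by simp
    next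
      case False
      define u v where "u = take n0 w" and "v = drop n0 w"
      have w: "w = u @ v" by (simp add: u_def v_def)
      have uv: "u \<in> lists {1..N}" "v \<in> lists {1..N}" "length u = n0" "length w = n0 + length v"
        using less.prems False by (auto simp: w) (auto simp: u_def v_def)
      have "gap w \<le> gap u * gap v / c\<^sup>2"
        unfolding w using am uv c by (intro gap_append) (auto simp: almost_mult_def)
      also have "\<dots> \<le> (c\<^sup>2 / 2) * gap v / c\<^sup>2"
        using n0(2)[of u] uv gap_pos[of v] by (intro divide_right_mono mult_right_mono) (auto simp: words_iff)
      also have "\<dots> = (1/2) * gap v" using c by simp
      also have "\<dots> \<le> (1/2) * (2 * \<tau> ^ length v)"
        using uv n0(1) by (intro mult_left_mono less.hyps) auto
      also have "\<dots> = 2 * \<tau> ^ length w" by (simp add: uv(4) power_add \<tau>n)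
      finally show ?thesis .
    qed
  qed
  then show ?thesis using that[of 2 \<tau>] \<tau> \<tau>1 by simp
qed

end

section \<open>Expansion and contraction inside an invariant cone\<close>

locale cocycle_cone = cocycle +
  fixes C :: "(real^2) set"
  assumes cone: "invariant_cone N A C"
begin

lemma zero_notin: "0 \<notin> C" using cone by (simp add: invariant_cone_def)

lemma C_scale: "x \<in> C \<Longrightarrow> c \<noteq> 0 \<Longrightarrow> c *\<^sub>R x \<in> C" using cone by (simp add: invariant_cone_def)

lemma C_normalize: "x \<in> C \<Longrightarrow> (1 / norm x) *\<^sub>R x \<in> C \<inter> sphere 0 1"
  using C_scale[of x "1 / norm x"] zero_notin by auto

lemma C_compact: "compact (C \<inter> sphere 0 1)" using cone by (simp add: invariant_cone_def)

lemma C_step: "a \<in> {1..N} \<Longrightarrow> x \<in> C \<Longrightarrow> A a *v x \<in> interior C"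
  using cone by (simp add: invariant_cone_def)

lemma C_word: "w \<in> lists {1..N} \<Longrightarrow> x \<in> C \<Longrightarrow> M w *v x \<in> C"
proof (induction w)
  case (Cons a w)
  then have "A a *v (M w *v x) \<in> interior C" by (intro C_step) auto
  then show ?case using interior_subset by (auto simp: matrix_vector_mul_assoc)
qed simp

text \<open>Unit vectors of the first images of the cone. They form a compact subset of the interior
  of \<open>C\<close>, which gives a uniform margin.\<close>

definition image1 :: "(real^2) set" where
  "image1 = (\<Union>a\<in>{1..N}. (\<lambda>x. (1 / norm (A a *v x)) *\<^sub>R (A a *v x)) ` (C \<inter> sphere 0 1))"

lemma A_nz: "a \<in> {1..N} \<Longrightarrow> x \<in> C \<Longrightarrow> A a *v x \<noteq> 0"
  using C_step interior_subset zero_notin by (metis subsetD)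

lemma image1_compact: "compact image1"
  unfolding image1_def
proof (intro compact_UN compact_continuous_image C_compact)
  fix a assume a: "a \<in> {1..N}"
  show "continuous_on (C \<inter> sphere 0 1) (\<lambda>x. (1 / norm (A a *v x)) *\<^sub>R (A a *v x))"
    using A_nz[OF a] by (intro continuous_intros) auto
qed simp

lemma interior_scale: "x \<in> interior C \<Longrightarrow> c \<noteq> 0 \<Longrightarrow> c *\<^sub>R x \<in> interior C"
proof -
  assume x: "x \<in> interior C" and c: "c \<noteq> 0"
  have "(*\<^sub>R) c ` interior C \<subseteq> C" using C_scale c interior_subset by blast
  moreover have "open ((*\<^sub>R) c ` interior C)" using c by (intro open_scaling open_interior)
  ultimately have "(*\<^sub>R) c ` interior C \<subseteq> interior C" by (rule interior_maximal)
  then show ?thesis using x by blast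
qed

lemma image1_unit: "p \<in> image1 \<Longrightarrow> norm p = 1"
  using A_nz by (auto simp: image1_def)

lemma image1_interior: "image1 \<subseteq> interior C"
  unfolding image1_def using C_step A_nz by (auto intro!: interior_scale)

lemma image1I:
  assumes a: "a \<in> {1..N}" and x: "x \<in> C"
  shows "(1 / norm (A a *v x)) *\<^sub>R (A a *v x) \<in> image1"
proof -
  let ?y = "(1 / norm x) *\<^sub>R x"
  have "norm x > 0" using x zero_notin by auto
  then have "(1 / norm (A a *v ?y)) *\<^sub>R (A a *v ?y) = (1 / norm (A a *v x)) *\<^sub>R (A a *v x)"
    using A_nz[OF a x] by (simp add: matrix_vector_mult_scaleR)
  then show ?thesis unfolding image1_def using a C_normalize[OF x] by (metis (no_types, lifting) UN_I imageI)
qed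

text \<open>The functional \<open>y \<mapsto> M w y \<times> z\<close> has no zero on a ball of fixed radius around \<open>p\<close>, because
  \<open>M w\<close> maps that ball into the cone, which omits the direction \<open>z\<close>.\<close>

lemma image1_expand:
  obtains c where "c > 0" "\<And>p w. p \<in> image1 \<Longrightarrow> w \<in> lists {1..N} \<Longrightarrow> c * opnorm (M w) \<le> norm (M w *v p)"
proof -
  obtain z where z: "z \<noteq> 0" "z \<notin> C" using cone by (auto simp: invariant_cone_def)
  obtain e where e: "e > 0" "\<And>p. p \<in> image1 \<Longrightarrow> cball p e \<subseteq> C"
  proof -
    obtain e where "e > 0" "(\<Union>p\<in>image1. cball p e) \<subseteq> interior C"
      using compact_subset_open_imp_cball_epsilon_subset[OF image1_compact open_interior image1_interior] by blast
    then show ?thesis using that interior_subset by (meson UN_subset_iff order_trans)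
  qed
  \<comment> \<open>No vector of the cone is parallel to \<open>z\<close>, so by compactness the
    angles to \<open>z\<close> are bounded below.\<close>
  obtain \<eta> where \<eta>: "\<eta> > 0" "\<And>x. x \<in> C \<Longrightarrow> \<eta> * norm x \<le> \<bar>cross2 x z\<bar>"
  proof -
    let ?S = "C \<inter> sphere 0 1"
    have ne: "?S \<noteq> {}"
    proof -
      obtain x where "x \<in> C" using cone by (auto simp: invariant_cone_def)
      then show ?thesis using C_normalize by blast
    qed
    have "continuous_on ?S (\<lambda>x. \<bar>cross2 x z\<bar>)" unfolding cross2_def by (intro continuous_intros)
    then obtain x0 where x0: "x0 \<in> ?S" "\<And>x. x \<in> ?S \<Longrightarrow> \<bar>cross2 x0 z\<bar> \<le> \<bar>cross2 x z\<bar>"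
      using continuous_attains_inf[OF C_compact ne] by metis
    have "cross2 x0 z \<noteq> 0"
    proof
      assume "cross2 x0 z = 0"
      then obtain k where "z = k *\<^sub>R x0" using cross2_eq_0D x0(1) zero_notin by (metis IntD1)
      moreover have "k \<noteq> 0" using calculation z by auto
      ultimately show False using C_scale x0(1) z by auto
    qed
    moreover have "\<bar>cross2 x0 z\<bar> * norm x \<le> \<bar>cross2 x z\<bar>" if x: "x \<in> C" for x
    proof -
      have "norm x > 0" using x zero_notin by auto
      moreover have "\<bar>cross2 x0 z\<bar> \<le> \<bar>cross2 ((1 / norm x) *\<^sub>R x) z\<bar>" by (rule x0(2)[OF C_normalize[OF x]])
      ultimately show ?thesis by (simp add: abs_mult field_simps)
    qed
    ultimately show ?thesis using that[of "\<bar>cross2 x0 z\<bar>"] by auto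
  qed
  \<comment> \<open>Comes from writing \<open>y\<close> as the difference of \<open>p + y\<close>
    and \<open>p\<close>: the image of \<open>p + y\<close> has at most
    \<open>2 * norm z / \<eta>\<close> times the norm of the image of \<open>p\<close>.\<close>
  define K where "K = 2 * norm z / \<eta> + 1"
  have K: "K > 0" using \<eta> z by (simp add: K_def add_nonneg_pos)
  have "e / K * opnorm (M w) \<le> norm (M w *v p)" if p: "p \<in> image1" and w: "w \<in> lists {1..N}" for p w
  proof -
    define \<psi> where "\<psi> y = cross2 (M w *v y) z" for y
    have add: "\<psi> (x + t *\<^sub>R y) = \<psi> x + t * \<psi> y" for x y t
      by (simp add: \<psi>_def matrix_vector_right_distrib matrix_vector_mult_scaleR cross2_add)
    have big: "\<eta> * norm (M w *v (p + y)) \<le> \<bar>\<psi> (p + y)\<bar>" "M w *v (p + y) \<noteq> 0" if "norm y \<le> e" for y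
    proof -
      have "p + y \<in> C" using e(2)[OF p] that by (auto simp: cball_def dist_norm)
      then have "M w *v (p + y) \<in> C" using C_word w by blast
      then show "\<eta> * norm (M w *v (p + y)) \<le> \<bar>\<psi> (p + y)\<bar>" "M w *v (p + y) \<noteq> 0"
        using \<eta>(2) zero_notin by (auto simp: \<psi>_def)
    qed
    have small: "\<bar>\<psi> y\<bar> \<le> \<bar>\<psi> p\<bar>" if y: "norm y \<le> e" for y
    proof (rule ccontr)
      assume "\<not> ?thesis"
      then have lt: "\<bar>\<psi> p\<bar> < \<bar>\<psi> y\<bar>" by simp
      then have nz: "\<psi> y \<noteq> 0" by auto
      \<comment> \<open>The zero of the functional on the line through \<open>p\<close> with
        direction \<open>y\<close>; it would lie in the ball.\<close>
      define t where "t = - \<psi> p / \<psi> y"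
      have "\<bar>t\<bar> \<le> 1" using lt nz by (simp add: t_def field_simps)
      then have "norm (t *\<^sub>R y) \<le> e" using y e(1) mult_mono[of "\<bar>t\<bar>" 1 "norm y" e] by simp
      from big[OF this] have "\<psi> (p + t *\<^sub>R y) \<noteq> 0" using \<eta>(1) by (auto simp: mult_le_0_iff)
      moreover have "\<psi> (p + t *\<^sub>R y) = 0" unfolding add t_def using nz by simp
      ultimately show False by blast
    qed
    obtain x where x: "norm x = 1" "norm (M w *v x) = opnorm (M w)" by (rule opnorm_attained)
    define y where "y = e *\<^sub>R x"
    have y: "norm y \<le> e" using x e by (simp add: y_def)
    have "\<psi> (p + y) = \<psi> p + \<psi> y" using add[of p 1 y] by simp
    then have "\<eta> * norm (M w *v (p + y)) \<le> 2 * \<bar>\<psi> p\<bar>" using big(1)[OF y] small[OF y] by linarith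
    also have "\<bar>\<psi> p\<bar> \<le> norm (M w *v p) * norm z" unfolding \<psi>_def by (rule abs_cross2_le)
    finally have "norm (M w *v (p + y)) \<le> 2 * norm z / \<eta> * norm (M w *v p)"
      using \<eta>(1) by (simp add: field_simps)
    moreover have "norm (M w *v y) \<le> norm (M w *v (p + y)) + norm (M w *v p)"
      using norm_triangle_ineq4[of "M w *v (p + y)" "M w *v p"] by (simp add: matrix_vector_right_distrib)
    ultimately have "norm (M w *v y) \<le> K * norm (M w *v p)" by (simp add: K_def algebra_simps)
    moreover have "norm (M w *v y) = e * opnorm (M w)"
      using x e by (simp add: y_def matrix_vector_mult_scaleR)
    ultimately show ?thesis using K by (simp add: field_simps)
  qed
  moreover have "e / K > 0" using e K by simp
  ultimately show ?thesis using that by blast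
qed

text \<open>The letter of \<open>w\<close> that acts first brings \<open>x\<close> into the first
  image, where \<open>image1_expand\<close> applies; it shrinks \<open>x\<close> by no more than the
  least gap of a letter allows. The bound \<open>1\<close> on \<open>c\<close> is for the empty
  word.\<close>

lemma C_expand:
  obtains c where "c > 0" "\<And>x w. x \<in> C \<Longrightarrow> w \<in> lists {1..N} \<Longrightarrow> c * opnorm (M w) * norm x \<le> norm (M w *v x)"
proof -
  obtain c1 where c1: "c1 > 0" "\<And>p w. p \<in> image1 \<Longrightarrow> w \<in> lists {1..N} \<Longrightarrow> c1 * opnorm (M w) \<le> norm (M w *v p)"
    using image1_expand by blast
  define g where "g = Min ((\<lambda>a. gap [a]) ` {1..N})"
  have g: "0 < g" "\<And>a. a \<in> {1..N} \<Longrightarrow> g \<le> gap [a]"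
    unfolding g_def using N1 by (auto simp: Min_gr_iff gap_pos)
  define c where "c = min 1 (c1 * g)"
  have c: "c > 0" using c1 g by (simp add: c_def)
  have "c * opnorm (M w) * norm x \<le> norm (M w *v x)" if x: "x \<in> C" and w: "w \<in> lists {1..N}" for x w
  proof (cases w rule: rev_cases)
    case Nil
    have "c * norm x \<le> 1 * norm x" by (intro mult_right_mono) (auto simp: c_def)
    then show ?thesis using Nil by simp
  next
    case (snoc u a)
    have ua: "u \<in> lists {1..N}" "a \<in> {1..N}" using w snoc by auto
    let ?y = "A a *v x"
    have y: "norm ?y > 0" using A_nz[OF ua(2) x] by simp
    have opa: "opnorm (A a) > 0" using ua(2) inv_A invertible_opnorm_pos by blast
    have "c1 * opnorm (M u) \<le> norm (M u *v ((1 / norm ?y) *\<^sub>R ?y))"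
      by (rule c1(2)[OF image1I[OF ua(2) x] ua(1)])
    then have 1: "c1 * opnorm (M u) * norm ?y \<le> norm (M w *v x)"
      using y by (simp add: snoc matword_append matrix_vector_mult_scaleR matrix_vector_mul_assoc field_simps)
    have 2: "gap [a] * opnorm (A a) * norm x \<le> norm ?y"
      using norm_mv_ge[of "A a" x] opa by (simp add: gap_def field_simps power2_eq_square)
    have 3: "opnorm (M w) \<le> opnorm (M u) * opnorm (A a)"
      using opnorm_mult[of "M u" "A a"] by (simp add: snoc matword_append)
    have "c * opnorm (M w) * norm x \<le> (c1 * g) * (opnorm (M u) * opnorm (A a)) * norm x"
      using 3 c1 g by (intro mult_right_mono mult_mono) (auto simp: c_def)
    also have "\<dots> \<le> (c1 * gap [a]) * (opnorm (M u) * opnorm (A a)) * norm x"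
      using c1 g(2)[OF ua(2)] by (intro mult_right_mono mult_left_mono) auto
    also have "\<dots> = (c1 * opnorm (M u)) * (gap [a] * opnorm (A a) * norm x)" by simp
    also have "\<dots> \<le> (c1 * opnorm (M u)) * norm ?y" using 2 c1 by (intro mult_left_mono) auto
    also have "\<dots> \<le> norm (M w *v x)" using 1 by simp
    finally show ?thesis .
  qed
  with c that show ?thesis by blast
qed

text \<open>A vector of the cone is stretched almost maximally by \<open>M v\<close>; its image is
  again in the cone and is stretched almost maximally by \<open>M u\<close>.\<close>

lemma cone_almost_mult: "\<exists>c. almost_mult c"
proof -
  obtain c where c: "c > 0" "\<And>x w. x \<in> C \<Longrightarrow> w \<in> lists {1..N} \<Longrightarrow> c * opnorm (M w) * norm x \<le> norm (M w *v x)"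
    using C_expand by blast
  obtain x where x: "x \<in> C" using cone by (auto simp: invariant_cone_def)
  have nx: "norm x > 0" using x zero_notin by auto
  have "(c * c) * opnorm (M u) * opnorm (M v) \<le> opnorm (M (u @ v))"
    if u: "u \<in> lists {1..N}" and v: "v \<in> lists {1..N}" for u v
  proof -
    have "c * opnorm (M u) * (c * opnorm (M v) * norm x) \<le> c * opnorm (M u) * norm (M v *v x)"
      using c x v by (intro mult_left_mono) auto
    also have "\<dots> \<le> norm (M u *v (M v *v x))" using c C_word x u v by blast
    also have "\<dots> \<le> opnorm (M (u @ v)) * norm x"
      using norm_mv_le[of "M (u @ v)" x] by (simp add: matword_append matrix_vector_mul_assoc)
    finally have "((c * c) * opnorm (M u) * opnorm (M v)) * norm x \<le> opnorm (M (u @ v)) * norm x"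
      by (simp add: mult_ac)
    then show ?thesis using nx by simp
  qed
  then show ?thesis using c unfolding almost_mult_def by (intro exI[of _ "c * c"]) auto
qed

text \<open>Otherwise every direction of \<open>C\<close> occurs in the first image, hence in the
  interior. Then \<open>C\<close> is open and closed in the punctured plane, which is connected,
  contrary to the omitted direction.\<close>

lemma exists_outside_image:
  obtains p e where "p \<in> C" "norm p = 1" "e > 0" "\<And>y. y \<in> image1 \<Longrightarrow> e \<le> \<bar>cross2 p y\<bar>"
proof -
  have "\<exists>p\<in>C. \<forall>y\<in>image1. cross2 p y \<noteq> 0"
  proof (rule ccontr)
    assume "\<not> ?thesis"
    then have *: "\<exists>y\<in>image1. cross2 p y = 0" if "p \<in> C" for p using that by blast
    have "C \<subseteq> interior C"
    proof
      fix p assume p: "p \<in> C"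
      then obtain y where y: "y \<in> image1" "cross2 p y = 0" using * by blast
      have "y \<noteq> 0" using image1_unit[OF y(1)] by auto
      then obtain k where k: "p = k *\<^sub>R y" using cross2_eq_0D[of y p] y(2) cross2_commute[of y p] by auto
      moreover have "k \<noteq> 0" using k p zero_notin by auto
      ultimately show "p \<in> interior C" using y(1) image1_interior interior_scale by blast
    qed
    then have "C = interior C" using interior_subset by blast
    then have oC: "open C" using open_interior by metis
    have "closedin (top_of_set (- {0})) C"
    proof -
      have "(1 / norm x) *\<^sub>R x \<in> C \<longleftrightarrow> x \<in> C" if "x \<noteq> 0" for x
        using C_scale[of x "1 / norm x"] C_scale[of "(1 / norm x) *\<^sub>R x" "norm x"] that by auto
      then have "- {0} - C = {x \<in> - {0}. (1 / norm x) *\<^sub>R x \<in> - (C \<inter> sphere 0 1)}"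
        by auto
      moreover have "openin (top_of_set (- {0})) \<dots>"
      proof -
        have "continuous_on (- {0}) (\<lambda>x :: real^2. (1 / norm x) *\<^sub>R x)" by (intro continuous_intros) auto
        moreover have "open (- (C \<inter> sphere 0 1))" using compact_imp_closed[OF C_compact] by blast
        ultimately show ?thesis
          using continuous_openin_preimage_gen[of "- {0}" "\<lambda>x. (1 / norm x) *\<^sub>R x" "- (C \<inter> sphere 0 1)"]
          by (simp add: vimage_def Int_def)
      qed
      ultimately show ?thesis using zero_notin by (auto simp: closedin_def)
    qed
    moreover have "openin (top_of_set (- {0})) C"
      using oC zero_notin by (intro open_openin_trans) auto
    moreover have "connected (- {0 :: real^2})" by (rule connected_punctured_universe) simp
    ultimately have "C = {} \<or> C = - {0}" by (metis connected_clopen)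
    then show False using cone by (auto simp: invariant_cone_def)
  qed
  then obtain p0 where p0: "p0 \<in> C" "\<And>y. y \<in> image1 \<Longrightarrow> cross2 p0 y \<noteq> 0" by blast
  define p where "p = (1 / norm p0) *\<^sub>R p0"
  have p: "p \<in> C" "norm p = 1" using C_normalize[OF p0(1)] by (auto simp: p_def)
  have pn: "cross2 p y \<noteq> 0" if "y \<in> image1" for y
    using p0(2)[OF that] p0(1) zero_notin by (auto simp: p_def)
  have ne: "image1 \<noteq> {}" using image1I[OF _ p(1)] N1 by fastforce
  have "continuous_on image1 (\<lambda>y. \<bar>cross2 p y\<bar>)" unfolding cross2_def by (intro continuous_intros)
  then obtain y0 where "y0 \<in> image1" "\<And>y. y \<in> image1 \<Longrightarrow> \<bar>cross2 p y0\<bar> \<le> \<bar>cross2 p y\<bar>"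
    using continuous_attains_inf[OF image1_compact ne] by metis
  then show ?thesis using that[OF p, of "\<bar>cross2 p y0\<bar>"] pn by auto
qed

text \<open>If all products along the prefixes of a word are quasi-conformal, then the images under them of a
  direction outside the first image of the cone are uniformly separated; so the word is short.\<close>

lemma gap_small:
  assumes \<delta>: "\<delta> > 0"
  obtains n where "n \<ge> 1" "\<And>w. w \<in> words N n \<Longrightarrow> gap w \<le> \<delta>"
proof -
  obtain c where am: "almost_mult c" using cone_almost_mult by blast
  then have c: "c > 0" by (simp add: almost_mult_def)
  obtain p e where p: "p \<in> C" "norm p = 1" "e > 0" "\<And>y. y \<in> image1 \<Longrightarrow> e \<le> \<bar>cross2 p y\<bar>"
    using exists_outside_image by blast
  \<comment> \<open>Lower bound for the sine of the angle between \<open>r i\<close> and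
    \<open>r j\<close>: the area \<open>e\<close> between \<open>p\<close> and the first image,
    reduced by a prefix gap of at least \<open>c\<^sup>2 * \<delta>\<close>.\<close>
  define \<rho> where "\<rho> = c\<^sup>2 * \<delta> * e"
  have \<rho>: "\<rho> > 0" using c \<delta> p by (simp add: \<rho>_def)
  obtain k where k: "finite k" "sphere (0 :: real^2) 1 \<subseteq> (\<Union>x\<in>k. ball x (\<rho> / 2))"
    using compact_imp_seq_compact[of "sphere (0 :: real^2) 1", THEN seq_compact_imp_totally_bounded] \<rho>
    by (metis compact_sphere half_gt_zero)
  define n where "n = Suc (card k)"
  have "gap w \<le> \<delta>" if w: "w \<in> words N n" for w
  proof (rule ccontr)
    assume "\<not> ?thesis"
    then have big: "\<delta> < gap w" by simp
    have wl: "w \<in> lists {1..N}" "length w = n" using w by (auto simp: words_iff)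
    have sub: "take i w \<in> lists {1..N}" "drop i w \<in> lists {1..N}" for i
      using wl by (auto dest: in_set_takeD in_set_dropD)
    \<comment> \<open>Gaps are at most \<open>1\<close> and submultiplicative up to
      \<open>1 / c\<^sup>2\<close>, so every prefix of a word with a large gap has a large
      gap.\<close>
    have gap_take: "c\<^sup>2 * \<delta> \<le> gap (take i w)" for i
    proof -
      have "gap (take i w @ drop i w) \<le> gap (take i w) * gap (drop i w) / c\<^sup>2"
        using am sub c unfolding almost_mult_def by (intro gap_append) blast+
      then have "gap w \<le> gap (take i w) * gap (drop i w) / c\<^sup>2" by simp
      also have "\<dots> \<le> gap (take i w) * 1 / c\<^sup>2"
        using gap_pos[OF sub(1), of i] gap_le_1 by (intro divide_right_mono mult_left_mono) auto
      finally have "c\<^sup>2 * gap w \<le> gap (take i w)" using c by (simp add: field_simps)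
      moreover have "c\<^sup>2 * \<delta> \<le> c\<^sup>2 * gap w" using big by (intro mult_left_mono) auto
      ultimately show ?thesis by linarith
    qed
    define q where "q i = M (take i w) *v p" for i
    define r where "r i = (1 / norm (q i)) *\<^sub>R q i" for i
    have q0: "q i \<noteq> 0" for i using C_word[OF sub(1) p(1), of i] zero_notin by (auto simp: q_def)
    have r1: "norm (r i) = 1" for i using q0 by (simp add: r_def)
    have sep: "\<rho> \<le> norm (r i - r j)" if ij: "i < j" "j \<le> n" for i j
    proof -
      define a where "a = w ! i"
      have a: "a \<in> {1..N}" using wl ij nth_mem[of i w] by (auto simp: a_def)
      define v where "v = drop (Suc i) (take j w)"
      have v: "v \<in> lists {1..N}" using wl by (auto simp: v_def dest!: in_set_dropD in_set_takeD)
      have split: "take j w = take i w @ a # v"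
      proof -
        have "take j w = take i (take j w) @ take j w ! i # drop (Suc i) (take j w)"
          using ij wl by (intro id_take_nth_drop) simp
        then show ?thesis using ij by (simp add: v_def a_def min_def)
      qed
      define y where "y = A a *v (M v *v p)"
      \<comment> \<open>Up to the common factor \<open>M (take i w)\<close>, the vectors
        \<open>q i\<close> and \<open>q j\<close> are \<open>p\<close> and a vector \<open>y\<close>
        whose direction lies in the first image.\<close>
      have qj: "q j = M (take i w) *v y"
        unfolding q_def split y_def by (simp add: matword_append matrix_vector_mul_assoc matrix_mul_assoc)
      have y: "(1 / norm y) *\<^sub>R y \<in> image1" unfolding y_def by (rule image1I[OF a C_word[OF v p(1)]])
      have yn: "norm y > 0" using q0[of j] by (auto simp: qj)
      have cp: "e * norm y \<le> \<bar>cross2 p y\<bar>" using p(4)[OF y] yn by (simp add: field_simps abs_mult)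
      let ?P = "M (take i w)"
      have op: "opnorm ?P > 0" using opnorm_M_pos[OF sub(1)] .
      have "\<rho> * (norm (q i) * norm (q j)) \<le> \<rho> * ((opnorm ?P * 1) * (opnorm ?P * norm y))"
        using norm_mv_le[of ?P p] norm_mv_le[of ?P y] p(2) \<rho>
        by (intro mult_left_mono mult_mono) (auto simp: q_def[of i] qj)
      also have "\<dots> = (c\<^sup>2 * \<delta>) * (opnorm ?P)\<^sup>2 * (e * norm y)" by (simp add: \<rho>_def power2_eq_square)
      also have "\<dots> \<le> gap (take i w) * (opnorm ?P)\<^sup>2 * \<bar>cross2 p y\<bar>"
        using gap_take[of i] cp p(3) gap_pos[OF sub(1), of i] yn by (intro mult_mono) auto
      also have "\<dots> = \<bar>cross2 (q i) (q j)\<bar>"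
        using op by (simp add: gap_def q_def[of i] qj cross2_mv abs_mult)
      finally have "\<rho> \<le> \<bar>cross2 (r i) (r j)\<bar>"
        using q0[of i] q0[of j] by (simp add: r_def abs_mult field_simps)
      also have "cross2 (r i) (r j) = cross2 (r i - r j) (r j)"
        by (simp add: cross2_def algebra_simps)
      also have "\<bar>\<dots>\<bar> \<le> norm (r i - r j)" using abs_cross2_le[of "r i - r j" "r j"] r1 by simp
      finally show ?thesis .
    qed
    have "\<exists>x\<in>k. r i \<in> ball x (\<rho> / 2)" for i
    proof -
      have "r i \<in> sphere 0 1" using r1 by simp
      then show ?thesis using k(2) by blast
    qed
    then obtain h where h: "\<And>i. h i \<in> k" "\<And>i. r i \<in> ball (h i) (\<rho> / 2)" by metis
    have "inj_on h {..n}"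
    proof (rule inj_onI)
      fix i j assume ij: "i \<in> {..n}" "j \<in> {..n}" "h i = h j"
      have "dist (h i) (r i) < \<rho> / 2" "dist (h i) (r j) < \<rho> / 2"
        using h(2)[of i] h(2)[of j] ij(3) by simp_all
      then have "dist (r i) (r j) < \<rho>" by (rule dist_triangle_half_r)
      then show "i = j"
        using sep[of i j] sep[of j i] ij by (cases i j rule: linorder_cases) (auto simp: dist_norm norm_minus_commute)
    qed
    then have "card {..n} \<le> card k" using h(1) k(1) by (intro card_inj_on_le[of h]) auto
    then show False by (simp add: n_def)
  qed
  then show ?thesis using that[of n] by (simp add: n_def)
qed

end

lemma common_len_agree: "x \<noteq> y \<Longrightarrow> j < common_len x y \<Longrightarrow> x j = y j"
  unfolding common_len_def by (metis (mono_tags) not_less_Least)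

lemma abs_ln_diff_le:
  assumes "l \<le> x" "l \<le> y" "0 < (l :: real)" "\<bar>x - y\<bar> \<le> d"
  shows "\<bar>ln x - ln y\<bar> \<le> d / l"
proof -
  have *: "ln x - ln y \<le> d / l" if "l \<le> x" "l \<le> y" "\<bar>x - y\<bar> \<le> d" for x y
  proof -
    have "ln x - ln y = ln (x / y)" using that assms(3) by (simp add: ln_div)
    also have "\<dots> \<le> x / y - 1" using that assms(3) by (intro ln_le_minus_one) simp
    also have "\<dots> = (x - y) / y" using that assms(3) by (simp add: field_simps)
    also have "\<dots> \<le> d / y" using that assms(3) by (intro divide_right_mono) auto
    also have "\<dots> \<le> d / l" using that assms(3) by (intro divide_left_mono) auto
    finally show ?thesis .
  qed
  show ?thesis using *[of x y] *[of y x] assms by (auto simp: abs_le_iff abs_minus_commute)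
qed

section \<open>The potential given by an invariant cone\<close>

context cocycle_cone
begin

lemma prefix_lists: "x \<in> Sig N \<Longrightarrow> prefix x n \<in> lists {1..N}"
  using prefix_in_words words_in_lists by blast

text \<open>\<open>F x\<close> is the logarithmic stretch, by the letter \<open>x 0\<close>, of the
  limit direction at \<open>shift x\<close>. Its sums telescope already at finite level: there they
  compare the norms of one vector of the cone before and after applying
  \<open>M (prefix x n)\<close>, and by \<open>C_expand\<close> this ratio is the operator norm up
  to the factor \<open>c\<close>.\<close>

theorem cone_imp_potential:
  "\<exists>K f. K > 0 \<and> holder N f \<and> (\<forall>x\<in>Sig N. \<forall>n. \<bar>birkhoff f n x - ln (opnorm (M (prefix x n)))\<bar> \<le> K)"
proof -
  obtain c where c: "c > 0" "\<And>x w. x \<in> C \<Longrightarrow> w \<in> lists {1..N} \<Longrightarrow> c * opnorm (M w) * norm x \<le> norm (M w *v x)"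
    using C_expand by blast
  obtain b where am: "almost_mult b" using cone_almost_mult by blast
  then have b: "b > 0" by (simp add: almost_mult_def)
  have "b\<^sup>2 / 2 > 0" using b by simp
  from gap_small[OF this] obtain n0 where n0: "n0 \<ge> 1" "\<And>w. w \<in> words N n0 \<Longrightarrow> gap w \<le> b\<^sup>2 / 2" by blast
  from gap_exponential[OF am n0] obtain G \<tau> where G: "G > 0" "0 < \<tau>" "\<tau> < 1"
    "\<And>w. w \<in> lists {1..N} \<Longrightarrow> gap w \<le> G * \<tau> ^ length w" by blast
  define g where "g = Min ((\<lambda>a. gap [a]) ` {1..N})"
  have g: "0 < g" "\<And>a. a \<in> {1..N} \<Longrightarrow> g \<le> gap [a]"
    unfolding g_def using N1 by (auto simp: Min_gr_iff gap_pos)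
  obtain v0 where v0: "v0 \<in> C" using cone by (auto simp: invariant_cone_def)
  define V where "V x n = M (prefix x n) *v v0" for x n
  have VC: "V x n \<in> C" if "x \<in> Sig N" for x n
    unfolding V_def by (rule C_word[OF prefix_lists[OF that] v0])
  have Vn: "norm (V x n) > 0" if "x \<in> Sig N" for x n using VC[OF that, of n] zero_notin by auto
  have V_add: "V x (n + m) = M (prefix x n) *v V ((shift ^^ n) x) m" for x n m
    by (simp add: V_def prefix_add matword_append matrix_vector_mul_assoc)
  have V_Suc: "V x (Suc m) = A (x 0) *v V (shift x) m" for x m
    using V_add[of x 1 m] by (simp add: prefix_def)
  have letter: "x 0 \<in> {1..N}" if "x \<in> Sig N" for x using that by (simp add: Sig_def)
  have sh: "shift x \<in> Sig N" if "x \<in> Sig N" for x using shift_Sig[OF that, of 1] by simp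
  define f where "f n x = ln (norm (V x (Suc n))) - ln (norm (V (shift x) n))" for n x
  have f_eq: "f n x = ln (norm (A (x 0) *v ((1 / norm (V (shift x) n)) *\<^sub>R V (shift x) n)))"
    if x: "x \<in> Sig N" for n x
  proof -
    have "norm (V x (Suc n)) > 0" by (rule Vn[OF x])
    then show ?thesis using Vn[OF sh[OF x], of n]
      by (simp add: f_def V_Suc matrix_vector_mult_scaleR ln_div)
  qed
  have opA: "opnorm (A a) > 0" if "a \<in> {1..N}" for a using inv_A that invertible_opnorm_pos by blast
  have A_low: "gap [a] * opnorm (A a) * norm x \<le> norm (A a *v x)" if "a \<in> {1..N}" for a x
    using norm_mv_ge[of "A a" x] opA[OF that] by (simp add: gap_def field_simps power2_eq_square)
  \<comment> \<open>The factor \<open>2\<close> is that of \<open>norm_mv_diff_le\<close>,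
    \<open>G / c\<^sup>2\<close> comes from the contraction of directions, and \<open>g\<close>
    bounds the norms inside the logarithm from below, relative to the norm of the letter.\<close>
  define E where "E = 2 * G / (c\<^sup>2 * g)"
  have E: "E > 0" using G c g by (simp add: E_def)
  \<comment> \<open>Agreement at the positions \<open>0\<close> to \<open>k\<close> means the same
    first letter and \<open>k\<close> further common letters \<open>h\<close>, whose product
    contracts angles in proportion to its gap.\<close>
  have close: "\<bar>f n x - f m y\<bar> \<le> E * \<tau> ^ k"
    if x: "x \<in> Sig N" and y: "y \<in> Sig N" and agree: "\<And>j. j \<le> k \<Longrightarrow> x j = y j" and nm: "n \<ge> k" "m \<ge> k" for n m x y k
  proof -
    define a where "a = x 0"
    have a: "a \<in> {1..N}" "y 0 = a" using letter[OF x] agree[of 0] by (auto simp: a_def)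
    define h where "h = prefix (shift x) k"
    have h: "h \<in> lists {1..N}" "length h = k" using prefix_lists[OF sh[OF x]] by (auto simp: h_def)
    have h': "h = prefix (shift y) k"
      unfolding h_def using agree by (intro nth_equalityI) (auto simp: shift_def)
    define p where "p = V ((shift ^^ k) (shift x)) (n - k)"
    define r where "r = V ((shift ^^ k) (shift y)) (m - k)"
    have pr: "p \<in> C" "r \<in> C" unfolding p_def r_def using shift_Sig sh x y by (auto intro!: VC)
    have Vx: "V (shift x) n = M h *v p" using V_add[of "shift x" k "n - k"] nm by (simp add: h_def p_def)
    have Vy: "V (shift y) m = M h *v r" using V_add[of "shift y" k "m - k"] nm by (simp add: h' r_def)
    define u where "u = (1 / norm (M h *v p)) *\<^sub>R (M h *v p)"
    define v where "v = (1 / norm (M h *v r)) *\<^sub>R (M h *v r)"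
    have pos: "norm (M h *v p) > 0" "norm (M h *v r) > 0" "norm p > 0" "norm r > 0"
      using C_word[OF h(1)] pr zero_notin by (auto simp: ) metis+
    have uv: "norm u = 1" "norm v = 1" using pos by (auto simp: u_def v_def)
    have oph: "opnorm (M h) > 0" by (rule opnorm_M_pos[OF h(1)])
    have "\<bar>cross2 u v\<bar> = \<bar>det (M h)\<bar> * \<bar>cross2 p r\<bar> / (norm (M h *v p) * norm (M h *v r))"
      by (simp add: u_def v_def cross2_mv abs_mult)
    also have "\<dots> \<le> \<bar>det (M h)\<bar> * (norm p * norm r) / ((c * opnorm (M h) * norm p) * (c * opnorm (M h) * norm r))"
      using c(2)[OF pr(1) h(1)] c(2)[OF pr(2) h(1)] pos oph c(1)
      by (intro frac_le mult_left_mono abs_cross2_le mult_mono) auto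
    also have "\<dots> = gap h / c\<^sup>2"
      using pos oph c by (simp add: gap_def power2_eq_square field_simps)
    also have "\<dots> \<le> G * \<tau> ^ k / c\<^sup>2" using G(4)[OF h(1)] h(2) by (intro divide_right_mono) auto
    finally have cr: "\<bar>cross2 u v\<bar> \<le> G * \<tau> ^ k / c\<^sup>2" .
    have "\<bar>norm (A a *v u) - norm (A a *v v)\<bar> \<le> 2 * opnorm (A a) * \<bar>cross2 u v\<bar>"
      by (rule norm_mv_diff_le[OF uv])
    also have "\<dots> \<le> 2 * opnorm (A a) * (G * \<tau> ^ k / c\<^sup>2)" using cr by (intro mult_left_mono) auto
    finally have d: "\<bar>norm (A a *v u) - norm (A a *v v)\<bar> \<le> 2 * opnorm (A a) * (G * \<tau> ^ k / c\<^sup>2)" .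
    have gl: "g * opnorm (A a) \<le> gap [a] * opnorm (A a)" using g(2)[OF a(1)] by (intro mult_right_mono) auto
    have low: "g * opnorm (A a) \<le> norm (A a *v u)" "g * opnorm (A a) \<le> norm (A a *v v)"
      using A_low[OF a(1), of u] A_low[OF a(1), of v] uv gl by auto
    have "\<bar>ln (norm (A a *v u)) - ln (norm (A a *v v))\<bar> \<le> 2 * opnorm (A a) * (G * \<tau> ^ k / c\<^sup>2) / (g * opnorm (A a))"
      using low d g(1) opA[OF a(1)] by (intro abs_ln_diff_le) auto
    also have "\<dots> = E * \<tau> ^ k" using opA[OF a(1)] by (simp add: E_def field_simps)
    finally show ?thesis
      using f_eq[OF x, of n] f_eq[OF y, of m] by (simp add: Vx Vy u_def v_def a(2) flip: a_def)
  qed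
  define F where "F x = lim (\<lambda>n. f n x)" for x
  have lim: "(\<lambda>n. f n x) \<longlonglongrightarrow> F x" if x: "x \<in> Sig N" for x
  proof -
    have "Cauchy (\<lambda>n. f n x)"
    proof (rule CauchyI)
      fix \<epsilon> :: real assume \<epsilon>: "\<epsilon> > 0"
      obtain k where k: "\<tau> ^ k < \<epsilon> / E" using real_arch_pow_inv[of "\<epsilon> / E" \<tau>] \<epsilon> E G by auto
      have "norm (f m x - f n x) < \<epsilon>" if "m \<ge> k" "n \<ge> k" for m n
      proof -
        have "\<bar>f m x - f n x\<bar> \<le> E * \<tau> ^ k" by (rule close[OF x x _ that]) simp
        also have "\<dots> < \<epsilon>" using k E by (simp add: field_simps)
        finally show ?thesis by simp
      qed
      then show "\<exists>k. \<forall>m\<ge>k. \<forall>n\<ge>k. norm (f m x - f n x) < \<epsilon>" by blast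
    qed
    then show ?thesis unfolding F_def by (simp add: Cauchy_convergent_iff convergent_LIMSEQ_iff)
  qed
  define Q where "Q = (\<Sum>a\<in>{1..N}. \<bar>ln (gap [a] * opnorm (A a))\<bar> + \<bar>ln (opnorm (A a))\<bar>)"
  have f_bound: "\<bar>f n x\<bar> \<le> Q" if x: "x \<in> Sig N" for n x
  proof -
    define a where "a = x 0"
    have a: "a \<in> {1..N}" using letter[OF x] by (simp add: a_def)
    define u where "u = (1 / norm (V (shift x) n)) *\<^sub>R V (shift x) n"
    have u: "norm u = 1" using Vn[OF sh[OF x], of n] by (simp add: u_def)
    have lo: "gap [a] * opnorm (A a) \<le> norm (A a *v u)" using A_low[OF a, of u] u by simp
    have up: "norm (A a *v u) \<le> opnorm (A a)" using norm_mv_le[of "A a" u] u by simp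
    have p: "0 < gap [a] * opnorm (A a)" using gap_pos[of "[a]"] a opA[OF a] by simp
    have "ln (gap [a] * opnorm (A a)) \<le> ln (norm (A a *v u))" "ln (norm (A a *v u)) \<le> ln (opnorm (A a))"
      using lo up p opA[OF a] by (auto intro!: ln_mono)
    then have "\<bar>ln (norm (A a *v u))\<bar> \<le> \<bar>ln (gap [a] * opnorm (A a))\<bar> + \<bar>ln (opnorm (A a))\<bar>" by linarith
    also have "\<dots> \<le> Q" unfolding Q_def using a by (intro member_le_sum) auto
    finally show ?thesis using f_eq[OF x, of n] by (simp add: a_def u_def)
  qed
  have F_bound: "\<bar>F x\<bar> \<le> Q" if x: "x \<in> Sig N" for x
    by (rule LIMSEQ_le_const2[OF tendsto_rabs[OF lim[OF x]]]) (use f_bound[OF x] in auto)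
  have Q0: "Q \<ge> 0" unfolding Q_def by (intro sum_nonneg) auto
  have "holder N F"
    unfolding holder_def
  proof (intro exI conjI ballI impI)
    \<comment> \<open>A common length \<open>Suc k\<close> yields only \<open>\<tau> ^ k\<close>,
      hence the division by \<open>\<tau>\<close>; the summand \<open>2 * Q\<close> handles
      sequences that differ in the first letter.\<close>
    show "0 < E / \<tau> + 2 * Q" using E G Q0 by (simp add: add_pos_nonneg)
    show "0 < \<tau>" "\<tau> < 1" by (rule G)+
    fix x y assume x: "x \<in> Sig N" and y: "y \<in> Sig N" and ne: "x \<noteq> y"
    show "\<bar>F x - F y\<bar> \<le> (E / \<tau> + 2 * Q) * \<tau> ^ common_len x y"
    proof (cases "common_len x y")
      case 0
      have "\<bar>F x - F y\<bar> \<le> 2 * Q" using F_bound[OF x] F_bound[OF y] by linarith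
      also have "\<dots> \<le> E / \<tau> + 2 * Q" using E G by simp
      finally show ?thesis using 0 by simp
    next
      case (Suc k)
      have ag: "x j = y j" if "j \<le> k" for j using common_len_agree[OF ne, of j] that Suc by simp
      have "\<bar>F x - F y\<bar> \<le> E * \<tau> ^ k"
      proof (rule LIMSEQ_le_const2[OF tendsto_rabs[OF tendsto_diff[OF lim[OF x] lim[OF y]]]])
        show "\<exists>N. \<forall>n\<ge>N. \<bar>f n x - f n y\<bar> \<le> E * \<tau> ^ k" using close[OF x y ag] by blast
      qed
      also have "\<dots> = E / \<tau> * \<tau> ^ common_len x y" using G by (simp add: Suc)
      also have "\<dots> \<le> (E / \<tau> + 2 * Q) * \<tau> ^ common_len x y" using Q0 G by (intro mult_right_mono) auto
      finally show ?thesis .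
    qed
  qed
  moreover have "\<bar>birkhoff F n x - ln (opnorm (M (prefix x n)))\<bar> \<le> \<bar>ln c\<bar> + 1" if x: "x \<in> Sig N" for x n
  proof -
    \<comment> \<open>The level \<open>m + n - Suc k\<close> drops by one with each shift, which
      makes the sum telescope exactly.\<close>
    have tele: "(\<Sum>k<n. f (m + n - Suc k) ((shift ^^ k) x)) = ln (norm (V x (n + m))) - ln (norm (V ((shift ^^ n) x) m))" for m
    proof -
      define T where "T k = ln (norm (V ((shift ^^ k) x) (m + n - k)))" for k
      have "(\<Sum>k<n. f (m + n - Suc k) ((shift ^^ k) x)) = (\<Sum>k<n. T k - T (Suc k))"
      proof (rule sum.cong[OF refl])
        fix k assume "k \<in> {..<n}"
        then have "Suc (m + n - Suc k) = m + n - k" by simp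
        then show "f (m + n - Suc k) ((shift ^^ k) x) = T k - T (Suc k)" by (simp add: f_def T_def)
      qed
      also have "\<dots> = T 0 - T n" by (rule sum_lessThan_telescope')
      finally show ?thesis by (simp add: T_def add.commute)
    qed
    have bd: "\<bar>(\<Sum>k<n. f (m + n - Suc k) ((shift ^^ k) x)) - ln (opnorm (M (prefix x n)))\<bar> \<le> \<bar>ln c\<bar> + 1" for m
    proof -
      define y where "y = V ((shift ^^ n) x) m"
      have y: "y \<in> C" "norm y > 0" using VC Vn shift_Sig[OF x] by (auto simp: y_def)
      have w: "prefix x n \<in> lists {1..N}" by (rule prefix_lists[OF x])
      let ?o = "opnorm (M (prefix x n))"
      have o: "?o > 0" by (rule opnorm_M_pos[OF w])
      have lo: "c * ?o * norm y \<le> norm (V x (n + m))" unfolding V_add y_def[symmetric] by (rule c(2)[OF y(1) w])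
      have up: "norm (V x (n + m)) \<le> ?o * norm y" unfolding V_add y_def[symmetric] by (rule norm_mv_le)
      have "ln (c * ?o * norm y) \<le> ln (norm (V x (n + m)))" using lo c o y by (intro ln_mono) auto
      then have 1: "ln c + ln ?o + ln (norm y) \<le> ln (norm (V x (n + m)))" using c o y by (simp add: ln_mult_pos)
      have "ln (norm (V x (n + m))) \<le> ln (?o * norm y)" using up Vn[OF x] by (intro ln_mono)
      then have 2: "ln (norm (V x (n + m))) \<le> ln ?o + ln (norm y)" using o y by (simp add: ln_mult_pos)
      show ?thesis unfolding tele y_def[symmetric] using 1 2 by linarith
    qed
    have "(\<lambda>m. \<Sum>k<n. f (m + n - Suc k) ((shift ^^ k) x)) \<longlonglongrightarrow> (\<Sum>k<n. F ((shift ^^ k) x))"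
    proof (rule tendsto_sum)
      fix k assume "k \<in> {..<n}"
      then have "m + n - Suc k = m + (n - Suc k)" for m by auto
      then show "(\<lambda>m. f (m + n - Suc k) ((shift ^^ k) x)) \<longlonglongrightarrow> F ((shift ^^ k) x)"
        using LIMSEQ_ignore_initial_segment[OF lim[OF shift_Sig[OF x, of k]], of "n - Suc k"] by simp
    qed
    from LIMSEQ_le_const2[OF tendsto_rabs[OF tendsto_diff[OF this tendsto_const[of "ln (opnorm (M (prefix x n)))"]]]]
    show ?thesis unfolding birkhoff_def using bd by blast
  qed
  moreover have "\<bar>ln c\<bar> + 1 > 0" by linarith
  ultimately show ?thesis by blast
qed

end

section \<open>Multicones and cones\<close>

definition dir :: "real \<Rightarrow> real^2" where
  "dir t = vector [cos t, sin t]"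

lemma dir_nth [simp]: "dir t $ 1 = cos t" "dir t $ 2 = sin t"
  by (simp_all add: dir_def)

lemma norm_dir [simp]: "norm (dir t) = 1"
proof -
  have "(norm (dir t))\<^sup>2 = 1\<^sup>2" by (simp add: norm2_sq)
  then show ?thesis by (metis norm_ge_zero power2_eq_iff_nonneg zero_le_one)
qed

lemma dir_nonzero [simp]: "dir t \<noteq> 0"
  using norm_dir[of t] by (metis norm_zero zero_neq_one)

lemma pline_eq: "pline t = span {dir t}"
  by (simp add: pline_def dir_def)

lemma polar2: "norm x = 1 \<Longrightarrow> \<exists>t. x = dir t"
proof -
  assume "norm x = 1"
  then have "(x $ 1)\<^sup>2 + (x $ 2)\<^sup>2 = 1" using norm2_sq[of x] by simp
  then obtain t where "x $ 1 = cos t" "x $ 2 = sin t" using sincos_total_2pi by metis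
  then show ?thesis by (auto simp: vec2_eq_iff intro!: exI[of _ t])
qed

lemma continuous_on_dir: "continuous_on S dir"
proof -
  have e: "dir = (\<lambda>t. cos t *\<^sub>R axis 1 1 + sin t *\<^sub>R axis 2 1)"
    by (auto simp: vec2_eq_iff axis_def)
  show ?thesis unfolding e by (intro continuous_intros)
qed

lemma span_scale: "c \<noteq> 0 \<Longrightarrow> span {c *\<^sub>R x} = span {x :: real^2}"
proof -
  assume c: "c \<noteq> 0"
  have "span ((*\<^sub>R) c ` {x}) = span {x}" using c by (intro span_image_scale) auto
  then show ?thesis by simp
qed

lemma span_eq_singleD:
  assumes "span {x} = span {y :: real^2}" "x \<noteq> 0"
  obtains c where "c \<noteq> 0" "x = c *\<^sub>R y"
proof -
  have "x \<in> span {y}" using assms(1) span_base[of x "{x}"] by simp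
  then obtain c where "x = c *\<^sub>R y" by (auto simp: span_singleton)
  moreover have "c \<noteq> 0" using calculation assms(2) by auto
  ultimately show ?thesis using that by blast
qed

lemma image_span_single: "(\<lambda>x. A *v x) ` span {x} = span {A *v (x :: real^2)}"
  by (auto simp: span_singleton matrix_vector_mult_scaleR image_iff)

text \<open>A neighbourhood of a line cut out by angles. Writing the angle through
  \<open>arctan\<close> makes openness a matter of continuity; for large \<open>e\<close> it is the
  set of all vectors not orthogonal to \<open>dir t\<close>.\<close>

definition sector :: "real \<Rightarrow> real \<Rightarrow> (real^2) set" where
  "sector t e = {y. y \<bullet> dir t \<noteq> 0 \<and> \<bar>arctan ((y \<bullet> perp (dir t)) / (y \<bullet> dir t))\<bar> < e}"

lemma open_sector: "open (sector t e)"
proof -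
  have 1: "open {y :: real^2. y \<bullet> dir t \<noteq> 0}"
    by (intro open_Collect_neq continuous_intros)
  have "continuous_on {y. y \<bullet> dir t \<noteq> 0} (\<lambda>y. \<bar>arctan ((y \<bullet> perp (dir t)) / (y \<bullet> dir t))\<bar>)"
    by (intro continuous_intros) auto
  then have "open ({y. y \<bullet> dir t \<noteq> 0} \<inter> (\<lambda>y. \<bar>arctan ((y \<bullet> perp (dir t)) / (y \<bullet> dir t))\<bar>) -` {..<e})"
    using 1 by (intro continuous_open_preimage) auto
  moreover have "\<dots> = sector t e" by (auto simp: sector_def)
  ultimately show ?thesis by metis
qed

lemma dir_in_sector: "e > 0 \<Longrightarrow> c \<noteq> 0 \<Longrightarrow> c *\<^sub>R dir t \<in> sector t e"
proof -
  assume "e > 0" "c \<noteq> 0"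
  have "dir t \<bullet> dir t = 1" by (simp add: dot_square_norm)
  moreover have "dir t \<bullet> perp (dir t) = 0" by (simp add: inner_vec_def sum_2)
  ultimately show ?thesis using \<open>e > 0\<close> \<open>c \<noteq> 0\<close> by (simp add: sector_def)
qed

lemma sectorE:
  assumes "y \<in> sector t e"
  obtains s c where "\<bar>s - t\<bar> < e" "c \<noteq> 0" "y = c *\<^sub>R dir s"
proof -
  define \<alpha> \<beta> where "\<alpha> = y \<bullet> dir t" and "\<beta> = y \<bullet> perp (dir t)"
  define h where "h = arctan (\<beta> / \<alpha>)"
  have \<alpha>: "\<alpha> \<noteq> 0" and h: "\<bar>h\<bar> < e" using assms by (auto simp: sector_def \<alpha>_def \<beta>_def h_def)
  have ch: "cos h > 0" unfolding h_def by (rule cos_arctan_not_zero[THEN not_sym, THEN le_neq_trans[rotated]]) (simp add: cos_arctan)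
  have "tan h = \<beta> / \<alpha>" by (simp add: h_def tan_arctan)
  then have sh: "sin h = \<beta> / \<alpha> * cos h" using ch by (simp add: tan_def field_simps)
  have "(\<alpha> / cos h) *\<^sub>R dir (t + h) = \<alpha> *\<^sub>R dir t + \<beta> *\<^sub>R perp (dir t)"
    using ch \<alpha> unfolding vec2_eq_iff by (simp add: cos_add sin_add sh field_simps)
  also have "\<dots> = y"
  proof -
    have *: "cos t * (cos t * r) + sin t * (sin t * r) = r" for r
    proof -
      have "cos t * (cos t * r) + sin t * (sin t * r) = ((cos t)\<^sup>2 + (sin t)\<^sup>2) * r"
        by (simp only: power2_eq_square algebra_simps)
      then show ?thesis by simp
    qed
    show ?thesis
      unfolding vec2_eq_iff \<alpha>_def \<beta>_def inner_vec_def sum_2 by (simp add: algebra_simps *)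
  qed
  finally have "y = (\<alpha> / cos h) *\<^sub>R dir (t + h)" by simp
  moreover have "\<alpha> / cos h \<noteq> 0" using \<alpha> ch by simp
  moreover have "\<bar>t + h - t\<bar> < e" using h by simp
  ultimately show ?thesis using that by blast
qed

text \<open>The cone consists of the nonzero vectors on lines of the multicone; sectors turn an
  interval of angles into an open set of vectors.\<close>

lemma invariant_cone_of_multicone:
  assumes "\<forall>i\<in>{1..N}. invertible (A i)" and "has_strongly_invariant_multicone N A"
  shows "\<exists>C. invariant_cone N A C"
proof -
  obtain C where mc: "multicone C"
    and step: "\<forall>i\<in>{1..N}. (\<lambda>l. (\<lambda>x. A i *v x) ` l) ` C \<subseteq> proj_interior C"
    using assms(2) unfolding has_strongly_invariant_multicone_def by (elim exE conjE)
  have proper: "C \<subset> range pline" using mc unfolding multicone_def by (rule conjunct1)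
  obtain I :: "(real \<times> real) set" where I: "finite I" "I \<noteq> {}" "\<forall>(a,b)\<in>I. a < b"
    and C_eq: "C = (\<Union>(a,b)\<in>I. pline ` {a..b})"
    using mc unfolding multicone_def by (elim exE conjE)
  have C_I: "pline t \<in> C" if "(a, b) \<in> I" "t \<in> {a..b}" for a b t
    unfolding C_eq using that by (intro UN_I[of "(a, b)"]) auto
  define D where "D = {x. x \<noteq> 0 \<and> span {x} \<in> C}"
  have "invariant_cone N A D"
    unfolding invariant_cone_def
  proof (intro conjI ballI allI impI)
    show "0 \<notin> D" by (simp add: D_def)
    show "c *\<^sub>R x \<in> D" if "x \<in> D" "c \<noteq> 0" for x c using that by (simp add: D_def span_scale)
    show "compact (D \<inter> sphere 0 1)"
    proof -
      define K where "K = (\<Union>(a,b)\<in>I. dir ` {a..b} \<union> uminus ` dir ` {a..b})"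
      have "compact K"
        unfolding K_def case_prod_beta using I(1)
        by (intro compact_UN compact_Un compact_negations compact_continuous_image continuous_on_dir) auto
      moreover have "D \<inter> sphere 0 1 = K"
      proof (intro equalityI subsetI)
        fix x assume x: "x \<in> D \<inter> sphere 0 1"
        then obtain a b t where t: "(a, b) \<in> I" "t \<in> {a..b}" "span {x} = span {dir t}"
          unfolding D_def C_eq by (auto simp: pline_eq)
        obtain c where c: "c \<noteq> 0" "x = c *\<^sub>R dir t" using span_eq_singleD[OF t(3)] x by (auto simp: D_def)
        then have "\<bar>c\<bar> = 1" using x by simp
        then have "x = dir t \<or> x = - dir t" using c by (auto simp: abs_if split: if_splits)
        then show "x \<in> K" using t unfolding K_def by blast
      next
        fix x assume "x \<in> K"
        then obtain a b t where t: "(a, b) \<in> I" "t \<in> {a..b}" "x = dir t \<or> x = - dir t"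
          unfolding K_def by blast
        have "span {x} = span {dir t}" using t(3) span_scale[of "-1" "dir t"] by auto
        moreover have "span {dir t} \<in> C" using C_I[OF t(1,2)] by (simp add: pline_eq)
        moreover have "x \<noteq> 0" "norm x = 1" using t(3) by auto
        ultimately show "x \<in> D \<inter> sphere 0 1" by (simp add: D_def)
      qed
      ultimately show ?thesis by simp
    qed
    show "A a *v x \<in> interior D" if a: "a \<in> {1..N}" and x: "x \<in> D" for a x
    proof -
      have "span {A a *v x} \<in> proj_interior C"
        using step a x image_span_single[of "A a" x] unfolding D_def by blast
      then obtain t e where te: "e > 0" "span {A a *v x} = span {dir t}" "pline ` ball t e \<subseteq> C"
        unfolding proj_interior_def by (auto simp: pline_eq)
      have "A a *v x \<noteq> 0" using invertible_mv_eq_0[of "A a" x] assms(1) a x by (auto simp: D_def)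
      then obtain c where c: "c \<noteq> 0" "A a *v x = c *\<^sub>R dir t" using span_eq_singleD[OF te(2)] by auto
      have "sector t e \<subseteq> D"
      proof
        fix y assume "y \<in> sector t e"
        then obtain s c where s: "\<bar>s - t\<bar> < e" "c \<noteq> 0" "y = c *\<^sub>R dir s" by (rule sectorE)
        have "pline s \<in> C" using te(3) s(1) by (auto simp: dist_real_def abs_minus_commute)
        then show "y \<in> D" using s by (simp add: D_def span_scale pline_eq)
      qed
      then show ?thesis using dir_in_sector[OF te(1) c(1), of t] open_sector c(2) by (metis interiorI)
    qed
    show "D \<noteq> {}"
    proof -
      obtain a b where ab: "(a, b) \<in> I" using I(2) by auto
      then have "a < b" using I(3) by auto
      then have "pline a \<in> C" using C_I[OF ab, of a] by simp
      then have "dir a \<in> D" by (simp add: D_def pline_eq)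
      then show ?thesis by blast
    qed
    show "\<exists>z. z \<noteq> 0 \<and> z \<notin> D"
    proof -
      obtain t where "pline t \<notin> C" using proper by blast
      then have "dir t \<notin> D" by (simp add: D_def pline_eq)
      then show ?thesis using dir_nonzero by blast
    qed
  qed
  then show ?thesis by blast
qed

text \<open>The compact first image is covered by finitely many open sectors whose closed angle
  intervals stay in \<open>C\<close>. The lines over these intervals form the multicone: they lie in
  \<open>C\<close>, so the letters send them into the first image and thus into the open
  sectors.\<close>

lemma (in cocycle_cone) multicone_of_cone: "has_strongly_invariant_multicone N A"
proof -
  have "\<exists>t e. e > 0 \<and> p = dir t \<and> dir ` {t - e..t + e} \<subseteq> C" if p: "p \<in> image1" for p
  proof -
    obtain t where t: "p = dir t" using polar2 image1_unit[OF p] by blast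
    have "isCont dir t" using continuous_on_dir[of UNIV] by (simp add: continuous_on_eq_continuous_at)
    moreover have "dir t \<in> interior C" using image1_interior p t by blast
    ultimately have "\<forall>\<^sub>F s in nhds t. dir s \<in> interior C"
      by (metis continuous_at open_interior tendsto_def isCont_def at_within_def tendsto_at_iff_tendsto_nhds topological_tendstoD)
    then obtain e where e: "e > 0" "\<And>s. dist s t < e \<Longrightarrow> dir s \<in> interior C"
      unfolding eventually_nhds_metric by blast
    have "dir ` {t - e / 2..t + e / 2} \<subseteq> C"
      using e interior_subset by (fastforce simp: dist_real_def abs_if)
    then show ?thesis using e(1) t by (intro exI[of _ t] exI[of _ "e / 2"]) auto
  qed
  then obtain T E where TE: "\<And>p. p \<in> image1 \<Longrightarrow> E p > 0 \<and> p = dir (T p) \<and> dir ` {T p - E p..T p + E p} \<subseteq> C"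
    by metis
  have "image1 \<subseteq> (\<Union>p\<in>image1. sector (T p) (E p))"
  proof
    fix p assume p: "p \<in> image1"
    have "1 *\<^sub>R dir (T p) \<in> sector (T p) (E p)" using TE[OF p] by (intro dir_in_sector) auto
    then show "p \<in> (\<Union>p\<in>image1. sector (T p) (E p))" using TE[OF p] p by auto
  qed
  then obtain P where P: "P \<subseteq> image1" "finite P" "image1 \<subseteq> (\<Union>p\<in>P. sector (T p) (E p))"
    using compactE_image[OF image1_compact, of image1 "\<lambda>p. sector (T p) (E p)"] open_sector by metis
  obtain x0 where x0: "x0 \<in> C" using cone by (auto simp: invariant_cone_def)
  have "image1 \<noteq> {}" using image1I[OF _ x0] N1 by fastforce
  then have Pne: "P \<noteq> {}" using P(3) by auto
  define I where "I = (\<lambda>p. (T p - E p, T p + E p)) ` P"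
  define D where "D = (\<Union>(a,b)\<in>I. pline ` {a..b})"
  have D_C: "x \<in> C" if x: "x \<noteq> 0" "span {x} \<in> D" for x
  proof -
    obtain p s where p: "p \<in> P" "s \<in> {T p - E p..T p + E p}" "span {x} = span {dir s}"
      using x(2) unfolding D_def I_def by (auto simp: pline_eq)
    have "dir s \<in> C" using TE[of p] p P(1) by blast
    moreover obtain c where "c \<noteq> 0" "x = c *\<^sub>R dir s" using span_eq_singleD[OF p(3) x(1)] by blast
    ultimately show ?thesis using C_scale by blast
  qed
  have D_line: "\<exists>t. l = pline t" if "l \<in> D" for l using that unfolding D_def by auto
  have "multicone D"
    unfolding multicone_def
  proof (intro conjI exI[of _ I])
    obtain z where z: "z \<noteq> 0" "z \<notin> C" using cone by (auto simp: invariant_cone_def)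
    have "norm ((1 / norm z) *\<^sub>R z) = 1" using z by simp
    then obtain t where t: "(1 / norm z) *\<^sub>R z = dir t" using polar2 by blast
    have "span {z} = pline t" using span_scale[of "1 / norm z" z] z t by (simp add: pline_eq)
    then have "pline t \<notin> D" using D_C[of z] z by auto
    then show "D \<subset> range pline" using D_line by blast
    show "finite I" using P(2) by (simp add: I_def)
    show "I \<noteq> {}" using Pne by (simp add: I_def)
    show "\<forall>(a, b)\<in>I. a < b" unfolding I_def using TE P(1) by fastforce
    show "D = (\<Union>(a,b)\<in>I. pline ` {a..b})" by (rule D_def)
  qed
  moreover have "(\<lambda>l. (\<lambda>x. A i *v x) ` l) ` D \<subseteq> proj_interior D" if i: "i \<in> {1..N}" for i
  proof
    fix l assume "l \<in> (\<lambda>l. (\<lambda>x. A i *v x) ` l) ` D"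
    then obtain t where t: "pline t \<in> D" "l = (\<lambda>x. A i *v x) ` pline t" using D_line by blast
    define x where "x = dir t"
    have x: "x \<in> C" using D_C[of x] t(1) by (simp add: x_def pline_eq)
    have l: "l = span {A i *v x}" using t(2) by (simp add: pline_eq x_def image_span_single)
    have nz: "A i *v x \<noteq> 0" by (rule A_nz[OF i x])
    obtain p where p: "p \<in> P" "(1 / norm (A i *v x)) *\<^sub>R (A i *v x) \<in> sector (T p) (E p)"
      using image1I[OF i x] P(3) by blast
    obtain s c where s: "\<bar>s - T p\<bar> < E p" "c \<noteq> 0" "(1 / norm (A i *v x)) *\<^sub>R (A i *v x) = c *\<^sub>R dir s"
      using p(2) by (rule sectorE)
    have "l = pline s"
      using span_scale[of "1 / norm (A i *v x)" "A i *v x"] nz span_scale[OF s(2), of "dir s"] s(3) l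
      by (simp add: pline_eq)
    \<comment> \<open>The radius is the distance of \<open>s\<close> to the nearer end of the
      interval around \<open>T p\<close>.\<close>
    moreover have "pline ` ball s (E p - \<bar>s - T p\<bar>) \<subseteq> D"
    proof
      fix l' assume "l' \<in> pline ` ball s (E p - \<bar>s - T p\<bar>)"
      then obtain r where r: "\<bar>s - r\<bar> < E p - \<bar>s - T p\<bar>" "l' = pline r" by (auto simp: dist_real_def)
      have "r \<in> {T p - E p..T p + E p}" using r(1) by (auto simp: abs_if split: if_splits)
      then show "l' \<in> D" unfolding D_def I_def using p(1) r(2) by (auto intro!: bexI[of _ p])
    qed
    ultimately show "l \<in> proj_interior D"
      unfolding proj_interior_def using s(1) by (intro CollectI exI[of _ s] exI[of _ "E p - \<bar>s - T p\<bar>"]) auto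
  qed
  ultimately show ?thesis unfolding has_strongly_invariant_multicone_def by blast
qed

section \<open>Conformal cocycles\<close>

lemma orthogonal_matrix_iff_norm:
  "orthogonal_matrix (Q :: real^2^2) \<longleftrightarrow> (\<forall>x. norm (Q *v x) = norm x)"
proof -
  have "orthogonal_transformation ((*v) Q) \<longleftrightarrow> orthogonal_matrix Q"
    using orthogonal_transformation_matrix[of "(*v) Q"] by simp
  then show ?thesis unfolding orthogonal_transformation by simp
qed

text \<open>Conformality after conjugation by \<open>S\<close> means that the norm of
  \<open>S *v x\<close> is preserved up to the scalar \<open>\<bar>det A\<bar> powr (1/2)\<close>.
  In this form the condition composes along words.\<close>

lemma conformal_matrix_iff:
  fixes S A :: "real^2^2"
  assumes S: "invertible S" and A: "invertible A"
  shows "orthogonal_matrix (\<bar>det A\<bar> powr (-1/2) *\<^sub>R (S ** A ** matrix_inv S)) \<longleftrightarrow>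
    (\<forall>x. norm (S *v (A *v x)) = \<bar>det A\<bar> powr (1/2) * norm (S *v x))" (is "?L \<longleftrightarrow> ?R")
proof -
  define d where "d = \<bar>det A\<bar> powr (1/2)"
  have d: "d > 0" using A by (simp add: d_def invertible_det_nz)
  have d': "\<bar>det A\<bar> powr (-1/2) = 1 / d" by (simp add: d_def powr_minus_divide[symmetric])
  have "?L \<longleftrightarrow> (\<forall>y. norm ((S ** A ** matrix_inv S) *v y) = d * norm y)"
    unfolding orthogonal_matrix_iff_norm d' scaleR_mv using d by (simp add: field_simps)
  also have "\<dots> \<longleftrightarrow> (\<forall>x. norm (S *v (A *v x)) = d * norm (S *v x))"
  proof
    assume L: "\<forall>y. norm ((S ** A ** matrix_inv S) *v y) = d * norm y"
    show "\<forall>x. norm (S *v (A *v x)) = d * norm (S *v x)"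
    proof
      fix x
      have "(S ** A ** matrix_inv S) *v (S *v x) = S *v (A *v ((matrix_inv S ** S) *v x))"
        by (simp add: matrix_vector_mul_assoc matrix_mul_assoc)
      then show "norm (S *v (A *v x)) = d * norm (S *v x)"
        using L[rule_format, of "S *v x"] by (simp add: matrix_inv_left[OF S])
    qed
  next
    assume R: "\<forall>x. norm (S *v (A *v x)) = d * norm (S *v x)"
    show "\<forall>y. norm ((S ** A ** matrix_inv S) *v y) = d * norm y"
    proof
      fix y
      have "(S ** A ** matrix_inv S) *v y = S *v (A *v (matrix_inv S *v y))"
        by (simp add: matrix_vector_mul_assoc matrix_mul_assoc)
      moreover have "S *v (matrix_inv S *v y) = y"
        by (simp add: matrix_vector_mul_assoc matrix_inv_right[OF S])
      ultimately show "norm ((S ** A ** matrix_inv S) *v y) = d * norm y"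
        using R[rule_format, of "matrix_inv S *v y"] by simp
    qed
  qed
  finally show ?thesis by (simp add: d_def)
qed

context cocycle
begin

lemma strongly_conformal_iff:
  "strongly_conformal N A \<longleftrightarrow> (\<exists>S :: real^2^2. invertible S \<and>
     (\<forall>i\<in>{1..N}. \<forall>x. norm (S *v (A i *v x)) = \<bar>det (A i)\<bar> powr (1/2) * norm (S *v x)))"
  unfolding strongly_conformal_def using conformal_matrix_iff inv_A by blast

text \<open>Half the logarithm of the modulus of the determinant of the first letter serves as the
  potential. It depends on one letter, so any Hoelder rate will do; the distortion by
  \<open>S\<close> is the bounded error.\<close>

theorem conformal_imp_potential:
  assumes "strongly_conformal N A"
  shows "\<exists>K f. K > 0 \<and> holder N f \<and> (\<forall>x\<in>Sig N. \<forall>n. \<bar>birkhoff f n x - ln (opnorm (M (prefix x n)))\<bar> \<le> K)"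
proof -
  obtain S :: "real^2^2" where S: "invertible S"
    "\<And>i x. i \<in> {1..N} \<Longrightarrow> norm (S *v (A i *v x)) = \<bar>det (A i)\<bar> powr (1/2) * norm (S *v x)"
    using assms unfolding strongly_conformal_iff by blast
  have word: "norm (S *v (M w *v x)) = \<bar>det (M w)\<bar> powr (1/2) * norm (S *v x)" if "w \<in> lists {1..N}" for w x
    using that
  proof (induction w arbitrary: x)
    case (Cons a w)
    have "norm (S *v (M (a # w) *v x)) = norm (S *v (A a *v (M w *v x)))"
      by (simp add: matrix_vector_mul_assoc)
    also have "\<dots> = \<bar>det (A a)\<bar> powr (1/2) * (\<bar>det (M w)\<bar> powr (1/2) * norm (S *v x))"
      using Cons by (simp add: S(2))
    finally show ?case by (simp add: det_mul abs_mult powr_mult)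
  qed simp
  define k1 k2 where "k1 = opnorm S" and "k2 = opnorm (matrix_inv S)"
  have up: "norm (S *v x) \<le> k1 * norm x" for x unfolding k1_def by (rule norm_mv_le)
  have lo: "norm x \<le> k2 * norm (S *v x)" for x
    using norm_mv_le[of "matrix_inv S" "S *v x"]
    by (simp add: k2_def matrix_vector_mul_assoc matrix_inv_left[OF S(1)])
  have k1: "k1 > 0" using S(1) invertible_opnorm_pos by (simp add: k1_def)
  have k12: "k1 * k2 \<ge> 1"
    using opnorm_mult[of S "matrix_inv S"] by (simp add: k1_def k2_def matrix_inv_right[OF S(1)])
  then have k2: "k2 > 0" using k1 by (smt (verit) mult_nonneg_nonpos)
  define K where "K = ln (k1 * k2)"
  have K: "K \<ge> 0" using k12 by (simp add: K_def)
  have bound: "\<bar>ln (\<bar>det (M w)\<bar> powr (1/2)) - ln (opnorm (M w))\<bar> \<le> K" if w: "w \<in> lists {1..N}" for w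
  proof -
    define d where "d = \<bar>det (M w)\<bar> powr (1/2)"
    have d: "d > 0" using invertible_M[OF w] by (simp add: d_def invertible_det_nz)
    have o: "opnorm (M w) > 0" by (rule opnorm_M_pos[OF w])
    have "opnorm (M w) \<le> k1 * k2 * d"
    proof (rule opnorm_leI)
      fix x
      have "norm (M w *v x) \<le> k2 * norm (S *v (M w *v x))" by (rule lo)
      also have "\<dots> = k2 * (d * norm (S *v x))" by (simp add: word[OF w] d_def)
      also have "\<dots> \<le> k2 * (d * (k1 * norm x))" using k2 d up by (intro mult_left_mono) auto
      finally show "norm (M w *v x) \<le> k1 * k2 * d * norm x" by (simp add: mult_ac)
    qed (use k1 k2 d in simp)
    then have "ln (opnorm (M w)) \<le> ln (k1 * k2 * d)" using o by (intro ln_mono)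
    then have 1: "ln (opnorm (M w)) \<le> K + ln d" using k1 k2 d by (simp add: K_def ln_mult_pos)
    obtain x :: "real^2" where x: "norm x = 1" using opnorm_attained by blast
    have Sx: "norm (S *v x) > 0" using lo[of x] x k2 by (auto simp: zero_less_mult_iff)
    have "d * norm (S *v x) = norm (S *v (M w *v x))" by (simp add: word[OF w] d_def)
    also have "\<dots> \<le> k1 * norm (M w *v x)" by (rule up)
    also have "\<dots> \<le> k1 * (opnorm (M w) * norm x)" using k1 norm_mv_le by (intro mult_left_mono) auto
    also have "\<dots> \<le> k1 * (opnorm (M w) * (k2 * norm (S *v x)))" using k1 lo[of x] by (intro mult_left_mono) auto
    finally have "d * norm (S *v x) \<le> (k1 * k2 * opnorm (M w)) * norm (S *v x)" by (simp add: mult_ac)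
    then have "d \<le> k1 * k2 * opnorm (M w)" using Sx by simp
    then have "ln d \<le> ln (k1 * k2 * opnorm (M w))" using d by (intro ln_mono)
    then have 2: "ln d \<le> K + ln (opnorm (M w))" using k1 k2 o by (simp add: K_def ln_mult_pos)
    show ?thesis using 1 2 by (auto simp: d_def[symmetric])
  qed
  define f where "f x = ln (\<bar>det (A (x 0))\<bar> powr (1/2))" for x :: "nat \<Rightarrow> nat"
  have bf: "birkhoff f n x = ln (\<bar>det (M (prefix x n))\<bar> powr (1/2))" if x: "x \<in> Sig N" for n x
  proof (induction n)
    case 0
    show ?case by (simp add: birkhoff_def prefix_def)
  next
    case (Suc n)
    have p: "prefix x (Suc n) = prefix x n @ [x n]" by (simp add: prefix_def)
    have "det (M (prefix x n)) \<noteq> 0"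
      using invertible_M[OF words_in_lists[OF prefix_in_words[OF x]]] by (simp add: invertible_det_nz)
    moreover have "det (A (x n)) \<noteq> 0" using inv_A x by (auto simp: Sig_def invertible_det_nz[symmetric])
    ultimately show ?case using Suc
      by (simp add: birkhoff_def p matword_append det_mul abs_mult powr_mult ln_mult_pos f_def funpow_shift)
  qed
  define Q where "Q = (\<Sum>a\<in>{1..N}. \<bar>ln (\<bar>det (A a)\<bar> powr (1/2))\<bar>)"
  have Q: "\<bar>f x\<bar> \<le> Q" if "x \<in> Sig N" for x
    unfolding Q_def f_def using that by (intro member_le_sum) (auto simp: Sig_def)
  have Q0: "Q \<ge> 0" unfolding Q_def by (intro sum_nonneg) auto
  have "holder N f"
    unfolding holder_def
  proof (intro exI conjI ballI impI)
    show "(0::real) < 2 * Q + 1" using Q0 by simp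
    show "(0::real) < 1/2" "(1/2::real) < 1" by auto
    fix x y assume xy: "x \<in> Sig N" "y \<in> Sig N" "x \<noteq> y"
    show "\<bar>f x - f y\<bar> \<le> (2 * Q + 1) * (1/2) ^ common_len x y"
    proof (cases "common_len x y")
      case 0
      then show ?thesis using Q[OF xy(1)] Q[OF xy(2)] by simp
    next
      case (Suc k)
      then have "x 0 = y 0" using common_len_agree[OF xy(3), of 0] by simp
      then show ?thesis using Q0 by (simp add: f_def)
    qed
  qed
  moreover have "\<bar>birkhoff f n x - ln (opnorm (M (prefix x n)))\<bar> \<le> K + 1" if x: "x \<in> Sig N" for x n
    using bound[OF words_in_lists[OF prefix_in_words[OF x, of n]]] unfolding bf[OF x] by linarith
  moreover have "K + 1 > 0" using K by simp
  ultimately show ?thesis by blast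
qed

end

text \<open>Symmetric matrices are stored as triples of entries, so that sets of forms are subsets
  of a product of reals and compactness is at hand.\<close>

definition qform :: "real \<times> real \<times> real \<Rightarrow> real^2 \<Rightarrow> real" where
  "qform p v = fst p * (v $ 1)\<^sup>2 + 2 * fst (snd p) * (v $ 1) * (v $ 2) + snd (snd p) * (v $ 2)\<^sup>2"

definition qdet :: "real \<times> real \<times> real \<Rightarrow> real" where
  "qdet p = fst p * snd (snd p) - (fst (snd p))\<^sup>2"

text \<open>Eliminating \<open>z\<close> and \<open>z'\<close> turns the hypothesis on the midpoint
  into \<open>D * (x - x')\<^sup>2 + (x * y' - x' * y)\<^sup>2 \<le> 0\<close>.\<close>

lemma qdet_midpoint:
  fixes x y z x' y' z' D :: real
  assumes D: "D > 0" and p: "x * z - y\<^sup>2 = D" "x > 0" and p': "x' * z' - y'\<^sup>2 = D" "x' > 0"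
    and le: "((x + x') / 2) * ((z + z') / 2) - ((y + y') / 2)\<^sup>2 \<le> D"
  shows "x = x' \<and> y = y' \<and> z = z'"
proof -
  have z: "z = (D + y\<^sup>2) / x" "z' = (D + y'\<^sup>2) / x'" using p p' by (auto simp: field_simps)
  have "x * z' + x' * z - 2 * y * y' \<le> 2 * D"
    using le p p' by (simp add: field_simps power2_eq_square)
  then have "(x * z' + x' * z - 2 * y * y') * (x * x') \<le> 2 * D * (x * x')"
    using p p' by (intro mult_right_mono) auto
  moreover have "(x * z' + x' * z - 2 * y * y') * (x * x') = x\<^sup>2 * (x' * z') + x'\<^sup>2 * (x * z) - 2 * y * y' * (x * x')"
    by (simp add: power2_eq_square algebra_simps)
  moreover have "x' * z' = D + y'\<^sup>2" "x * z = D + y\<^sup>2" using p p' by auto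
  ultimately have "x\<^sup>2 * (D + y'\<^sup>2) + x'\<^sup>2 * (D + y\<^sup>2) - 2 * y * y' * (x * x') \<le> 2 * D * (x * x')"
    by simp
  then have le0: "D * (x - x')\<^sup>2 + (x * y' - x' * y)\<^sup>2 \<le> 0"
    by (simp add: power2_eq_square algebra_simps)
  have "D * (x - x')\<^sup>2 \<ge> 0" "(x * y' - x' * y)\<^sup>2 \<ge> 0" using D by auto
  then have "D * (x - x')\<^sup>2 = 0" "(x * y' - x' * y)\<^sup>2 = 0" using le0 by linarith+
  then have "x = x'" "y = y'" using D p by auto
  then show ?thesis using z by simp
qed

text \<open>The quadratic form of maximal determinant below an invariant function is unique by strict
  concavity of the determinant, hence itself invariant (the John ellipse of the invariant norm).\<close>

lemma (in cocycle) conformal_of_gap_bounded: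
  assumes \<delta>: "\<delta> > 0" "\<And>w. w \<in> lists {1..N} \<Longrightarrow> \<delta> \<le> gap w"
  shows "strongly_conformal N A"
proof -
  have det_pos: "\<bar>det (M w)\<bar> > 0" if "w \<in> lists {1..N}" for w
    using invertible_M[OF that] by (simp add: invertible_det_nz)
  \<comment> \<open>Squared norms normalised by the determinant. The lower bound on the gaps keeps
    them bounded, so their supremum \<open>R\<close> over all words is finite; relative to the
    determinant it can only decrease under a letter.\<close>
  define s where "s v w = (norm (M w *v v))\<^sup>2 / \<bar>det (M w)\<bar>" for v w
  have s_le: "s v w \<le> (norm v)\<^sup>2 / \<delta>" if w: "w \<in> lists {1..N}" for v w
  proof -
    have "(norm (M w *v v))\<^sup>2 \<le> (opnorm (M w) * norm v)\<^sup>2" using norm_mv_le by (intro power_mono) auto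
    then have "s v w \<le> (opnorm (M w))\<^sup>2 * (norm v)\<^sup>2 / \<bar>det (M w)\<bar>"
      unfolding s_def by (intro divide_right_mono) (auto simp: power_mult_distrib)
    also have "\<dots> = (norm v)\<^sup>2 / gap w" by (simp add: gap_def)
    also have "\<dots> \<le> (norm v)\<^sup>2 / \<delta>" using \<delta>(2)[OF w] \<delta>(1) by (intro divide_left_mono) auto
    finally show ?thesis .
  qed
  have bdd: "bdd_above (s v ` lists {1..N})" for v
    using s_le by (intro bdd_aboveI[of _ "(norm v)\<^sup>2 / \<delta>"]) auto
  define R where "R v = (SUP w\<in>lists {1..N}. s v w)" for v
  have R_ge: "s v w \<le> R v" if "w \<in> lists {1..N}" for v w
    unfolding R_def using that bdd by (intro cSUP_upper)
  have R_le: "R v \<le> (norm v)\<^sup>2 / \<delta>" for v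
    unfolding R_def using s_le by (intro cSUP_least) auto
  have R_step: "R (A a *v v) \<le> \<bar>det (A a)\<bar> * R v" if a: "a \<in> {1..N}" for a v
    unfolding R_def[of "A a *v v"]
  proof (rule cSUP_least)
    fix w assume w: "w \<in> lists {1..N}"
    have "det (A a) \<noteq> 0" using a inv_A by (auto simp: invertible_det_nz[symmetric])
    then have "s (A a *v v) w = \<bar>det (A a)\<bar> * s v (w @ [a])"
      by (simp add: s_def matword_append det_mul abs_mult matrix_vector_mul_assoc)
    also have "\<dots> \<le> \<bar>det (A a)\<bar> * R v" using w a by (intro mult_left_mono R_ge) auto
    finally show "s (A a *v v) w \<le> \<bar>det (A a)\<bar> * R v" .
  qed auto
  define F where "F = {p. \<forall>v. 0 \<le> qform p v \<and> qform p v \<le> R v}"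
  have cont: "continuous_on UNIV (\<lambda>p. qform p v)" for v
    unfolding qform_def by (intro continuous_intros)
  have "closed F"
  proof -
    have "F = (\<Inter>v. {p. 0 \<le> qform p v} \<inter> {p. qform p v \<le> R v})" by (auto simp: F_def)
    also have "closed \<dots>"
      by (intro closed_INT ballI closed_Int closed_Collect_le continuous_intros cont)
    finally show ?thesis .
  qed
  moreover have "bounded F"
  proof -
    have "F \<subseteq> {0..1/\<delta>} \<times> {-1/\<delta>..1/\<delta>} \<times> {0..1/\<delta>}"
    proof
      fix p assume "p \<in> F"
      then have b: "0 \<le> qform p v" "qform p v \<le> (norm v)\<^sup>2 / \<delta>" for v
        using R_le order_trans by (auto simp: F_def) blast
      obtain x y z where p: "p = (x, y, z)" by (cases p)
      have "0 \<le> x" "x \<le> 1 / \<delta>" using b[of "vector [1, 0]"] by (simp_all add: p qform_def norm2_sq)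
      moreover have "0 \<le> z" "z \<le> 1 / \<delta>" using b[of "vector [0, 1]"] by (simp_all add: p qform_def norm2_sq)
      moreover have "0 \<le> x + 2 * y + z" "x + 2 * y + z \<le> 2 / \<delta>"
        using b[of "vector [1, 1]"] by (simp_all add: p qform_def norm2_sq)
      ultimately have "- 1 / \<delta> \<le> y" "y \<le> 1 / \<delta>" by (auto simp: field_simps)
      then show "p \<in> {0..1/\<delta>} \<times> {-1/\<delta>..1/\<delta>} \<times> {0..1/\<delta>}"
        using \<open>0 \<le> x\<close> \<open>x \<le> 1 / \<delta>\<close> \<open>0 \<le> z\<close> \<open>z \<le> 1 / \<delta>\<close> by (simp add: p)
    qed
    moreover have "bounded ({0..1/\<delta>} \<times> {-1/\<delta>..1/\<delta>} \<times> {0..1/\<delta>})"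
      by (intro bounded_Times bounded_closed_interval)
    ultimately show ?thesis using bounded_subset by blast
  qed
  ultimately have "compact F" by (simp add: compact_eq_bounded_closed)
  moreover have oneF: "(1, 0, 1) \<in> F"
  proof -
    have "qform (1, 0, 1) v = s v []" for v by (simp add: qform_def s_def norm2_sq)
    then show ?thesis using R_ge[of "[]"] by (auto simp: F_def s_def)
  qed
  moreover have "continuous_on F qdet" unfolding qdet_def by (intro continuous_intros)
  ultimately obtain q where q: "q \<in> F" "\<And>p. p \<in> F \<Longrightarrow> qdet p \<le> qdet q"
    using continuous_attains_sup[of F qdet] by blast
  obtain x y z where q_eq: "q = (x, y, z)" by (cases q)
  define D where "D = qdet q"
  have D1: "D \<ge> 1" using q(2)[OF oneF] by (simp add: D_def qdet_def)
  have pos1: "fst p > 0" if "p \<in> F" "qdet p = D" for p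
  proof -
    have "0 \<le> qform p (vector [1, 0])" using that by (simp add: F_def)
    then have "fst p \<ge> 0" by (simp add: qform_def)
    moreover have "fst p \<noteq> 0" using that(2) D1 by (auto simp: qdet_def) (smt (verit) zero_le_power2)
    ultimately show ?thesis by simp
  qed
  have unique: "p = q" if p: "p \<in> F" "qdet p = D" for p
  proof -
    obtain x' y' z' where p_eq: "p = (x', y', z')" by (cases p)
    let ?m = "((x + x') / 2, (y + y') / 2, (z + z') / 2)"
    have "qform ?m v = (qform q v + qform p v) / 2" for v
      by (simp add: qform_def q_eq p_eq field_simps)
    then have "?m \<in> F" using q(1) p(1) by (simp add: F_def add_mono) (smt (verit) field_sum_of_halves)
    then have "qdet ?m \<le> D" using q(2) by (simp add: D_def)
    then have "x = x' \<and> y = y' \<and> z = z'"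
      using D1 pos1[OF q(1)] pos1[OF p] p(2)
      by (intro qdet_midpoint[of D]) (auto simp: qdet_def q_eq p_eq D_def)
    then show ?thesis by (simp add: q_eq p_eq)
  qed
  have inv: "qform q (A a *v v) = \<bar>det (A a)\<bar> * qform q v" if a: "a \<in> {1..N}" for a v
  proof -
    define d where "d = \<bar>det (A a)\<bar>"
    have d: "d > 0" using a inv_A by (auto simp: d_def invertible_det_nz[symmetric])
    define B where "B = A a"
    \<comment> \<open>The coefficients of \<open>q\<close> composed with \<open>A a\<close>, divided
      by \<open>\<bar>det (A a)\<bar>\<close>. By \<open>R_step\<close> this form is admissible, and
      its determinant is that of \<open>q\<close>.\<close>
    define p where "p = ((x * (B$1$1)\<^sup>2 + 2 * y * B$1$1 * B$2$1 + z * (B$2$1)\<^sup>2) / d,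
      (x * B$1$1 * B$1$2 + y * (B$1$1 * B$2$2 + B$1$2 * B$2$1) + z * B$2$1 * B$2$2) / d,
      (x * (B$1$2)\<^sup>2 + 2 * y * B$1$2 * B$2$2 + z * (B$2$2)\<^sup>2) / d)"
    have pq: "qform p v = qform q (A a *v v) / d" for v
      using d unfolding B_def[symmetric] p_def qform_def q_eq mv_components
      by (simp add: field_simps power2_eq_square)
    have "p \<in> F"
    proof -
      have "0 \<le> qform q (A a *v v)" "qform q (A a *v v) \<le> d * R v" for v
        using q(1) R_step[OF a, of v] by (auto simp: F_def d_def intro: order_trans)
      then show ?thesis using d by (simp add: F_def pq field_simps)
    qed
    moreover have "qdet p = D"
    proof -
      have "qdet p * d\<^sup>2 = D * (det B)\<^sup>2"
        unfolding D_def qdet_def q_eq p_def det_2 using d by (simp add: field_simps power2_eq_square)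
      moreover have "(det B)\<^sup>2 = d\<^sup>2" by (simp add: d_def B_def)
      ultimately show ?thesis using d by simp
    qed
    ultimately have "p = q" by (rule unique)
    then show ?thesis using pq[of v] d by (simp add: d_def field_simps)
  qed
  have x: "x > 0" using pos1[OF q(1)] by (simp add: D_def q_eq)
  \<comment> \<open>The Cholesky factor of the form \<open>q\<close>, whose determinant is
    \<open>D\<close>.\<close>
  define S :: "real^2^2" where "S = vector [vector [sqrt x, y / sqrt x], vector [0, sqrt (D / x)]]"
  have Sn: "(norm (S *v v))\<^sup>2 = qform q v" for v
  proof -
    have Dx: "(sqrt (D / x))\<^sup>2 = D / x" using D1 x by simp
    have "(norm (S *v v))\<^sup>2 = (sqrt x * v$1 + y / sqrt x * v$2)\<^sup>2 + (sqrt (D / x) * v$2)\<^sup>2"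
      by (simp add: norm2_sq mv_components S_def)
    also have "\<dots> = x * (v$1)\<^sup>2 + 2 * y * v$1 * v$2 + y\<^sup>2 / x * (v$2)\<^sup>2 + D / x * (v$2)\<^sup>2"
      unfolding power_mult_distrib Dx using x by (simp add: power2_sum power_mult_distrib power_divide)
    also have "\<dots> = qform q v"
      using x by (simp add: qform_def q_eq D_def qdet_def field_simps power2_eq_square)
    finally show ?thesis .
  qed
  have "det S = sqrt x * sqrt (D / x)" by (simp add: det_2 S_def)
  then have "invertible S" using x D1 by (simp add: invertible_det_nz)
  moreover have "norm (S *v (A i *v v)) = \<bar>det (A i)\<bar> powr (1/2) * norm (S *v v)" if "i \<in> {1..N}" for i v
  proof -
    have "(norm (S *v (A i *v v)))\<^sup>2 = (\<bar>det (A i)\<bar> powr (1/2) * norm (S *v v))\<^sup>2"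
      unfolding Sn power_mult_distrib by (simp add: inv[OF that] powr_half_sqrt)
    then show ?thesis by (simp add: power2_eq_iff_nonneg)
  qed
  ultimately show ?thesis unfolding strongly_conformal_iff by blast
qed

section \<open>Domination yields an invariant cone\<close>

text \<open>The preimage of a vector orthogonal to the most stretched image; it spans the singular
  direction of the smaller singular value.\<close>

lemma contracted_vector:
  fixes P :: "real^2^2"
  assumes "invertible P"
  obtains z where "z \<noteq> 0" "opnorm P * norm (P *v z) \<le> \<bar>det P\<bar> * norm z"
proof -
  obtain x where x: "norm x = 1" "norm (P *v x) = opnorm P" by (rule opnorm_attained)
  define e where "e = perp (P *v x)"
  define z where "z = matrix_inv P *v e"
  have Pz: "P *v z = e" by (simp add: z_def matrix_vector_mul_assoc matrix_inv_right[OF assms])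
  have op: "opnorm P > 0" using assms by (rule invertible_opnorm_pos)
  have en: "norm e = opnorm P" by (simp add: e_def x)
  have "z \<noteq> 0" using Pz en op by auto
  have "opnorm P * opnorm P = cross2 (P *v x) (P *v z)"
    using x by (simp add: Pz e_def cross2_perp dot_square_norm power2_eq_square)
  also have "\<dots> = det P * cross2 x z" by (rule cross2_mv)
  also have "\<dots> \<le> \<bar>det P\<bar> * \<bar>cross2 x z\<bar>" by (metis abs_ge_self abs_mult)
  also have "\<dots> \<le> \<bar>det P\<bar> * (norm x * norm z)" by (intro mult_left_mono abs_cross2_le) simp
  finally have "opnorm P * norm (P *v z) \<le> \<bar>det P\<bar> * norm z" using x by (simp add: Pz en)
  then show ?thesis using \<open>z \<noteq> 0\<close> that by blast
qed

context cocycle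
begin

text \<open>A quantitative way to say that \<open>v\<close> stays away from the directions
  contracted by any of the products.\<close>

definition transversal :: "real \<Rightarrow> real^2 \<Rightarrow> bool" where
  "transversal b v \<longleftrightarrow> (\<forall>u\<in>lists {1..N}. b * opnorm (M u) * norm v \<le> norm (M u *v v))"

lemma transversal_mono: "transversal b v \<Longrightarrow> b' \<le> b \<Longrightarrow> transversal b' v"
  unfolding transversal_def
  by (meson mult_right_mono norm_ge_zero opnorm_nonneg order_trans)

text \<open>An eccentric \<open>M g\<close> that does not contract \<open>v\<close> much sends it
  close, in direction, to the image of its most stretched vector. Almost multiplicativity bounds the
  stretching of that image from below with the constant \<open>c0\<close>, and the angle costs at
  most half of it. The constant obtained is independent of \<open>b\<close>.\<close>

lemma transversal_image:
  assumes am: "almost_mult c0" and g: "g \<in> lists {1..N}" and v: "v \<noteq> 0" and b: "b > 0"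
    and big: "b * opnorm (M g) * norm v \<le> norm (M g *v v)" and gap: "gap g \<le> b * c0\<^sup>2 / 4"
  shows "transversal (c0 / 2) (M g *v v)"
  unfolding transversal_def
proof
  fix u assume u: "u \<in> lists {1..N}"
  have c0: "c0 > 0" and am': "c0 * opnorm (M u) * opnorm (M g) \<le> opnorm (M (u @ g))"
    using am u g by (auto simp: almost_mult_def simp del: One_nat_def)
  have op: "opnorm (M u) > 0" "opnorm (M g) > 0" using u g opnorm_M_pos by auto
  obtain x where x: "norm x = 1" "norm (M (u @ g) *v x) = opnorm (M (u @ g))" by (rule opnorm_attained)
  have ux: "c0 * opnorm (M u) * opnorm (M g) \<le> norm (M u *v (M g *v x))"
    using am' x by (simp add: matword_append matrix_vector_mul_assoc)
  also have "\<dots> \<le> opnorm (M u) * norm (M g *v x)" by (rule norm_mv_le)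
  finally have "opnorm (M u) * (c0 * opnorm (M g)) \<le> opnorm (M u) * norm (M g *v x)" by (simp add: mult_ac)
  then have gx: "c0 * opnorm (M g) \<le> norm (M g *v x)" using op by simp
  have gx0: "norm (M g *v x) > 0" using gx c0 op by (smt (verit) mult_pos_pos)
  have "0 < b * opnorm (M g) * norm v" using b op v by simp
  then have gv0: "norm (M g *v v) > 0" using big by linarith
  define p r where "p = (1 / norm (M g *v v)) *\<^sub>R (M g *v v)" and "r = (1 / norm (M g *v x)) *\<^sub>R (M g *v x)"
  have pr: "norm p = 1" "norm r = 1" using gx0 gv0 by (auto simp: p_def r_def)
  have "\<bar>cross2 p r\<bar> = \<bar>det (M g)\<bar> * \<bar>cross2 v x\<bar> / (norm (M g *v v) * norm (M g *v x))"
    by (simp add: p_def r_def cross2_mv abs_mult)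
  also have "\<dots> \<le> \<bar>det (M g)\<bar> * (norm v * norm x) / ((b * opnorm (M g) * norm v) * (c0 * opnorm (M g)))"
    using big gx b c0 op v by (intro frac_le mult_left_mono abs_cross2_le mult_mono) auto
  also have "\<dots> = gap g / (b * c0)"
    using x v op by (simp add: gap_def power2_eq_square field_simps)
  also have "\<dots> \<le> (b * c0\<^sup>2 / 4) / (b * c0)" using gap b c0 by (intro divide_right_mono) auto
  also have "\<dots> = c0 / 4" using b c0 by (simp add: power2_eq_square)
  finally have cr: "\<bar>cross2 p r\<bar> \<le> c0 / 4" .
  have "c0 * opnorm (M u) \<le> norm (M u *v r)"
  proof -
    have "c0 * opnorm (M u) * norm (M g *v x) \<le> c0 * opnorm (M u) * opnorm (M g)"
      using norm_mv_le[of "M g" x] x c0 by (intro mult_left_mono) auto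
    also have "\<dots> \<le> norm (M u *v (M g *v x))" by (rule ux)
    finally show ?thesis using gx0 by (simp add: r_def matrix_vector_mult_scaleR field_simps)
  qed
  moreover have "\<bar>norm (M u *v p) - norm (M u *v r)\<bar> \<le> c0 * opnorm (M u) / 2"
  proof -
    have "\<bar>norm (M u *v p) - norm (M u *v r)\<bar> \<le> 2 * opnorm (M u) * \<bar>cross2 p r\<bar>"
      by (rule norm_mv_diff_le[OF pr])
    also have "\<dots> \<le> 2 * opnorm (M u) * (c0 / 4)" using cr by (intro mult_left_mono) auto
    finally show ?thesis by simp
  qed
  ultimately have "c0 * opnorm (M u) / 2 \<le> norm (M u *v p)" by linarith
  then show "c0 / 2 * opnorm (M u) * norm (M g *v v) \<le> norm (M u *v (M g *v v))"
    using gv0 by (simp add: p_def matrix_vector_mult_scaleR field_simps)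
qed

text \<open>The term \<open>b' * (1 + \<rho>)\<close> accounts for the length of the new vector,
  \<open>\<rho>\<close> for the image of the difference.\<close>

lemma transversal_perturb:
  assumes t: "transversal b x" and d: "norm (x' - x) \<le> \<rho> * norm x" and \<rho>: "0 \<le> \<rho>"
    and b: "b' * (1 + \<rho>) + \<rho> \<le> b" "0 \<le> b'"
  shows "transversal b' x'"
  unfolding transversal_def
proof
  fix u assume u: "u \<in> lists {1..N}"
  let ?o = "opnorm (M u)"
  have "norm x' \<le> norm x + norm (x' - x)" using norm_triangle_ineq[of x "x' - x"] by simp
  then have n: "norm x' \<le> (1 + \<rho>) * norm x" using d by (simp add: algebra_simps)
  have t1: "norm (M u *v x) \<le> norm (M u *v x') + norm (M u *v (x' - x))"
    using norm_triangle_ineq4[of "M u *v x'" "M u *v (x' - x)"] by (simp add: matrix_vector_mult_diff_distrib)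
  have t2: "norm (M u *v (x' - x)) \<le> ?o * (\<rho> * norm x)"
    using norm_mv_le[of "M u" "x' - x"] mult_left_mono[OF d, of ?o] by simp
  have "b * ?o * norm x \<le> norm (M u *v x)" using t u unfolding transversal_def by blast
  then have "b * ?o * norm x \<le> norm (M u *v x') + ?o * (\<rho> * norm x)" using t1 t2 by linarith
  moreover have "b' * ?o * norm x' \<le> b' * ?o * ((1 + \<rho>) * norm x)"
    using n b by (intro mult_left_mono) auto
  moreover have "(b' * (1 + \<rho>) + \<rho>) * (?o * norm x) \<le> b * (?o * norm x)"
    using b by (intro mult_right_mono) auto
  ultimately show "b' * ?o * norm x' \<le> norm (M u *v x')" by (simp add: algebra_simps)
qed

text \<open>As in the construction of an adapted norm, the cone asks for constants
  \<open>c * l ^ k\<close> growing with the number \<open>k < n0\<close> of letters applied. A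
  letter shifts \<open>k\<close> by one and so gains the factor \<open>l > 1\<close>; after
  \<open>n0\<close> letters \<open>transversal_image\<close> restores the constant
  \<open>c0 / 2 = 2 * c\<close>. The gain leaves room for a whole ball.\<close>

theorem cone_of_domination:
  assumes am: "almost_mult c0"
    and dom: "\<And>e. e > 0 \<Longrightarrow> \<exists>n. \<forall>w\<in>lists {1..N}. length w \<ge> n \<longrightarrow> gap w \<le> e"
  shows "\<exists>C. invariant_cone N A C"
proof -
  have c0: "c0 > 0" using am by (simp add: almost_mult_def)
  have c01: "c0 \<le> 1"
  proof -
    have "c0 * opnorm (M []) * opnorm (M []) \<le> opnorm (M ([] @ []))" using am unfolding almost_mult_def by blast
    then show ?thesis by simp
  qed
  define c where "c = c0 / 4"
  have c: "c > 0" using c0 by (simp add: c_def)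
  \<comment> \<open>The first bound serves the return after \<open>n0\<close> letters, the second
    the words applied to the vector that shows nonemptiness, the third the vector outside the
    cone.\<close>
  define e where "e = min (c * c0\<^sup>2 / 4) (min (c0 ^ 5 / 8) (c / 2))"
  have e: "e > 0" using c c0 by (simp add: e_def)
  obtain n1 where n1: "\<And>w. w \<in> lists {1..N} \<Longrightarrow> length w \<ge> n1 \<Longrightarrow> gap w \<le> e" using dom[OF e] by blast
  define n0 where "n0 = Suc n1"
  define l :: real where "l = 2 powr (1 / real n0)"
  have l1: "l > 1" by (simp add: l_def n0_def)
  have "real n0 \<noteq> 0" by (simp add: n0_def)
  then have ln0: "l ^ n0 = 2" by (simp add: l_def powr_realpow[symmetric] powr_powr)
  have l2: "l ^ k \<le> 2" if "k \<le> n0" for k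
    using power_increasing[OF that, of l] l1 ln0 by simp
  define K where "K = {v. v \<noteq> 0 \<and> (\<forall>k<n0. \<forall>w\<in>words N k. transversal (c * l ^ k) (M w *v v))}"
  have K0: "transversal c v" if "v \<in> K" for v
  proof -
    have "transversal (c * l ^ 0) (M [] *v v)" using that unfolding K_def n0_def by fastforce
    then show ?thesis by simp
  qed
  have "invariant_cone N A K"
    unfolding invariant_cone_def
  proof (intro conjI ballI allI impI)
    show "0 \<notin> K" by (simp add: K_def)
    show "r *\<^sub>R v \<in> K" if "v \<in> K" "r \<noteq> 0" for r v
    proof -
      have "transversal b (r *\<^sub>R x)" if "transversal b x" for b x
        using that mult_left_mono[of _ _ "\<bar>r\<bar>"] unfolding transversal_def
        by (simp add: matrix_vector_mult_scaleR mult.left_commute)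
      then show ?thesis using that by (auto simp: K_def matrix_vector_mult_scaleR)
    qed
    show "compact (K \<inter> sphere 0 1)"
    proof -
      have "K \<inter> sphere 0 1 = sphere 0 1 \<inter> (\<Inter>k\<in>{..<n0}. \<Inter>w\<in>words N k. \<Inter>u\<in>lists {1..N}.
          {v. c * l ^ k * opnorm (M u) * norm (M w *v v) \<le> norm (M u *v (M w *v v))})"
        by (auto simp: K_def transversal_def)
      moreover have "closed (\<Inter>k\<in>{..<n0}. \<Inter>w\<in>words N k. \<Inter>u\<in>lists {1..N}.
          {v. c * l ^ k * opnorm (M u) * norm (M w *v v) \<le> norm (M u *v (M w *v v))})"
        unfolding matrix_vector_mul_assoc
        by (intro closed_INT ballI closed_Collect_le continuous_intros)
      ultimately show ?thesis by (simp add: compact_Int_closed)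
    qed
    show "A a *v v \<in> interior K" if a: "a \<in> {1..N}" and v: "v \<in> K" for a v
    proof -
      define y where "y = A a *v v"
      have v0: "v \<noteq> 0" using v by (simp add: K_def)
      have y0: "norm y > 0" using invertible_mv_eq_0[of "A a" v] inv_A a v0 by (auto simp: y_def)
      have ty: "transversal (c * l ^ Suc k) (M w *v y)" if k: "k < n0" and w: "w \<in> words N k" for k w
      proof -
        have wa: "w @ [a] \<in> lists {1..N}" "length (w @ [a]) = Suc k" using w a by (auto simp: words_iff)
        have eq: "M w *v y = M (w @ [a]) *v v" by (simp add: y_def matword_append matrix_vector_mul_assoc)
        show ?thesis
        proof (cases "Suc k < n0")
          case True
          have "w @ [a] \<in> words N (Suc k)" using wa by (simp add: words_iff)
          then show ?thesis using v True unfolding eq K_def by blast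
        next
          case False
          then have kn: "Suc k = n0" using k by simp
          have "gap (w @ [a]) \<le> c * c0\<^sup>2 / 4" using n1[OF wa(1)] wa(2) kn by (simp add: n0_def e_def)
          moreover have "c * opnorm (M (w @ [a])) * norm v \<le> norm (M (w @ [a]) *v v)"
            using K0[OF v] wa(1) unfolding transversal_def by blast
          ultimately have "transversal (c0 / 2) (M (w @ [a]) *v v)"
            using transversal_image[OF am wa(1) v0 c] by blast
          moreover have "c * l ^ Suc k \<le> c0 / 2" unfolding kn ln0 by (simp add: c_def)
          ultimately show ?thesis unfolding eq by (rule transversal_mono)
        qed
      qed
      \<comment> \<open>Solves \<open>\<rho> * (1 + 2 * c) = c * (l - 1)\<close>: a perturbation may
        use up the gain of one factor \<open>l\<close>, given that
        \<open>l ^ k \<le> 2\<close>.\<close>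
      define \<rho> where "\<rho> = c * (l - 1) / (1 + 2 * c)"
      have \<rho>: "\<rho> > 0" using c l1 by (simp add: \<rho>_def)
      define r where "r = min (norm y) (\<rho> * c * norm y)"
      have r: "r > 0" using \<rho> c y0 by (simp add: r_def)
      have "ball y r \<subseteq> K"
      proof
        fix y' assume "y' \<in> ball y r"
        then have d: "norm (y' - y) < r" by (simp add: dist_norm norm_minus_commute)
        have "y' \<noteq> 0" using d by (auto simp: r_def)
        moreover have "transversal (c * l ^ k) (M w *v y')" if k: "k < n0" and w: "w \<in> words N k" for k w
        proof (rule transversal_perturb[OF ty[OF k w]])
          have wl: "w \<in> lists {1..N}" using w by (rule words_in_lists)
          have "transversal (c * l ^ Suc 0) (M [] *v y)" by (rule ty) (auto simp: n0_def)
          then have "transversal (c * l) y" by simp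
          then have "transversal c y" by (rule transversal_mono) (use c l1 in simp)
          then have low: "c * opnorm (M w) * norm y \<le> norm (M w *v y)" using wl unfolding transversal_def by blast
          have "norm (M w *v (y' - y)) \<le> opnorm (M w) * (\<rho> * c * norm y)"
            using norm_mv_le[of "M w" "y' - y"] d
              mult_left_mono[of "norm (y' - y)" "\<rho> * c * norm y" "opnorm (M w)"] by (simp add: r_def)
          also have "\<dots> = \<rho> * (c * opnorm (M w) * norm y)" by simp
          also have "\<dots> \<le> \<rho> * norm (M w *v y)" using \<rho> low by (intro mult_left_mono) auto
          finally show "norm (M w *v y' - M w *v y) \<le> \<rho> * norm (M w *v y)"
            by (simp add: matrix_vector_mult_diff_distrib)
          show "0 \<le> \<rho>" "0 \<le> c * l ^ k" using \<rho> c l1 by auto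
          have lk: "1 \<le> l ^ k" "l ^ k \<le> 2" using l1 l2[of k] k by (auto simp: one_le_power)
          have "\<rho> * (1 + c * l ^ k) \<le> \<rho> * (1 + 2 * c)"
            using lk \<rho> c by (intro mult_left_mono add_left_mono) (auto simp: mult.commute)
          also have "\<dots> = c * (l - 1)" using c by (simp add: \<rho>_def)
          also have "\<dots> \<le> c * (l - 1) * l ^ k" using mult_left_mono[OF lk(1), of "c * (l - 1)"] c l1 by simp
          finally show "c * l ^ k * (1 + \<rho>) + \<rho> \<le> c * l ^ Suc k" by (simp add: algebra_simps)
        qed
        ultimately show "y' \<in> K" by (simp add: K_def)
      qed
      then show ?thesis unfolding y_def[symmetric] using r by (auto simp: mem_interior)
    qed
    define g where "g = replicate n1 (1::nat)"
    have g: "g \<in> lists {1..N}" "length g = n1" using words_nonempty[OF N1, of n1] by (auto simp: g_def words_iff)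
    have gap_g: "gap g \<le> e" using n1 g by simp
    show "K \<noteq> {}"
    proof -
      \<comment> \<open>The image of the most stretched vector of one long word lies in the
        cone.\<close>
      obtain x where x: "norm x = 1" "norm (M g *v x) = opnorm (M g)" by (rule opnorm_attained)
      have x0: "x \<noteq> 0" using x by auto
      have "M g *v x \<noteq> 0" using x opnorm_M_pos[OF g(1)] by auto
      moreover have "transversal (c * l ^ k) (M w *v (M g *v x))" if k: "k < n0" and w: "w \<in> words N k" for k w
      proof -
        have wl: "w \<in> lists {1..N}" using w by (rule words_in_lists)
        have "gap g \<le> 1 * c0\<^sup>2 / 4"
        proof -
          have "e \<le> c * c0\<^sup>2 / 4" by (simp add: e_def)
          also have "\<dots> \<le> 1 * c0\<^sup>2 / 4" using c01 by (intro divide_right_mono mult_right_mono) (auto simp: c_def)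
          finally show ?thesis using gap_g by linarith
        qed
        then have "transversal (c0 / 2) (M g *v x)"
          using x by (intro transversal_image[OF am g(1) x0, of 1]) auto
        then have "c0 / 2 * opnorm (M w) * norm (M g *v x) \<le> norm (M w *v (M g *v x))"
          using wl unfolding transversal_def by blast
        moreover have "c0 / 2 * opnorm (M (w @ g)) * norm x \<le> c0 / 2 * opnorm (M w) * norm (M g *v x)"
          using opnorm_mult[of "M w" "M g"] c0 by (simp add: x matword_append)
        ultimately have big: "c0 / 2 * opnorm (M (w @ g)) * norm x \<le> norm (M (w @ g) *v x)"
          by (simp add: matword_append matrix_vector_mul_assoc)
        have "gap (w @ g) \<le> gap w * gap g / c0\<^sup>2"
          using am wl g(1) c0 unfolding almost_mult_def by (intro gap_append) blast+
        also have "\<dots> \<le> 1 * (c0 ^ 5 / 8) / c0\<^sup>2"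
          using gap_le_1[of w] gap_g gap_pos[OF g(1)]
          by (intro divide_right_mono mult_mono) (auto simp: e_def)
        also have "\<dots> = c0 / 2 * c0\<^sup>2 / 4" using c0 by (simp add: field_simps power2_eq_square power_def numeral_eq_Suc)
        finally have "transversal (c0 / 2) (M (w @ g) *v x)"
          using big c0 wl g(1) by (intro transversal_image[OF am _ x0, of _ "c0 / 2"]) auto
        moreover have "c * l ^ k \<le> c0 / 2" using l2[of k] k mult_left_mono[of "l ^ k" 2 c] c by (simp add: c_def)
        ultimately have "transversal (c * l ^ k) (M (w @ g) *v x)" by (rule transversal_mono)
        then show ?thesis by (simp add: matword_append matrix_vector_mul_assoc)
      qed
      ultimately have "M g *v x \<in> K" by (simp add: K_def)
      then show ?thesis by blast
    qed
    show "\<exists>z. z \<noteq> 0 \<and> z \<notin> K"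
    proof -
      \<comment> \<open>Transversality of this vector would give
        \<open>c \<le> gap g\<close>.\<close>
      obtain z where z: "z \<noteq> 0" "opnorm (M g) * norm (M g *v z) \<le> \<bar>det (M g)\<bar> * norm z"
        using contracted_vector[OF invertible_M[OF g(1)]] by blast
      have op: "opnorm (M g) > 0" by (rule opnorm_M_pos[OF g(1)])
      have "z \<notin> K"
      proof
        assume "z \<in> K"
        then have "c * opnorm (M g) * norm z \<le> norm (M g *v z)" using K0 g(1) unfolding transversal_def by blast
        then have "opnorm (M g) * (c * opnorm (M g) * norm z) \<le> opnorm (M g) * norm (M g *v z)"
          using op by (intro mult_left_mono) auto
        also have "\<dots> \<le> gap g * (opnorm (M g))\<^sup>2 * norm z" using z(2) op by (simp add: gap_def)
        finally have "c * ((opnorm (M g))\<^sup>2 * norm z) \<le> gap g * ((opnorm (M g))\<^sup>2 * norm z)"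
          by (simp add: power2_eq_square mult_ac)
        then have "c \<le> gap g" using op z(1) by (simp add: mult_le_cancel_right)
        moreover have "gap g \<le> c / 2" using gap_g by (simp add: e_def)
        ultimately show False using c by simp
      qed
      then show ?thesis using z(1) by blast
    qed
  qed
  then show ?thesis by blast
qed

end

section \<open>Cocycles with a Hoelder potential\<close>

text \<open>Applied with \<open>a k\<close> the norm of the \<open>k\<close>-th power of a matrix \<open>P\<close>, \<open>t = |trace P|\<close> and \<open>d = |det P|\<close>:
  both recursive bounds come from Cayley--Hamilton, and \<open>R\<close> is the spectral radius of \<open>P\<close>.\<close>

lemma growth_rate_bounds:
  fixes a :: "nat \<Rightarrow> real"
  assumes R: "R > 0" and K: "K > 0" and lo: "\<And>k. R ^ k / K \<le> a k" and hi: "\<And>k. a k \<le> K * R ^ k"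
    and up: "\<And>k. a (k + 2) \<le> t * a (k + 1) + d * a k" and dn: "\<And>k. t * a (k + 1) - d * a k \<le> a (k + 2)"
    and t: "t \<ge> 0" and d: "d \<ge> 0"
  shows "\<bar>R - t\<bar> \<le> d / R"
proof -
  define b where "b k = a k / R ^ k" for k
  define \<alpha> \<beta> where "\<alpha> = t / R" and "\<beta> = d / R\<^sup>2"
  have \<alpha>: "\<alpha> \<ge> 0" "\<beta> \<ge> 0" using R t d by (auto simp: \<alpha>_def \<beta>_def)
  have b_lo: "1 / K \<le> b k" and b_hi: "b k \<le> K" for k
    using lo[of k] hi[of k] R K by (simp_all add: b_def field_simps)
  have rw: "t * a (k + 1) = \<alpha> * b (k + 1) * R ^ (k + 2)" "d * a k = \<beta> * b k * R ^ (k + 2)"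
    "a (k + 2) = b (k + 2) * R ^ (k + 2)" for k
    using R by (simp_all add: \<alpha>_def \<beta>_def b_def field_simps power2_eq_square)
  have b_up: "b (k + 2) \<le> \<alpha> * b (k + 1) + \<beta> * b k" for k
  proof -
    have "b (k + 2) * R ^ (k + 2) \<le> (\<alpha> * b (k + 1) + \<beta> * b k) * R ^ (k + 2)"
      using up[of k] unfolding rw by (simp only: distrib_right)
    then show ?thesis by (rule mult_right_le_imp_le) (use R in simp)
  qed
  have b_dn: "\<alpha> * b (k + 1) - \<beta> * b k \<le> b (k + 2)" for k
  proof -
    have "(\<alpha> * b (k + 1) - \<beta> * b k) * R ^ (k + 2) \<le> b (k + 2) * R ^ (k + 2)"
      using dn[of k] unfolding rw by (simp only: left_diff_distrib)
    then show ?thesis by (rule mult_right_le_imp_le) (use R in simp)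
  qed
  have *: "\<not> (\<forall>n. real n * e \<le> L)" if "e > 0" for e L :: real
  proof
    assume "\<forall>n. real n * e \<le> L"
    moreover obtain n :: nat where "L / e < real n" using reals_Archimedean2 by blast
    ultimately show False using that by (auto simp: field_simps not_le[symmetric])
  qed
  \<comment> \<open>If \<open>\<alpha> + \<beta> < 1\<close>, summing the upper recursion bounds the
    partial sums of \<open>b\<close> uniformly, although \<open>b\<close> is at least
    \<open>1 / K\<close>.\<close>
  have "\<alpha> + \<beta> \<ge> 1"
  proof (rule ccontr)
    assume "\<not> ?thesis"
    then have lt: "1 - \<alpha> - \<beta> > 0" by simp
    have "real n * ((1 - \<alpha> - \<beta>) / K) \<le> 2 * K + \<alpha> * K" for n
    proof -
      have "(\<Sum>k<n. b (k + 2)) \<le> (\<Sum>k<n. \<alpha> * b (k + 1) + \<beta> * b k)" by (intro sum_mono b_up)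
      also have "\<dots> = \<alpha> * (\<Sum>k<n. b (k + 1)) + \<beta> * (\<Sum>k<n. b k)"
        by (simp add: sum.distrib sum_distrib_left)
      finally have 1: "(\<Sum>k<n. b (k + 2)) \<le> \<alpha> * (\<Sum>k<n. b (k + 1)) + \<beta> * (\<Sum>k<n. b k)" .
      have s1: "(\<Sum>k<n. b (k + 1)) = (\<Sum>k<n. b k) + (b n - b 0)"
        using sum_lessThan_telescope[of b n] by (simp add: sum_subtractf)
      have s2: "(\<Sum>k<n. b (k + 2)) = (\<Sum>k<n. b (k + 1)) + (b (n + 1) - b 1)"
        using sum_lessThan_telescope[of "\<lambda>k. b (k + 1)" n] by (simp add: sum_subtractf)
      have p: "0 \<le> b k" for k using b_lo[of k] K by (smt (verit) zero_le_divide_1_iff)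
      define \<Sigma> where "\<Sigma> = (\<Sum>k<n. b k)"
      have "(1 - \<alpha> - \<beta>) * \<Sigma> \<le> \<alpha> * (b n - b 0) - (b n - b 0) - (b (n + 1) - b 1)"
        using 1 unfolding s2 s1 \<Sigma>_def[symmetric] by (simp add: algebra_simps)
      also have "\<alpha> * (b n - b 0) \<le> \<alpha> * K" using \<alpha> b_hi[of n] p[of 0] by (intro mult_left_mono) auto
      also have "\<alpha> * K - (b n - b 0) - (b (n + 1) - b 1) \<le> 2 * K + \<alpha> * K"
        using p[of n] p[of "n + 1"] b_hi[of 0] b_hi[of 1] by simp
      finally have "(1 - \<alpha> - \<beta>) * \<Sigma> \<le> 2 * K + \<alpha> * K" by simp
      moreover have "real n * (1 / K) \<le> \<Sigma>"
        unfolding \<Sigma>_def using sum_mono[of "{..<n}" "\<lambda>_. 1 / K" b] b_lo by simp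
      then have "(1 - \<alpha> - \<beta>) * (real n * (1 / K)) \<le> (1 - \<alpha> - \<beta>) * \<Sigma>"
        using lt by (intro mult_left_mono) auto
      ultimately show ?thesis by (simp add: mult_ac)
    qed
    moreover have "(1 - \<alpha> - \<beta>) / K > 0" using lt K by simp
    ultimately show False using * by blast
  qed
  \<comment> \<open>If \<open>\<alpha> > 1 + \<beta>\<close>, by the lower recursion each increment
    of \<open>b\<close> exceeds \<open>\<beta>\<close> times the preceding one by a fixed amount;
    telescoping contradicts the boundedness of \<open>b\<close>.\<close>
  moreover have "\<alpha> \<le> 1 + \<beta>"
  proof (rule ccontr)
    assume "\<not> ?thesis"
    then have lt: "\<alpha> - 1 - \<beta> > 0" by simp
    have "real n * ((\<alpha> - 1 - \<beta>) / K) \<le> K + \<beta> * K" for n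
    proof -
      have "\<beta> * (b (k + 1) - b k) + (\<alpha> - 1 - \<beta>) / K \<le> b (k + 2) - b (k + 1)" for k
      proof -
        define e where "e = (\<alpha> - 1 - \<beta>) / K"
        have "(\<alpha> - 1 - \<beta>) * (1 / K) \<le> (\<alpha> - 1 - \<beta>) * b (k + 1)"
          using lt b_lo by (intro mult_left_mono) auto
        then have "e \<le> (\<alpha> - 1 - \<beta>) * b (k + 1)" by (simp add: e_def)
        then show ?thesis using b_dn[of k] unfolding e_def[symmetric] by (simp add: algebra_simps)
      qed
      then have "(\<Sum>k<n. \<beta> * (b (k + 1) - b k) + (\<alpha> - 1 - \<beta>) / K) \<le> (\<Sum>k<n. b (k + 2) - b (k + 1))"
        by (intro sum_mono)
      moreover have "(\<Sum>k<n. b (k + 2) - b (k + 1)) = b (n + 1) - b 1"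
        using sum_lessThan_telescope[of "\<lambda>k. b (k + 1)" n] by simp
      moreover have "(\<Sum>k<n. \<beta> * (b (k + 1) - b k) + (\<alpha> - 1 - \<beta>) / K)
          = \<beta> * (b n - b 0) + real n * ((\<alpha> - 1 - \<beta>) / K)"
        using sum_lessThan_telescope[of b n] by (simp add: sum.distrib flip: sum_distrib_left)
      ultimately have "real n * ((\<alpha> - 1 - \<beta>) / K) \<le> b (n + 1) - b 1 + \<beta> * (b 0 - b n)"
        by (simp add: algebra_simps)
      moreover have p: "0 \<le> b k" for k using b_lo[of k] K by (smt (verit) zero_le_divide_1_iff)
      have "\<beta> * (b 0 - b n) \<le> \<beta> * K" using \<alpha> b_hi[of 0] p[of n] by (intro mult_left_mono) auto
      ultimately show ?thesis using p[of 1] b_hi[of "n + 1"] by linarith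
    qed
    moreover have "(\<alpha> - 1 - \<beta>) / K > 0" using lt K by simp
    ultimately show False using * by blast
  qed
  ultimately have "\<bar>1 - \<alpha>\<bar> \<le> \<beta>" by linarith
  then have "\<bar>1 - \<alpha>\<bar> * R \<le> \<beta> * R" using R by (intro mult_right_mono) auto
  moreover have "\<bar>1 - \<alpha>\<bar> * R = \<bar>R - t\<bar>"
  proof -
    have "\<bar>1 - \<alpha>\<bar> * R = \<bar>(1 - \<alpha>) * R\<bar>" using R by (simp add: abs_mult)
    also have "(1 - \<alpha>) * R = R - t" using R by (simp add: \<alpha>_def field_simps)
    finally show ?thesis .
  qed
  moreover have "\<beta> * R = d / R" using R by (simp add: \<beta>_def power2_eq_square)
  ultimately show ?thesis by simp
qed

lemma trace_2: "trace (P :: real^2^2) = P$1$1 + P$2$2"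
  by (simp add: trace_def sum_2)

lemma cayley_hamilton_2: "(P :: real^2^2) ** (P ** (Q :: real^2^2)) = trace P *\<^sub>R (P ** Q) - det P *\<^sub>R Q"
  unfolding vec_eq_iff forall_2 by (simp add: mm_components trace_2 det_2 algebra_simps)

lemma tendsto_trace [tendsto_intros]:
  fixes g :: "'a \<Rightarrow> real^2^2"
  shows "(g \<longlongrightarrow> P) F \<Longrightarrow> ((\<lambda>x. trace (g x)) \<longlongrightarrow> trace P) F"
  unfolding trace_2 by (intro tendsto_intros)

lemma rank_one_2:
  fixes E :: "real^2^2"
  assumes "det E = 0" "E \<noteq> 0"
  obtains a b where "a \<noteq> 0" "b \<noteq> 0" "\<And>i j. E $ i $ j = a $ i * b $ j"
proof -
  obtain x where x: "norm x = 1" "norm (E *v x) = opnorm E" by (rule opnorm_attained)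
  define a where "a = E *v x"
  have a: "a \<noteq> 0" using x opnorm_pos[OF assms(2)] by (auto simp: a_def)
  have par: "\<exists>k. E *v y = k *\<^sub>R a" for y
    using cross2_eq_0D[OF _ a, of "E *v y"] cross2_mv[of E x y] assms(1) by (simp add: a_def)
  obtain k1 k2 where k: "E *v axis 1 1 = k1 *\<^sub>R a" "E *v axis 2 1 = k2 *\<^sub>R a" using par by metis
  define b :: "real^2" where "b = vector [k1, k2]"
  have E: "E $ i $ j = a $ i * b $ j" for i j
    using k exhaust_2[of i] exhaust_2[of j] unfolding vec2_eq_iff mv_components
    by (auto simp: b_def axis_def)
  moreover have "b \<noteq> 0"
  proof
    assume "b = 0"
    then have "E = 0" using E by (simp add: vec_eq_iff)
    then show False using assms(2) by simp
  qed
  ultimately show ?thesis using a that by blast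
qed

lemma trace_rank_one:
  fixes E P Q :: "real^2^2"
  assumes "\<And>i j. E $ i $ j = a $ i * b $ j"
  shows "trace (P ** E ** Q) = b \<bullet> (Q *v (P *v a))"
  unfolding trace_2 mm_components inner_vec_def sum_2 mv_components assms
  by (simp add: algebra_simps)

lemma mv_rank_one:
  fixes E :: "real^2^2"
  assumes "\<And>i j. E $ i $ j = a $ i * b $ j"
  shows "E *v x = (b \<bullet> x) *\<^sub>R a"
  unfolding vec2_eq_iff mv_components assms inner_vec_def sum_2 by (simp add: algebra_simps)

section \<open>Periodic sequences and their Birkhoff sums\<close>

definition periodic :: "nat list \<Rightarrow> nat \<Rightarrow> nat" where
  "periodic w k = w ! (k mod length w)"

lemma periodic_in_Sig: "w \<noteq> [] \<Longrightarrow> w \<in> lists {1..N} \<Longrightarrow> periodic w \<in> Sig N"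
  using nth_mem[of "_ mod length w" w] by (fastforce simp: Sig_def periodic_def)

lemma shift_periodic: "(shift ^^ length w) (periodic w) = periodic w"
  by (auto simp: funpow_shift periodic_def)

lemma shift_periodic_append:
  assumes "u @ v \<noteq> []"
  shows "(shift ^^ length u) (periodic (u @ v)) = periodic (v @ u)"
proof
  fix k
  let ?n = "length u + length v"
  have n: "?n > 0" using assms by simp
  define j where "j = k mod ?n"
  have j: "j < ?n" using n by (simp add: j_def)
  have "(k + length u) mod ?n = (j + length u) mod ?n" by (simp add: j_def mod_add_left_eq)
  also have "\<dots> = (if j < length v then j + length u else j - length v)"
  proof (cases "j < length v")
    case False
    then have "j + length u = (j - length v) + ?n" by simp
    then have "(j + length u) mod ?n = (j - length v) mod ?n" by (metis mod_add_self2)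
    then show ?thesis using False j by simp
  qed simp
  finally have m: "(k + length u) mod ?n = (if j < length v then j + length u else j - length v)" .
  have "(shift ^^ length u) (periodic (u @ v)) k = (u @ v) ! ((k + length u) mod ?n)"
    by (simp add: funpow_shift periodic_def)
  also have "\<dots> = (v @ u) ! j" unfolding m using j by (auto simp: nth_append)
  also have "\<dots> = periodic (v @ u) k" by (simp add: periodic_def j_def add.commute)
  finally show "(shift ^^ length u) (periodic (u @ v)) k = periodic (v @ u) k" .
qed

lemma periodic_low: "k < length w \<Longrightarrow> periodic w k = w ! k"
  by (simp add: periodic_def)

lemma prefix_periodic: "prefix (periodic w) (k * length w) = concat (replicate k w)"
proof (induction k)
  case (Suc k)
  have "prefix (periodic w) (Suc k * length w) = prefix (periodic w) (length w) @ prefix ((shift ^^ length w) (periodic w)) (k * length w)"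
    by (simp add: prefix_add[symmetric])
  also have "prefix (periodic w) (length w) = w" by (rule nth_equalityI) (auto simp: periodic_low)
  finally show ?case using Suc by (simp add: shift_periodic)
qed (simp add: prefix_def)

lemma birkhoff_add: "birkhoff f (n + m) x = birkhoff f n x + birkhoff f m ((shift ^^ n) x)"
  unfolding birkhoff_def
  by (induction m) (auto simp: funpow_shift add_ac)

lemma birkhoff_periodic: "birkhoff f (k * length w) (periodic w) = real k * birkhoff f (length w) (periodic w)"
proof (induction k)
  case (Suc k)
  have "birkhoff f (Suc k * length w) (periodic w) = birkhoff f (length w) (periodic w) + birkhoff f (k * length w) (periodic w)"
    using birkhoff_add[of f "length w" "k * length w" "periodic w"] by (simp add: shift_periodic)
  then show ?case using Suc by (simp add: algebra_simps)
qed (simp add: birkhoff_def)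


section \<open>Spectral radii from a potential\<close>

locale potential = cocycle +
  fixes f :: "(nat \<Rightarrow> nat) \<Rightarrow> real" and K :: real
  assumes hol: "holder N f"
    and close: "\<And>x n. x \<in> Sig N \<Longrightarrow> \<bar>birkhoff f n x - ln (opnorm (M (prefix x n)))\<bar> \<le> K"
begin

text \<open>Birkhoff sums are additive along concatenations, and each of the three norms involved is
  off by a factor of at most \<open>exp K\<close>.\<close>

lemma potential_almost_mult: "almost_mult (exp (- 3 * K))"
  unfolding almost_mult_def
proof (intro conjI ballI)
  fix u v assume u: "u \<in> lists {1..N}" and v: "v \<in> lists {1..N}"
  define x where "x = word_seq u (word_seq v (\<lambda>_. 1))"
  have vs: "word_seq v (\<lambda>_. 1) \<in> Sig N" by (rule word_seq_in_Sig[OF v ones_in_Sig[OF N1]])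
  have x: "x \<in> Sig N" unfolding x_def by (rule word_seq_in_Sig[OF u vs])
  have sx: "(shift ^^ length u) x = word_seq v (\<lambda>_. 1)" by (simp add: x_def)
  have pu: "prefix x (length u) = u" by (simp add: x_def)
  have puv: "prefix x (length u + length v) = u @ v" by (simp add: prefix_add sx pu)
  have "\<bar>birkhoff f (length u + length v) x - ln (opnorm (M (u @ v)))\<bar> \<le> K"
    using close[OF x, of "length u + length v"] by (simp add: puv)
  moreover have "\<bar>birkhoff f (length u) x - ln (opnorm (M u))\<bar> \<le> K" using close[OF x, of "length u"] by (simp add: pu)
  moreover have "\<bar>birkhoff f (length v) (word_seq v (\<lambda>_. 1)) - ln (opnorm (M v))\<bar> \<le> K"
    using close[OF vs, of "length v"] by simp
  ultimately have le: "- 3 * K + ln (opnorm (M u)) + ln (opnorm (M v)) \<le> ln (opnorm (M (u @ v)))"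
    using birkhoff_add[of f "length u" "length v" x] unfolding sx by linarith
  have pos: "opnorm (M u) > 0" "opnorm (M v) > 0" "opnorm (M (u @ v)) > 0" using u v by (auto intro!: opnorm_M_pos)
  have "exp (- 3 * K) * opnorm (M u) * opnorm (M v) = exp (- 3 * K + ln (opnorm (M u)) + ln (opnorm (M v)))"
    using pos by (simp only: exp_add exp_ln)
  also have "\<dots> \<le> exp (ln (opnorm (M (u @ v))))" using le by simp
  finally show "exp (- 3 * K) * opnorm (M u) * opnorm (M v) \<le> opnorm (M (u @ v))" using pos by simp
qed simp

text \<open>By \<open>rate_power\<close>, the logarithm of the spectral radius of
  \<open>M w\<close>.\<close>

definition rate :: "nat list \<Rightarrow> real" where
  "rate w = birkhoff f (length w) (periodic w)"

lemma rate_power: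
  assumes "w \<noteq> []" "w \<in> lists {1..N}"
  shows "\<bar>real k * rate w - ln (opnorm (M (concat (replicate k w))))\<bar> \<le> K"
  using close[OF periodic_in_Sig[OF assms], of "k * length w"]
  unfolding prefix_periodic birkhoff_periodic rate_def .

lemma rate_ge:
  assumes "w \<noteq> []" "w \<in> lists {1..N}"
  shows "exp (- K) * opnorm (M w) \<le> exp (rate w)"
proof -
  have "ln (opnorm (M w)) - K \<le> rate w" using rate_power[OF assms, of 1] by simp
  then have "exp (ln (opnorm (M w)) - K) \<le> exp (rate w)" by simp
  then show ?thesis using opnorm_M_pos[OF assms(2)] by (simp add: exp_diff exp_minus field_simps)
qed

text \<open>If \<open>R\<close> is the larger modulus of an eigenvalue, the other eigenvalue has
  modulus \<open>\<bar>det (M w)\<bar> / R\<close>, and the trace is their sum. The norms of the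
  powers obey the recursions of \<open>growth_rate_bounds\<close> by Cayley-Hamilton.\<close>

lemma rate_trace:
  assumes w: "w \<noteq> []" "w \<in> lists {1..N}"
  shows "\<bar>exp (rate w) - \<bar>trace (M w)\<bar>\<bar> \<le> \<bar>det (M w)\<bar> / exp (rate w)"
proof -
  define P where "P k = M (concat (replicate k w))" for k
  have P2: "P (k + 2) = trace (M w) *\<^sub>R P (k + 1) - det (M w) *\<^sub>R P k" for k
    using cayley_hamilton_2[of "M w" "P k"] by (simp add: P_def matword_append)
  have pl: "concat (replicate k w) \<in> lists {1..N}" for k using w(2) by (induction k) auto
  have Ppos: "opnorm (P k) > 0" for k unfolding P_def by (rule opnorm_M_pos[OF pl])
  have tri: "opnorm (X - Y) \<le> opnorm X + opnorm Y" "opnorm X - opnorm Y \<le> opnorm (X - Y)" for X Y :: "real^2^2"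
    using opnorm_diff_le[of X Y] opnorm_diff_le[of "X - Y" "- Y"] opnorm_scaleR[of "-1" Y] by auto
  show ?thesis
  proof (rule growth_rate_bounds[where a = "\<lambda>k. opnorm (P k)" and K = "exp K"])
    fix k
    have b: "\<bar>real k * rate w - ln (opnorm (P k))\<bar> \<le> K" unfolding P_def by (rule rate_power[OF w])
    have e: "exp (rate w) ^ k = exp (real k * rate w)" by (simp add: exp_of_nat_mult)
    have "exp (real k * rate w - K) \<le> exp (ln (opnorm (P k)))" using b by simp
    then show "exp (rate w) ^ k / exp K \<le> opnorm (P k)" using Ppos[of k] by (simp add: e exp_diff)
    have "exp (ln (opnorm (P k))) \<le> exp (K + real k * rate w)" using b by simp
    then show "opnorm (P k) \<le> exp K * exp (rate w) ^ k" using Ppos[of k] by (simp add: e exp_add)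
    show "opnorm (P (k + 2)) \<le> \<bar>trace (M w)\<bar> * opnorm (P (k + 1)) + \<bar>det (M w)\<bar> * opnorm (P k)"
      unfolding P2 using tri(1)[of "trace (M w) *\<^sub>R P (k + 1)" "det (M w) *\<^sub>R P k"] by simp
    show "\<bar>trace (M w)\<bar> * opnorm (P (k + 1)) - \<bar>det (M w)\<bar> * opnorm (P k) \<le> opnorm (P (k + 2))"
      unfolding P2 using tri(2)[of "trace (M w) *\<^sub>R P (k + 1)" "det (M w) *\<^sub>R P k"] by simp
  qed auto
qed

text \<open>Shifting consumes agreement: the \<open>i\<close>-th terms still agree in
  \<open>n - i + h\<close> letters, and the geometric series sums to a multiple of
  \<open>\<tau> ^ h\<close>.\<close>

lemma birkhoff_agree:
  obtains D \<tau> where "0 < \<tau>" "\<tau> < 1" "D > 0"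
    "\<And>x y n h. x \<in> Sig N \<Longrightarrow> y \<in> Sig N \<Longrightarrow> (\<And>k. k < n + h \<Longrightarrow> x k = y k) \<Longrightarrow>
       \<bar>birkhoff f n x - birkhoff f n y\<bar> \<le> D * \<tau> ^ h"
proof -
  obtain C \<tau> where C: "C > 0" "0 < \<tau>" "\<tau> < 1"
    "\<And>x y. x \<in> Sig N \<Longrightarrow> y \<in> Sig N \<Longrightarrow> x \<noteq> y \<Longrightarrow> \<bar>f x - f y\<bar> \<le> C * \<tau> ^ common_len x y"
    using hol unfolding holder_def by blast
  have one: "\<bar>f x - f y\<bar> \<le> C * \<tau> ^ m" if "x \<in> Sig N" "y \<in> Sig N" "\<And>k. k < m \<Longrightarrow> x k = y k" for x y m
  proof (cases "x = y")
    case True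
    then show ?thesis using C by simp
  next
    case False
    then obtain k where "x k \<noteq> y k" by blast
    then have "x (common_len x y) \<noteq> y (common_len x y)" unfolding common_len_def by (rule LeastI)
    then have "m \<le> common_len x y" using that(3) by (meson not_le)
    then have "\<tau> ^ common_len x y \<le> \<tau> ^ m" using C by (intro power_decreasing) auto
    then have "C * \<tau> ^ common_len x y \<le> C * \<tau> ^ m" using C by simp
    then show ?thesis using C(4)[OF that(1,2) False] by linarith
  qed
  have "\<bar>birkhoff f n x - birkhoff f n y\<bar> \<le> C / (1 - \<tau>) * \<tau> ^ h"
    if x: "x \<in> Sig N" and y: "y \<in> Sig N" and ag: "\<And>k. k < n + h \<Longrightarrow> x k = y k" for x y n h
  proof -
    have "\<bar>birkhoff f n x - birkhoff f n y\<bar> \<le> (\<Sum>i<n. \<bar>f ((shift ^^ i) x) - f ((shift ^^ i) y)\<bar>)"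
      unfolding birkhoff_def sum_subtractf[symmetric] by (rule sum_abs)
    also have "\<dots> \<le> (\<Sum>i<n. C * \<tau> ^ h * \<tau> ^ (n - Suc i))"
    proof (rule sum_mono)
      fix i assume i: "i \<in> {..<n}"
      have "\<bar>f ((shift ^^ i) x) - f ((shift ^^ i) y)\<bar> \<le> C * \<tau> ^ (n - i + h)"
        using i ag by (intro one shift_Sig x y) (auto simp: funpow_shift)
      also have "\<dots> \<le> C * (\<tau> ^ (h + (n - Suc i)))" using C i by (intro mult_left_mono power_decreasing) auto
      finally show "\<bar>f ((shift ^^ i) x) - f ((shift ^^ i) y)\<bar> \<le> C * \<tau> ^ h * \<tau> ^ (n - Suc i)"
        by (simp add: power_add)
    qed
    also have "\<dots> = C * \<tau> ^ h * (\<Sum>i<n. \<tau> ^ (n - Suc i))" by (simp add: sum_distrib_left)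
    also have "(\<Sum>i<n. \<tau> ^ (n - Suc i)) = (\<Sum>i<n. \<tau> ^ i)" by (rule sum.nat_diff_reindex)
    also have "\<dots> = (1 - \<tau> ^ n) / (1 - \<tau>)" using C by (subst sum_gp_strict) auto
    also have "C * \<tau> ^ h * \<dots> \<le> C * \<tau> ^ h * (1 / (1 - \<tau>))"
      using C by (intro mult_left_mono divide_right_mono) auto
    finally show ?thesis by simp
  qed
  then show ?thesis using that[of \<tau> "C / (1 - \<tau>)"] C by simp
qed

text \<open>The joint periodic sequence and that of \<open>g @ u\<close> both read
  \<open>g @ u\<close> and then \<open>g\<close> once more, so they agree for
  \<open>length g\<close> letters beyond the block that is summed. A cyclic shift turns the other
  half into the same situation with \<open>u\<close> and \<open>v\<close> exchanged.\<close>

lemma rate_decouple: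
  obtains D \<tau> where "0 < \<tau>" "\<tau> < 1" "D > 0"
    "\<And>g u v. g \<noteq> [] \<Longrightarrow> g \<in> lists {1..N} \<Longrightarrow> u \<in> lists {1..N} \<Longrightarrow> v \<in> lists {1..N} \<Longrightarrow>
       \<bar>rate ((g @ u) @ (g @ v)) - rate (g @ u) - rate (g @ v)\<bar> \<le> D * \<tau> ^ length g"
proof -
  obtain D \<tau> where D: "0 < \<tau>" "\<tau> < 1" "D > 0"
    "\<And>x y n h. x \<in> Sig N \<Longrightarrow> y \<in> Sig N \<Longrightarrow> (\<And>k. k < n + h \<Longrightarrow> x k = y k) \<Longrightarrow>
       \<bar>birkhoff f n x - birkhoff f n y\<bar> \<le> D * \<tau> ^ h"
    using birkhoff_agree by metis
  have half: "\<bar>birkhoff f (length (g @ u)) (periodic ((g @ u) @ (g @ v))) - rate (g @ u)\<bar> \<le> D * \<tau> ^ length g"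
    if g: "g \<noteq> []" "g \<in> lists {1..N}" and u: "u \<in> lists {1..N}" and v: "v \<in> lists {1..N}" for g u v
    unfolding rate_def
  proof (rule D(4))
    show "periodic ((g @ u) @ (g @ v)) \<in> Sig N" "periodic (g @ u) \<in> Sig N"
      using g u v by (auto intro!: periodic_in_Sig)
    fix k assume k: "k < length (g @ u) + length g"
    have "periodic ((g @ u) @ (g @ v)) k = ((g @ u) @ (g @ v)) ! k" using k by (intro periodic_low) simp
    also have "\<dots> = periodic (g @ u) k"
    proof (cases "k < length (g @ u)")
      case True
      then have "((g @ u) @ (g @ v)) ! k = (g @ u) ! k" by (rule nth_append_left)
      then show ?thesis using periodic_low[OF True] by simp
    next
      case False
      define j where "j = k - length (g @ u)"
      have j: "k = j + length (g @ u)" "j < length g" using k False by (auto simp: j_def)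
      have "((g @ u) @ (g @ v)) ! k = g ! j" unfolding j(1) using j(2) by (simp add: nth_append)
      moreover have "periodic (g @ u) k = g ! j" unfolding j(1) using j(2) by (simp add: periodic_def nth_append)
      ultimately show ?thesis by simp
    qed
    finally show "periodic ((g @ u) @ (g @ v)) k = periodic (g @ u) k" .
  qed
  have "\<bar>rate ((g @ u) @ (g @ v)) - rate (g @ u) - rate (g @ v)\<bar> \<le> 2 * D * \<tau> ^ length g"
    if g: "g \<noteq> []" "g \<in> lists {1..N}" and u: "u \<in> lists {1..N}" and v: "v \<in> lists {1..N}" for g u v
  proof -
    have "rate ((g @ u) @ (g @ v)) = birkhoff f (length (g @ u)) (periodic ((g @ u) @ (g @ v)))
        + birkhoff f (length (g @ v)) (periodic ((g @ v) @ (g @ u)))"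
      unfolding rate_def using g(1)
      by (simp only: length_append[of "g @ u" "g @ v"] birkhoff_add shift_periodic_append append_is_Nil_conv simp_thms)
    then show ?thesis using half[OF g u v] half[OF g v u] by linarith
  qed
  then show ?thesis using that[of \<tau> "2 * D"] D by simp
qed

end

section \<open>Exclusion of the mixed case\<close>

context potential
begin

text \<open>After scaling \<open>rate_trace\<close> by \<open>c n\<close>, the determinant term
  tends to \<open>0\<close> because \<open>det Y = 0\<close>, while \<open>rate_ge\<close> keeps the
  spectral radius from vanishing. In particular a nonzero singular limit of normalised products is
  not nilpotent.\<close>

lemma rate_limit:
  assumes X: "\<And>n. X n \<noteq> []" "\<And>n. X n \<in> lists {1..N}" and c: "\<And>n. c n > 0"
    and lim: "(\<lambda>n. (1 / c n) *\<^sub>R M (X n)) \<longlonglongrightarrow> Y" and Y: "Y \<noteq> 0" "det Y = 0"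
  shows "(\<lambda>n. exp (rate (X n)) / c n) \<longlonglongrightarrow> \<bar>trace Y\<bar>" "0 < \<bar>trace Y\<bar>"
proof -
  define Z where "Z n = (1 / c n) *\<^sub>R M (X n)" for n
  have Z: "Z \<longlonglongrightarrow> Y" using lim unfolding Z_def .
  define R where "R n = exp (rate (X n)) / c n" for n
  have Rpos: "R n > 0" for n using c[of n] by (simp add: R_def)
  have Rge: "exp (- K) * opnorm (Z n) \<le> R n" for n
    using divide_right_mono[OF rate_ge[OF X, of n], of "c n"] c[of n] by (simp add: Z_def R_def)
  have diff: "\<bar>R n - \<bar>trace (Z n)\<bar>\<bar> \<le> \<bar>det (Z n)\<bar> / R n" for n
  proof -
    have "\<bar>exp (rate (X n)) - \<bar>trace (M (X n))\<bar>\<bar> / c n \<le> \<bar>det (M (X n))\<bar> / exp (rate (X n)) / c n"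
      using rate_trace[OF X, of n] c[of n] by (intro divide_right_mono) auto
    moreover have "\<bar>trace (Z n)\<bar> = \<bar>trace (M (X n))\<bar> / c n"
    proof -
      have "trace (Z n) = trace (M (X n)) / c n" by (simp add: Z_def trace_2 add_divide_distrib)
      then show ?thesis using c[of n] by (simp add: abs_divide)
    qed
    moreover have "\<bar>exp (rate (X n)) - \<bar>trace (M (X n))\<bar>\<bar> / c n = \<bar>R n - \<bar>trace (M (X n))\<bar> / c n\<bar>"
    proof -
      have "R n - \<bar>trace (M (X n))\<bar> / c n = (exp (rate (X n)) - \<bar>trace (M (X n))\<bar>) / c n"
        by (simp add: R_def diff_divide_distrib)
      then show ?thesis using c[of n] by (simp add: abs_divide)
    qed
    moreover have "\<bar>det (M (X n))\<bar> / exp (rate (X n)) / c n = \<bar>det (Z n)\<bar> / R n"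
      using c[of n] by (simp add: Z_def R_def det_scaleR2 abs_mult power2_eq_square field_simps)
    ultimately show ?thesis by simp
  qed
  define \<eta> where "\<eta> = exp (- K) * opnorm Y"
  have \<eta>: "\<eta> > 0" using opnorm_pos[OF Y(1)] by (simp add: \<eta>_def)
  have oZ: "(\<lambda>n. exp (- K) * opnorm (Z n)) \<longlonglongrightarrow> \<eta>" unfolding \<eta>_def by (intro tendsto_intros Z)
  then have ev: "\<forall>\<^sub>F n in sequentially. \<eta> / 2 < exp (- K) * opnorm (Z n)"
    using \<eta> by (intro order_tendstoD(1)) auto
  have dz: "(\<lambda>n. \<bar>det (Z n)\<bar> / (\<eta> / 2)) \<longlonglongrightarrow> \<bar>det Y\<bar> / (\<eta> / 2)" using \<eta> by (intro tendsto_intros Z) auto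
  have "(\<lambda>n. R n - \<bar>trace (Z n)\<bar>) \<longlonglongrightarrow> 0"
  proof (rule Lim_null_comparison)
    show "\<forall>\<^sub>F n in sequentially. norm (R n - \<bar>trace (Z n)\<bar>) \<le> \<bar>det (Z n)\<bar> / (\<eta> / 2)"
      using ev
    proof eventually_elim
      case (elim n)
      then have "\<eta> / 2 \<le> R n" using Rge[of n] by linarith
      then have "\<bar>det (Z n)\<bar> / R n \<le> \<bar>det (Z n)\<bar> / (\<eta> / 2)" using \<eta> Rpos[of n] by (intro divide_left_mono) auto
      then show ?case using diff[of n] by simp
    qed
    show "(\<lambda>n. \<bar>det (Z n)\<bar> / (\<eta> / 2)) \<longlonglongrightarrow> 0" using dz Y(2) by simp
  qed
  moreover have "(\<lambda>n. \<bar>trace (Z n)\<bar>) \<longlonglongrightarrow> \<bar>trace Y\<bar>" by (intro tendsto_intros Z)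
  ultimately have "(\<lambda>n. (R n - \<bar>trace (Z n)\<bar>) + \<bar>trace (Z n)\<bar>) \<longlonglongrightarrow> 0 + \<bar>trace Y\<bar>" by (rule tendsto_add)
  then have RY: "R \<longlonglongrightarrow> \<bar>trace Y\<bar>" by simp
  then show "(\<lambda>n. exp (rate (X n)) / c n) \<longlonglongrightarrow> \<bar>trace Y\<bar>" by (simp add: R_def[abs_def])
  have "\<eta> \<le> \<bar>trace Y\<bar>" by (rule LIMSEQ_le[OF oZ RY]) (use Rge in auto)
  then show "0 < \<bar>trace Y\<bar>" using \<eta> by linarith
qed

lemma det_M_nz: "w \<in> lists {1..N} \<Longrightarrow> det (M w) \<noteq> 0"
  using invertible_M by (simp add: invertible_det_nz)

text \<open>Let \<open>G\<close> be a limit of the normalised quasi-conformal products and \<open>E = a b\<^sup>T\<close> one of the eccentric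
  products. Decoupling makes the modulus of \<open>b\<^sup>T W G V a\<close> multiplicative in the products \<open>V\<close> and \<open>W\<close>, which
  forces the orbit of \<open>a\<close> into two lines; but the eccentric products send both of them close to \<open>a\<close>.\<close>

lemma no_mixed_behaviour:
  assumes irr: "irreducible_tuple N A" and \<delta>: "\<delta> > 0"
    and conf: "\<And>n. \<exists>w\<in>lists {1..N}. length w \<ge> n \<and> gap w > \<delta>"
    and ecc: "\<And>e. e > 0 \<Longrightarrow> \<exists>w\<in>lists {1..N}. gap w < e"
  shows False
proof -
  have "\<exists>g. g \<in> lists {1..N} \<and> length g \<ge> Suc n \<and> gap g > \<delta>" for n using conf[of "Suc n"] by blast
  then obtain g0 where g0: "\<And>n. g0 n \<in> lists {1..N}" "\<And>n. length (g0 n) \<ge> Suc n" "\<And>n. gap (g0 n) > \<delta>" by metis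
  have "\<exists>u. u \<in> lists {1..N} \<and> gap u < 1 / real (Suc n)" for n using ecc[of "1 / real (Suc n)"] by auto
  then obtain u0 where u0: "\<And>n. u0 n \<in> lists {1..N}" "\<And>n. gap (u0 n) < 1 / real (Suc n)" by metis
  \<comment> \<open>Two normalisations: by the determinant for the quasi-conformal words, so that
    the limit is invertible, and by the norm for the eccentric words, so that the limit has rank
    one.\<close>
  define G0 where "G0 n = (1 / sqrt \<bar>det (M (g0 n))\<bar>) *\<^sub>R M (g0 n)" for n
  define E0 where "E0 n = (1 / opnorm (M (u0 n))) *\<^sub>R M (u0 n)" for n
  have oG0: "opnorm (G0 n) \<le> sqrt (1 / \<delta>)" for n
  proof -
    have d: "\<bar>det (M (g0 n))\<bar> > 0" using det_M_nz[OF g0(1)] by simp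
    have o: "opnorm (M (g0 n)) > 0" by (rule opnorm_M_pos[OF g0(1)])
    have "(opnorm (G0 n))\<^sup>2 = 1 / gap (g0 n)" using d by (simp add: G0_def gap_def power_divide power_mult_distrib)
    also have "\<dots> \<le> 1 / \<delta>" using g0(3)[of n] \<delta> by (intro divide_left_mono) auto
    finally show ?thesis by (rule real_le_rsqrt)
  qed
  have oE0: "opnorm (E0 n) = 1" for n using opnorm_M_pos[OF u0(1), of n] by (simp add: E0_def)
  have "bounded (range (\<lambda>n. (G0 n, E0 n)))"
  proof -
    have "bounded (range G0)"
      unfolding bounded_iff using order_trans[OF norm_le_opnorm mult_left_mono[OF oG0]]
      by (intro exI[of _ "4 * sqrt (1 / \<delta>)"]) auto
    moreover have "bounded (range E0)"
      unfolding bounded_iff using norm_le_opnorm[of "E0 _"] oE0 by (intro exI[of _ 4]) auto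
    ultimately have "bounded (range G0 \<times> range E0)" by (rule bounded_Times)
    then show ?thesis by (rule bounded_subset) auto
  qed
  then obtain GE r where r: "strict_mono r" "((\<lambda>n. (G0 n, E0 n)) \<circ> r) \<longlonglongrightarrow> GE"
    using bounded_imp_convergent_subsequence by blast
  define G E where "G = fst GE" and "E = snd GE"
  define g u where "g n = g0 (r n)" and "u n = u0 (r n)" for n
  define a' o' where "a' n = sqrt \<bar>det (M (g n))\<bar>" and "o' n = opnorm (M (u n))" for n
  have g: "g n \<in> lists {1..N}" "length (g n) \<ge> Suc n" "g n \<noteq> []" for n
  proof -
    show "g n \<in> lists {1..N}" unfolding g_def by (rule g0(1))
    show l: "length (g n) \<ge> Suc n" using g0(2)[of "r n"] seq_suble[OF r(1), of n] by (simp add: g_def)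
    then show "g n \<noteq> []" by auto
  qed
  have u: "u n \<in> lists {1..N}" for n unfolding u_def by (rule u0(1))
  have a': "a' n > 0" and o': "o' n > 0" for n
    using det_M_nz[OF g(1), of n] opnorm_M_pos[OF u, of n] by (simp_all add: a'_def o'_def)
  have limG: "(\<lambda>n. (1 / a' n) *\<^sub>R M (g n)) \<longlonglongrightarrow> G"
    using tendsto_fst[OF r(2)] by (simp add: G_def G0_def g_def a'_def o_def)
  have limE: "(\<lambda>n. (1 / o' n) *\<^sub>R M (u n)) \<longlonglongrightarrow> E"
    using tendsto_snd[OF r(2)] by (simp add: E_def E0_def u_def o'_def o_def)
  have detG: "\<bar>det G\<bar> = 1"
  proof -
    have "(\<lambda>n. \<bar>det ((1 / a' n) *\<^sub>R M (g n))\<bar>) \<longlonglongrightarrow> \<bar>det G\<bar>" by (intro tendsto_intros limG)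
    moreover have "\<bar>det ((1 / a' n) *\<^sub>R M (g n))\<bar> = 1" for n
      using det_M_nz[OF g(1), of n] by (simp add: det_scaleR2 a'_def abs_mult power_divide)
    ultimately show ?thesis by (simp add: LIMSEQ_const_iff)
  qed
  have opE: "opnorm E = 1"
  proof -
    have "(\<lambda>n. opnorm ((1 / o' n) *\<^sub>R M (u n))) \<longlonglongrightarrow> opnorm E" by (intro tendsto_intros limE)
    moreover have "opnorm ((1 / o' n) *\<^sub>R M (u n)) = 1" for n
      using o'[of n] by (simp add: o'_def)
    ultimately have "(\<lambda>n. 1) \<longlonglongrightarrow> opnorm E" by (simp only:)
    then show ?thesis by (simp add: LIMSEQ_const_iff)
  qed
  have E0': "E \<noteq> 0" using opnorm_le_norm[of E] opE by auto
  have detE: "det E = 0"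
  proof -
    have "(\<lambda>n. \<bar>det ((1 / o' n) *\<^sub>R M (u n))\<bar>) \<longlonglongrightarrow> \<bar>det E\<bar>" by (intro tendsto_intros limE)
    moreover have "(\<lambda>n. \<bar>det ((1 / o' n) *\<^sub>R M (u n))\<bar>) \<longlonglongrightarrow> 0"
    proof (rule Lim_null_comparison)
      have "\<bar>det ((1 / o' n) *\<^sub>R M (u n))\<bar> \<le> 1 / real (Suc n)" for n
      proof -
        have "\<bar>det ((1 / o' n) *\<^sub>R M (u n))\<bar> = gap (u n)"
          by (simp add: det_scaleR2 gap_def o'_def abs_mult power_divide)
        also have "\<dots> \<le> 1 / real (Suc (r n))" using u0(2)[of "r n"] by (simp add: u_def)
        also have "\<dots> \<le> 1 / real (Suc n)" using seq_suble[OF r(1), of n] by (intro divide_left_mono) auto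
        finally show ?thesis .
      qed
      then show "\<forall>\<^sub>F n in sequentially. norm \<bar>det ((1 / o' n) *\<^sub>R M (u n))\<bar> \<le> 1 / real (Suc n)" by simp
      show "(\<lambda>n. 1 / real (Suc n)) \<longlonglongrightarrow> 0" by (rule LIMSEQ_Suc[OF lim_1_over_n])
    qed
    ultimately have "\<bar>det E\<bar> = 0" by (rule LIMSEQ_unique)
    then show ?thesis by simp
  qed
  obtain a b where ab: "a \<noteq> 0" "b \<noteq> 0" "\<And>i j. E $ i $ j = a $ i * b $ j"
    using rank_one_2[OF detE E0'] by blast
  have Ev: "E *v x = (b \<bullet> x) *\<^sub>R a" for x by (rule mv_rank_one[OF ab(3)])
  have nz_mult: "P ** Q \<noteq> 0" if "invertible P" "Q \<noteq> 0" for P Q :: "real^2^2"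
  proof
    assume "P ** Q = 0"
    then have "matrix_inv P ** (P ** Q) = 0" by (simp add: vec_eq_iff mm_components)
    then show False using that(2) by (simp add: matrix_mul_assoc matrix_inv_left[OF that(1)])
  qed
  have nz_mult': "Q ** P \<noteq> 0" if "invertible P" "Q \<noteq> 0" for P Q :: "real^2^2"
  proof
    assume "Q ** P = 0"
    then have "(Q ** P) ** matrix_inv P = 0" by (simp add: vec_eq_iff mm_components)
    then show False using that(2) by (simp add: matrix_mul_assoc[symmetric] matrix_inv_right[OF that(1)])
  qed
  have invG: "invertible G" using detG by (auto simp: invertible_det_nz)
  \<comment> \<open>The trace of the limit of the normalised products along
    \<open>g n @ v @ u n @ w\<close>.\<close>
  define \<beta> where "\<beta> v w = b \<bullet> (M w *v (G *v (M v *v a)))" for v w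
  define c where "c n = a' n * o' n" for n
  have c: "c n > 0" for n using a' o' by (simp add: c_def)
  have lim1: "(\<lambda>n. (1 / c n) *\<^sub>R M (g n @ v @ u n @ w)) \<longlonglongrightarrow> G ** M v ** E ** M w" for v w
  proof -
    have "(\<lambda>n. ((1 / a' n) *\<^sub>R M (g n)) ** M v ** ((1 / o' n) *\<^sub>R M (u n)) ** M w) \<longlonglongrightarrow> G ** M v ** E ** M w"
      by (intro tendsto_intros limG limE)
    then show ?thesis by (simp add: scaleR_mm matword_append matrix_mul_assoc c_def mult.commute)
  qed
  have tr1: "trace (G ** M v ** E ** M w) = \<beta> v w" for v w
    using trace_rank_one[OF ab(3), of "G ** M v" "M w"] by (simp add: \<beta>_def matrix_vector_mul_assoc)
  have R1: "(\<lambda>n. exp (rate (g n @ v @ u n @ w)) / c n) \<longlonglongrightarrow> \<bar>\<beta> v w\<bar>" "\<beta> v w \<noteq> 0"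
    if v: "v \<in> lists {1..N}" and w: "w \<in> lists {1..N}" for v w
  proof -
    have nz: "G ** M v ** E ** M w \<noteq> 0"
      by (intro nz_mult' nz_mult invertible_mult invertible_M invG v w E0')
    have dz: "det (G ** M v ** E ** M w) = 0" by (simp add: det_mul detE)
    have l: "g n @ v @ u n @ w \<noteq> []" "g n @ v @ u n @ w \<in> lists {1..N}" for n
      using g[of n] u[of n] v w by auto
    note rl = rate_limit[OF l c lim1 nz dz]
    show "(\<lambda>n. exp (rate (g n @ v @ u n @ w)) / c n) \<longlonglongrightarrow> \<bar>\<beta> v w\<bar>" using rl(1) by (simp only: tr1)
    show "\<beta> v w \<noteq> 0" using rl(2) by (simp add: tr1)
  qed
  \<comment> \<open>Decoupling is applied with \<open>g n\<close> in front of both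
    \<open>u n\<close> and \<open>v @ u n @ w\<close>; the limit of the joint product has trace
    \<open>\<beta> [] w * \<beta> v []\<close>.\<close>
  have mult: "\<bar>\<beta> v []\<bar> * \<bar>\<beta> [] w\<bar> = \<bar>\<beta> [] []\<bar> * \<bar>\<beta> v w\<bar>"
    if v: "v \<in> lists {1..N}" and w: "w \<in> lists {1..N}" for v w
  proof -
    define P Q where "P n = g n @ u n" and "Q n = g n @ (v @ u n @ w)" for n
    have limP: "(\<lambda>n. exp (rate (P n)) / c n) \<longlonglongrightarrow> \<bar>\<beta> [] []\<bar>" using R1(1)[of "[]" "[]"] by (simp add: P_def)
    have limQ: "(\<lambda>n. exp (rate (Q n)) / c n) \<longlonglongrightarrow> \<bar>\<beta> v w\<bar>" using R1(1)[OF v w] by (simp add: Q_def)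
    have "(\<lambda>n. ((1 / c n) *\<^sub>R M (g n @ [] @ u n @ [])) ** ((1 / c n) *\<^sub>R M (g n @ v @ u n @ w)))
        \<longlonglongrightarrow> (G ** M [] ** E ** M []) ** (G ** M v ** E ** M w)"
      by (intro tendsto_matrix_mult lim1)
    then have limPQ: "(\<lambda>n. (1 / (c n * c n)) *\<^sub>R M (P n @ Q n)) \<longlonglongrightarrow> G ** E ** (G ** M v ** E ** M w)"
      by (simp add: scaleR_mm matword_append matrix_mul_assoc P_def Q_def)
    have tr: "trace (G ** E ** (G ** M v ** E ** M w)) = \<beta> [] w * \<beta> v []"
    proof -
      have "trace (G ** E ** (G ** M v ** E ** M w)) = b \<bullet> ((G ** M v ** E ** M w) *v (G *v a))"
        by (rule trace_rank_one[OF ab(3)])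
      also have "(G ** M v ** E ** M w) *v (G *v a) = G *v (M v *v (E *v (M w *v (G *v a))))"
        by (simp add: matrix_vector_mul_assoc matrix_mul_assoc)
      also have "\<dots> = (b \<bullet> (M w *v (G *v a))) *\<^sub>R (G *v (M v *v a))"
        unfolding Ev by (simp add: matrix_vector_mult_scaleR)
      finally show ?thesis by (simp add: \<beta>_def)
    qed
    have "(\<lambda>n. exp (rate (P n @ Q n)) / (c n * c n)) \<longlonglongrightarrow> \<bar>trace (G ** E ** (G ** M v ** E ** M w))\<bar>"
    proof (rule rate_limit(1)[OF _ _ _ limPQ])
      show "P n @ Q n \<noteq> []" "P n @ Q n \<in> lists {1..N}" "c n * c n > 0" for n
        using g[of n] u[of n] v w c[of n] by (auto simp: P_def Q_def)
      have "trace (G ** E ** (G ** M v ** E ** M w)) \<noteq> 0" unfolding tr using R1(2) v w by simp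
      then show "G ** E ** (G ** M v ** E ** M w) \<noteq> 0" by (auto simp: trace_2)
      show "det (G ** E ** (G ** M v ** E ** M w)) = 0" by (simp add: det_mul detE)
    qed
    moreover have "(\<lambda>n. exp (rate (P n @ Q n)) / (c n * c n)) \<longlonglongrightarrow> \<bar>\<beta> [] []\<bar> * \<bar>\<beta> v w\<bar> * exp 0"
    proof -
      obtain D \<tau> where D: "0 < \<tau>" "\<tau> < 1" "D > 0"
        "\<And>g u v. g \<noteq> [] \<Longrightarrow> g \<in> lists {1..N} \<Longrightarrow> u \<in> lists {1..N} \<Longrightarrow> v \<in> lists {1..N} \<Longrightarrow>
           \<bar>rate ((g @ u) @ (g @ v)) - rate (g @ u) - rate (g @ v)\<bar> \<le> D * \<tau> ^ length g"
        using rate_decouple by metis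
      define h where "h n = rate (P n @ Q n) - rate (P n) - rate (Q n)" for n
      have hb: "norm (h n) \<le> D * \<tau> ^ n" for n
      proof -
        have "\<bar>h n\<bar> \<le> D * \<tau> ^ length (g n)"
          unfolding h_def P_def Q_def using g[of n] u[of n] v w by (intro D(4)) auto
        also have "\<dots> \<le> D * \<tau> ^ n" using D g(2)[of n] by (intro mult_left_mono power_decreasing) auto
        finally show ?thesis by simp
      qed
      have "(\<lambda>n. D * \<tau> ^ n) \<longlonglongrightarrow> D * 0" using D by (intro tendsto_intros LIMSEQ_power_zero) auto
      then have "h \<longlonglongrightarrow> 0" by (intro Lim_null_comparison[of h]) (use hb in auto)
      then have "(\<lambda>n. (exp (rate (P n)) / c n) * (exp (rate (Q n)) / c n) * exp (h n)) \<longlonglongrightarrow> \<bar>\<beta> [] []\<bar> * \<bar>\<beta> v w\<bar> * exp 0"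
        by (intro tendsto_mult limP limQ tendsto_exp)
      moreover have "(exp (rate (P n)) / c n) * (exp (rate (Q n)) / c n) * exp (h n) = exp (rate (P n @ Q n)) / (c n * c n)" for n
        by (simp add: h_def exp_diff)
      ultimately show ?thesis by (simp only:)
    qed
    ultimately have "\<bar>\<beta> [] w * \<beta> v []\<bar> = \<bar>\<beta> [] []\<bar> * \<bar>\<beta> v w\<bar>" unfolding tr using LIMSEQ_unique by fastforce
    then show ?thesis by (simp add: abs_mult mult.commute)
  qed
  \<comment> \<open>Irreducibility moves the line orthogonal to \<open>b\<close>; this keeps the
    functional \<open>\<phi>\<close> below from vanishing at \<open>perp b\<close>.\<close>
  obtain j where j: "j \<in> {1..N}" "b \<bullet> (A j *v perp b) \<noteq> 0"
  proof -
    have "perp b \<noteq> 0" using ab(2) norm_perp[of b] by (metis norm_eq_zero)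
    then obtain j where "j \<in> {1..N}" "cross2 (perp b) (A j *v perp b) \<noteq> 0" using irreducible_moves[OF irr] by blast
    moreover have "cross2 (perp b) y = - (b \<bullet> y)" for y by (simp add: cross2_def inner_vec_def sum_2)
    ultimately show ?thesis using that by auto
  qed
  have jl: "[j] \<in> lists {1..N}" using j by simp
  define p q where "p = \<beta> [] []" and "q = \<beta> [] [j]"
  have pq: "p \<noteq> 0" "q \<noteq> 0" using R1(2)[of "[]" "[]"] R1(2)[of "[]" "[j]"] jl by (auto simp: p_def q_def)
  \<comment> \<open>The case \<open>w = [j]\<close> of \<open>mult\<close> equates two absolute
    values for \<open>x = M v *v a\<close>. The minus sign means \<open>\<theta> x = 0\<close>; the
    relation with the plus sign also holds at \<open>x = a\<close>, and a nonzero functional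
    vanishes on only one line, so then \<open>x\<close> is parallel to \<open>a\<close>.\<close>
  define \<theta> where "\<theta> x = b \<bullet> (A j *v (G *v x)) + (q / p) * (b \<bullet> (G *v x))" for x
  have \<theta>a: "\<theta> a \<noteq> 0" using pq by (simp add: \<theta>_def p_def q_def \<beta>_def)
  have two_lines: "cross2 a (M v *v a) = 0 \<or> \<theta> (M v *v a) = 0" if v: "v \<in> lists {1..N}" for v
  proof (rule ccontr)
    assume neg: "\<not> ?thesis"
    define x where "x = M v *v a"
    have indep: "cross2 (G *v a) (G *v x) \<noteq> 0" using neg detG by (auto simp: cross2_mv x_def)
    have "\<bar>b \<bullet> (G *v x)\<bar> * \<bar>q\<bar> = \<bar>p\<bar> * \<bar>b \<bullet> (A j *v (G *v x))\<bar>"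
      using mult[OF v jl] by (simp add: \<beta>_def p_def q_def x_def)
    then have "\<bar>b \<bullet> (A j *v (G *v x))\<bar> = \<bar>(q / p) * (b \<bullet> (G *v x))\<bar>"
      using pq by (simp add: abs_mult field_simps)
    moreover have "b \<bullet> (A j *v (G *v x)) \<noteq> - ((q / p) * (b \<bullet> (G *v x)))"
      using neg by (simp add: \<theta>_def x_def)
    ultimately have x0: "b \<bullet> (A j *v (G *v x)) - (q / p) * (b \<bullet> (G *v x)) = 0" by (auto simp: abs_eq_iff)
    have a0: "b \<bullet> (A j *v (G *v a)) - (q / p) * (b \<bullet> (G *v a)) = 0"
      using pq by (simp add: p_def q_def \<beta>_def)
    define \<phi> where "\<phi> y = b \<bullet> (A j *v y) - (q / p) * (b \<bullet> y)" for y
    have lin: "\<phi> (s *\<^sub>R y + t *\<^sub>R z) = s * \<phi> y + t * \<phi> z" for s t y z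
      by (simp add: \<phi>_def matrix_vector_right_distrib matrix_vector_mult_scaleR inner_add_right algebra_simps)
    have "\<phi> (cross2 (G *v a) (G *v x) *\<^sub>R perp b) = 0"
      unfolding cramer2[of "G *v a" "G *v x" "perp b"] lin using x0 a0 by (simp add: \<phi>_def)
    then have "cross2 (G *v a) (G *v x) * \<phi> (perp b) = 0" using lin[of _ "perp b" 0 0] by simp
    then have "\<phi> (perp b) = 0" using indep by simp
    moreover have "b \<bullet> perp b = 0" by (simp add: inner_vec_def sum_2)
    ultimately show False using j(2) by (simp add: \<phi>_def)
  qed
  \<comment> \<open>Otherwise \<open>E ** M v ** E = 0\<close>, against almost
    multiplicativity.\<close>
  have bV: "b \<bullet> (M v *v a) \<noteq> 0" if v: "v \<in> lists {1..N}" for v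
  proof
    assume z: "b \<bullet> (M v *v a) = 0"
    define k where "k = exp (- 3 * K)"
    have k: "k > 0" "\<And>u v. u \<in> lists {1..N} \<Longrightarrow> v \<in> lists {1..N} \<Longrightarrow> k * opnorm (M u) * opnorm (M v) \<le> opnorm (M (u @ v))"
      using potential_almost_mult unfolding almost_mult_def k_def by blast+
    have "(\<lambda>n. opnorm (((1 / o' n) *\<^sub>R M (u n)) ** M v ** ((1 / o' n) *\<^sub>R M (u n)))) \<longlonglongrightarrow> opnorm (E ** M v ** E)"
      by (intro tendsto_intros limE)
    moreover have "k * k * opnorm (M v) \<le> opnorm (((1 / o' n) *\<^sub>R M (u n)) ** M v ** ((1 / o' n) *\<^sub>R M (u n)))" for n
    proof -
      have "k * (k * opnorm (M (u n)) * opnorm (M v)) * opnorm (M (u n)) \<le> k * opnorm (M (u n @ v)) * opnorm (M (u n))"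
        using k(1) k(2)[OF u v, of n] by (intro mult_right_mono mult_left_mono) auto
      also have "\<dots> \<le> opnorm (M ((u n @ v) @ u n))" using u[of n] v by (intro k(2)) auto
      finally have "k * k * opnorm (M v) * (o' n * o' n) \<le> opnorm (M (u n) ** M v ** M (u n))"
        by (simp add: o'_def matword_append matrix_mul_assoc mult_ac)
      then show ?thesis using o'[of n] by (simp add: scaleR_mm field_simps)
    qed
    ultimately have "k * k * opnorm (M v) \<le> opnorm (E ** M v ** E)"
      by (intro LIMSEQ_le_const[of _ "opnorm (E ** M v ** E)"]) auto
    moreover have "opnorm (E ** M v ** E) \<le> 0"
    proof (rule opnorm_leI)
      fix x
      have "(E ** M v ** E) *v x = E *v (M v *v (E *v x))" by (simp add: matrix_vector_mul_assoc matrix_mul_assoc)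
      also have "\<dots> = 0" unfolding Ev by (simp add: matrix_vector_mult_scaleR z)
      finally show "norm ((E ** M v ** E) *v x) \<le> 0 * norm x" by simp
    qed simp
    moreover have "k * k * opnorm (M v) > 0" using k(1) opnorm_M_pos[OF v] by simp
    ultimately show False by linarith
  qed
  \<comment> \<open>The directions of \<open>M (u n @ v) *v a\<close> tend to that of
    \<open>a\<close>, where \<open>\<theta>\<close> does not vanish; so they are eventually off the
    second line and hence exactly on the first.\<close>
  have ev: "\<forall>\<^sub>F n in sequentially. cross2 a (M (u n) *v (M v *v a)) = 0" if v: "v \<in> lists {1..N}" for v
  proof -
    have \<theta>lin: "\<theta> (s *\<^sub>R x) = s * \<theta> x" for s x
      by (simp add: \<theta>_def matrix_vector_mult_scaleR algebra_simps)
    have "(\<lambda>n. \<theta> (((1 / o' n) *\<^sub>R M (u n)) *v (M v *v a))) \<longlonglongrightarrow> \<theta> (E *v (M v *v a))"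
      unfolding \<theta>_def by (intro tendsto_intros limE)
    moreover have "\<theta> (E *v (M v *v a)) \<noteq> 0" unfolding Ev \<theta>lin using \<theta>a bV[OF v] by simp
    ultimately have "\<forall>\<^sub>F n in sequentially. \<theta> (((1 / o' n) *\<^sub>R M (u n)) *v (M v *v a)) \<noteq> 0"
      by (rule tendsto_imp_eventually_ne)
    then show ?thesis
    proof eventually_elim
      case (elim n)
      then have "\<theta> (M (u n) *v (M v *v a)) \<noteq> 0" unfolding scaleR_mv \<theta>lin by simp
      then have "\<theta> (M (u n @ v) *v a) \<noteq> 0" by (simp add: matword_append matrix_vector_mul_assoc)
      then have "cross2 a (M (u n @ v) *v a) = 0" using two_lines[of "u n @ v"] u[of n] v by auto
      then show ?case by (simp add: matword_append matrix_vector_mul_assoc)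
    qed
  qed
  \<comment> \<open>Two independent vectors with images on one line contradict the invertibility of
    \<open>M (u n)\<close>.\<close>
  obtain i where i: "i \<in> {1..N}" "cross2 a (A i *v a) \<noteq> 0" using irreducible_moves[OF irr ab(1)] by blast
  have il: "[] \<in> lists {1..N}" "[i] \<in> lists {1..N}" using i by auto
  have "\<forall>\<^sub>F n in sequentially. False"
    using ev[OF il(1)] ev[OF il(2)]
  proof eventually_elim
    case (elim n)
    have e1: "cross2 a (M (u n) *v a) = 0" using elim(1) by simp
    have e2: "cross2 a (M (u n) *v (A i *v a)) = 0" using elim(2) i by simp
    obtain k l where kl: "M (u n) *v a = k *\<^sub>R a" "M (u n) *v (A i *v a) = l *\<^sub>R a"
      using cross2_eq_0D[OF e1 ab(1)] cross2_eq_0D[OF e2 ab(1)] by blast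
    have "cross2 (M (u n) *v a) (M (u n) *v (A i *v a)) = 0" unfolding kl by simp
    then show False using det_M_nz[OF u, of n] i(2) by (simp add: cross2_mv)
  qed
  then show False by simp
qed

theorem potential_imp_multicone_or_conformal:
  assumes irr: "irreducible_tuple N A"
  shows "has_strongly_invariant_multicone N A \<or> strongly_conformal N A"
proof (cases "\<forall>e>0. \<exists>n. \<forall>w\<in>lists {1..N}. length w \<ge> n \<longrightarrow> gap w \<le> e")
  case True
  then have "\<exists>C. invariant_cone N A C" using cone_of_domination[OF potential_almost_mult] by blast
  then obtain C where "invariant_cone N A C" by blast
  then interpret cocycle_cone N A C by unfold_locales
  show ?thesis using multicone_of_cone by blast
next
  case False
  then obtain \<delta> where \<delta>: "\<delta> > 0" "\<And>n. \<exists>w\<in>lists {1..N}. length w \<ge> n \<and> gap w > \<delta>" by (meson not_le)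
  have "\<exists>e>0. \<forall>w\<in>lists {1..N}. e \<le> gap w"
  proof (rule ccontr)
    assume "\<not> ?thesis"
    then have "\<exists>w\<in>lists {1..N}. gap w < e" if "e > 0" for e using that by (meson not_le)
    then show False using no_mixed_behaviour[OF irr \<delta>] by blast
  qed
  then show ?thesis using conformal_of_gap_bounded by blast
qed

end

section \<open>Gibbs measures, potentials and the equivalences\<close>

lemma holder_affine:
  assumes "holder N f"
  shows "holder N (\<lambda>x. r * f x + t)"
proof -
  obtain C \<tau> where C: "C > 0" "0 < \<tau>" "\<tau> < 1"
    "\<And>x y. x \<in> Sig N \<Longrightarrow> y \<in> Sig N \<Longrightarrow> x \<noteq> y \<Longrightarrow> \<bar>f x - f y\<bar> \<le> C * \<tau> ^ common_len x y"
    using assms unfolding holder_def by blast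
  show ?thesis unfolding holder_def
  proof (intro exI conjI ballI impI)
    show "0 < (\<bar>r\<bar> + 1) * C" using C by (simp add: add_nonneg_pos)
    show "0 < \<tau>" "\<tau> < 1" by (rule C)+
    fix x y assume xy: "x \<in> Sig N" "y \<in> Sig N" "x \<noteq> y"
    have "\<bar>(r * f x + t) - (r * f y + t)\<bar> = \<bar>r\<bar> * \<bar>f x - f y\<bar>"
      by (simp add: abs_mult[symmetric] right_diff_distrib)
    also have "\<dots> \<le> (\<bar>r\<bar> + 1) * (C * \<tau> ^ common_len x y)"
      using C(4)[OF xy] by (intro mult_mono) auto
    finally show "\<bar>(r * f x + t) - (r * f y + t)\<bar> \<le> (\<bar>r\<bar> + 1) * C * \<tau> ^ common_len x y" by simp
  qed
qed

lemma birkhoff_affine: "birkhoff (\<lambda>x. r * f x + t) n x = r * birkhoff f n x + real n * t"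
  by (simp add: birkhoff_def sum.distrib sum_distrib_left)

context cocycle
begin

text \<open>By comparability the logarithm of the measure of a cylinder is \<open>s\<close> times
  the logarithm of the norm minus \<open>n * P\<close>, up to a bounded error. A potential is thus
  Gibbs exactly if its Birkhoff sums, corrected by its own pressure, follow the same
  expression.\<close>

theorem gibbs_iff_potential:
  assumes irr: "irreducible_tuple N A" and s: "s > 0" and eq: "equilibrium N A s \<mu>"
  shows "(\<exists>\<phi>. holder N \<phi> \<and> gibbs N \<mu> \<phi>) \<longleftrightarrow>
    (\<exists>C f. C > 0 \<and> holder N f \<and> (\<forall>x\<in>Sig N. \<forall>n. \<bar>birkhoff f n x - ln (opnorm (M (prefix x n)))\<bar> \<le> C))"
proof -
  define P where "P = pressure N (Phi A s)"
  obtain C where C: "C > 0"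
    "\<And>w. w \<in> lists {1..N} \<Longrightarrow> exp (- real (length w) * P) * opnorm (M w) powr s / C \<le> measure \<mu> (cyl N w)
      \<and> measure \<mu> (cyl N w) \<le> C * (exp (- real (length w) * P) * opnorm (M w) powr s)"
    using equilibrium_comparable[OF irr s eq] unfolding P_def by blast
  have ln_mu: "\<bar>ln (measure \<mu> (cyl N w)) - (s * ln (opnorm (M w)) - real (length w) * P)\<bar> \<le> \<bar>ln C\<bar>"
    "0 < measure \<mu> (cyl N w)"
    if w: "w \<in> lists {1..N}" for w
  proof -
    define B where "B = exp (- real (length w) * P) * opnorm (M w) powr s"
    have B: "B > 0" using opnorm_M_pos[OF w] by (simp add: B_def)
    have lnB: "ln B = s * ln (opnorm (M w)) - real (length w) * P"
      using opnorm_M_pos[OF w] by (simp add: B_def ln_mult_pos ln_powr)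
    have b: "B / C \<le> measure \<mu> (cyl N w)" "measure \<mu> (cyl N w) \<le> C * B" using C(2)[OF w] by (auto simp: B_def)
    have BC: "0 < B / C" using B C(1) by simp
    then show pos: "0 < measure \<mu> (cyl N w)" using b(1) by linarith
    have "ln (B / C) \<le> ln (measure \<mu> (cyl N w))" using b(1) BC by (intro ln_mono)
    moreover have "ln (measure \<mu> (cyl N w)) \<le> ln (C * B)" using b(2) pos by (intro ln_mono)
    ultimately show "\<bar>ln (measure \<mu> (cyl N w)) - (s * ln (opnorm (M w)) - real (length w) * P)\<bar> \<le> \<bar>ln C\<bar>"
      using B C(1) by (simp add: ln_div ln_mult_pos flip: lnB)
  qed
  show ?thesis
  proof
    assume "\<exists>\<phi>. holder N \<phi> \<and> gibbs N \<mu> \<phi>"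
    then obtain \<phi> where \<phi>: "holder N \<phi>" "gibbs N \<mu> \<phi>" by blast
    define Q where "Q = pressure N (birkhoff \<phi>)"
    obtain D where D: "D \<ge> 1" "\<And>n w j. w \<in> words N n \<Longrightarrow> j \<in> cyl N w \<Longrightarrow>
       exp (- real n * Q + birkhoff \<phi> n j) / D \<le> measure \<mu> (cyl N w) \<and>
       measure \<mu> (cyl N w) \<le> D * exp (- real n * Q + birkhoff \<phi> n j)"
      using \<phi>(2) unfolding gibbs_def Q_def by blast
    \<comment> \<open>Solves \<open>s * f x - P = \<phi> x - Q\<close>, the comparison of the two
      exponents.\<close>
    define f where "f x = (1 / s) * \<phi> x + (P - Q) / s" for x
    define K where "K = (\<bar>ln C\<bar> + ln D) / s + 1"
    have "holder N f" unfolding f_def by (rule holder_affine[OF \<phi>(1)])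
    moreover have "\<bar>birkhoff f n x - ln (opnorm (M (prefix x n)))\<bar> \<le> K" if x: "x \<in> Sig N" for x n
    proof -
      define w where "w = prefix x n"
      have w: "w \<in> words N n" "w \<in> lists {1..N}" "length w = n" "x \<in> cyl N w"
        using prefix_in_words[OF x, of n] x by (auto simp: w_def words_iff cyl_iff)
      define m where "m = measure \<mu> (cyl N w)"
      have m: "0 < m" using ln_mu(2)[OF w(2)] by (simp add: m_def)
      have b: "exp (- real n * Q + birkhoff \<phi> n x) / D \<le> m" "m \<le> D * exp (- real n * Q + birkhoff \<phi> n x)"
        using D(2)[OF w(1,4)] by (auto simp: m_def)
      have "ln (exp (- real n * Q + birkhoff \<phi> n x) / D) \<le> ln m" using b(1) D(1) by (intro ln_mono) auto
      then have 1: "- real n * Q + birkhoff \<phi> n x - ln D \<le> ln m" using D(1) by (simp add: ln_div)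
      have "ln m \<le> ln (D * exp (- real n * Q + birkhoff \<phi> n x))" using b(2) m by (intro ln_mono) auto
      then have 2: "ln m \<le> ln D + (- real n * Q + birkhoff \<phi> n x)" using D(1) by (simp add: ln_mult_pos)
      have 3: "\<bar>ln m - (s * ln (opnorm (M w)) - real n * P)\<bar> \<le> \<bar>ln C\<bar>"
        using ln_mu(1)[OF w(2)] by (simp add: m_def w(3))
      have "\<bar>s * ln (opnorm (M w)) - (birkhoff \<phi> n x + real n * (P - Q))\<bar> \<le> \<bar>ln C\<bar> + ln D"
        using 1 2 3 by (simp add: right_diff_distrib abs_le_iff)
      moreover have "birkhoff \<phi> n x + real n * (P - Q) = s * birkhoff f n x"
        unfolding f_def birkhoff_affine using s by (simp add: field_simps)
      ultimately have "\<bar>s * (birkhoff f n x - ln (opnorm (M w)))\<bar> \<le> \<bar>ln C\<bar> + ln D"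
        by (simp add: right_diff_distrib abs_minus_commute)
      then have "\<bar>birkhoff f n x - ln (opnorm (M w))\<bar> \<le> (\<bar>ln C\<bar> + ln D) / s"
        unfolding abs_mult using s by (simp add: pos_le_divide_eq mult.commute)
      then show ?thesis by (simp add: K_def w_def)
    qed
    moreover have "K > 0" using D(1) s by (simp add: K_def add_nonneg_pos)
    ultimately show "\<exists>C f. C > 0 \<and> holder N f \<and> (\<forall>x\<in>Sig N. \<forall>n. \<bar>birkhoff f n x - ln (opnorm (M (prefix x n)))\<bar> \<le> C)"
      by blast
  next
    assume "\<exists>C f. C > 0 \<and> holder N f \<and> (\<forall>x\<in>Sig N. \<forall>n. \<bar>birkhoff f n x - ln (opnorm (M (prefix x n)))\<bar> \<le> C)"
    then obtain K f where K: "K > 0" "holder N f"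
      "\<And>x n. x \<in> Sig N \<Longrightarrow> \<bar>birkhoff f n x - ln (opnorm (M (prefix x n)))\<bar> \<le> K" by blast
    \<comment> \<open>The summand \<open>0\<close> brings this into the form of
      \<open>holder_affine\<close> and \<open>birkhoff_affine\<close>.\<close>
    define \<phi> where "\<phi> x = s * f x + 0" for x
    have hol: "holder N \<phi>" unfolding \<phi>_def by (rule holder_affine[OF K(2)])
    have cl: "\<bar>birkhoff \<phi> n x - s * ln (opnorm (M w))\<bar> \<le> s * K"
      if w: "w \<in> words N n" and x: "x \<in> cyl N w" for n w x
    proof -
      have xw: "x \<in> Sig N" "prefix x n = w" using w x by (auto simp: cyl_iff words_iff)
      have "birkhoff \<phi> n x - s * ln (opnorm (M w)) = s * (birkhoff f n x - ln (opnorm (M w)))"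
        unfolding \<phi>_def birkhoff_affine by (simp add: right_diff_distrib)
      then have "\<bar>birkhoff \<phi> n x - s * ln (opnorm (M w))\<bar> = s * \<bar>birkhoff f n x - ln (opnorm (M w))\<bar>"
        using s by (simp add: abs_mult)
      also have "\<dots> \<le> s * K" using K(3)[OF xw(1), of n] s xw(2) by (intro mult_left_mono) auto
      finally show ?thesis .
    qed
    \<comment> \<open>The Gibbs condition refers to the pressure of \<open>\<phi>\<close> itself.
      Its partition sums differ from those of the norms by bounded factors, so this pressure is
      \<open>P\<close>.\<close>
    have press: "pressure N (birkhoff \<phi>) = P"
    proof -
      define Z where "Z n = (\<Sum>w\<in>words N n. opnorm (M w) powr s)" for n
      define Y where "Y n = (\<Sum>w\<in>words N n. exp (SUP j\<in>cyl N w. birkhoff \<phi> n j))" for n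
      have Zpos: "Z n > 0" for n unfolding Z_def by (rule partition_pos)
      have sup: "exp (- (s * K)) * opnorm (M w) powr s \<le> exp (SUP j\<in>cyl N w. birkhoff \<phi> n j)"
        "exp (SUP j\<in>cyl N w. birkhoff \<phi> n j) \<le> exp (s * K) * opnorm (M w) powr s"
        if w: "w \<in> words N n" for w n
      proof -
        define S where "S = (SUP j\<in>cyl N w. birkhoff \<phi> n j)"
        have wl: "w \<in> lists {1..N}" using w by (rule words_in_lists)
        have pe: "opnorm (M w) powr s = exp (s * ln (opnorm (M w)))"
          using opnorm_M_pos[OF wl] by (simp add: powr_def)
        have up: "birkhoff \<phi> n j \<le> s * ln (opnorm (M w)) + s * K" if "j \<in> cyl N w" for j
          using cl[OF w that] by linarith
        have 1: "S \<le> s * ln (opnorm (M w)) + s * K"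
          unfolding S_def using cyl_nonempty[OF N1 wl] up by (intro cSUP_least) auto
        obtain j where j: "j \<in> cyl N w" using cyl_nonempty[OF N1 wl] by blast
        have "birkhoff \<phi> n j \<le> S"
          unfolding S_def using up j by (intro cSUP_upper bdd_aboveI[of _ "s * ln (opnorm (M w)) + s * K"]) auto
        then have 2: "s * ln (opnorm (M w)) - s * K \<le> S" using cl[OF w j] by linarith
        show "exp (- (s * K)) * opnorm (M w) powr s \<le> exp (SUP j\<in>cyl N w. birkhoff \<phi> n j)"
          unfolding pe S_def[symmetric] exp_add[symmetric] using 2 by simp
        show "exp (SUP j\<in>cyl N w. birkhoff \<phi> n j) \<le> exp (s * K) * opnorm (M w) powr s"
          unfolding pe S_def[symmetric] exp_add[symmetric] using 1 by simp
      qed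
      have lo: "exp (- (s * K)) * Z n \<le> Y n" for n
        unfolding Y_def Z_def sum_distrib_left by (intro sum_mono sup)
      have hi: "Y n \<le> exp (s * K) * Z n" for n
        unfolding Y_def Z_def sum_distrib_left by (intro sum_mono sup)
      have dist: "\<bar>ln (Y n) - ln (Z n)\<bar> \<le> s * K" for n
      proof -
        have p: "0 < exp (- (s * K)) * Z n" using Zpos by simp
        then have Yp: "0 < Y n" using lo[of n] by linarith
        have "ln (exp (- (s * K)) * Z n) \<le> ln (Y n)" using lo p by (intro ln_mono)
        moreover have "ln (Y n) \<le> ln (exp (s * K) * Z n)" using hi Yp by (intro ln_mono)
        ultimately show ?thesis using Zpos[of n] by (simp add: ln_mult_pos)
      qed
      have "(\<lambda>n. ln (Y n) / real n - ln (Z n) / real n) \<longlonglongrightarrow> 0"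
      proof (rule Lim_null_comparison)
        show "\<forall>\<^sub>F n in sequentially. norm (ln (Y n) / real n - ln (Z n) / real n) \<le> s * K * (1 / real n)"
        proof (rule always_eventually, rule allI)
          fix n
          have "norm (ln (Y n) / real n - ln (Z n) / real n) = \<bar>ln (Y n) - ln (Z n)\<bar> / real n"
            by (simp flip: diff_divide_distrib)
          also have "\<dots> \<le> s * K / real n" using dist by (intro divide_right_mono) auto
          finally show "norm (ln (Y n) / real n - ln (Z n) / real n) \<le> s * K * (1 / real n)" by simp
        qed
        have "(\<lambda>n. s * K * (1 / real n)) \<longlonglongrightarrow> s * K * 0" using lim_1_over_n by (intro tendsto_intros)
        then show "(\<lambda>n. s * K * (1 / real n)) \<longlonglongrightarrow> 0" by simp
      qed
      then have "(\<lambda>n. (ln (Y n) / real n - ln (Z n) / real n) + ln (Z n) / real n) \<longlonglongrightarrow> 0 + P"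
        using pressure_limit[OF s] unfolding P_def Z_def by (intro tendsto_add)
      then have "(\<lambda>n. ln (Y n) / real n) \<longlonglongrightarrow> P" by simp
      then show ?thesis unfolding pressure_def Y_def by (rule limI)
    qed
    have "gibbs N \<mu> \<phi>"
      unfolding gibbs_def press
    proof (intro exI[of _ "exp (\<bar>ln C\<bar> + s * K)"] conjI allI ballI)
      show "1 \<le> exp (\<bar>ln C\<bar> + s * K)" using s K(1) by simp
      fix n w j assume w: "w \<in> words N n" and j: "j \<in> cyl N w"
      have wl: "w \<in> lists {1..N}" "length w = n" using w by (auto simp: words_iff)
      define m where "m = measure \<mu> (cyl N w)"
      have m: "m > 0" using ln_mu(2)[OF wl(1)] by (simp add: m_def)
      have 1: "\<bar>ln m - (s * ln (opnorm (M w)) - real n * P)\<bar> \<le> \<bar>ln C\<bar>"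
        using ln_mu(1)[OF wl(1)] by (simp add: m_def wl(2))
      define X where "X = - real n * P + birkhoff \<phi> n j"
      have 2: "\<bar>ln m - X\<bar> \<le> \<bar>ln C\<bar> + s * K" using 1 cl[OF w j] by (simp add: X_def abs_le_iff)
      have "exp (X - (\<bar>ln C\<bar> + s * K)) \<le> exp (ln m)" using 2 by simp
      then show "exp (- real n * P + birkhoff \<phi> n j) / exp (\<bar>ln C\<bar> + s * K) \<le> measure \<mu> (cyl N w)"
        using m unfolding X_def[symmetric] m_def[symmetric] by (simp only: exp_diff exp_ln)
      have "exp (ln m) \<le> exp ((\<bar>ln C\<bar> + s * K) + X)" using 2 by simp
      then show "measure \<mu> (cyl N w) \<le> exp (\<bar>ln C\<bar> + s * K) * exp (- real n * P + birkhoff \<phi> n j)"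
        using m unfolding X_def[symmetric] m_def[symmetric] by (simp only: exp_add exp_ln)
    qed
    with hol show "\<exists>\<phi>. holder N \<phi> \<and> gibbs N \<mu> \<phi>" by blast
  qed
qed

theorem multicone_or_conformal_iff_potential:
  assumes irr: "irreducible_tuple N A"
  shows "has_strongly_invariant_multicone N A \<or> strongly_conformal N A \<longleftrightarrow>
    (\<exists>C f. C > 0 \<and> holder N f \<and> (\<forall>x\<in>Sig N. \<forall>n. \<bar>birkhoff f n x - ln (opnorm (M (prefix x n)))\<bar> \<le> C))"
proof
  assume "has_strongly_invariant_multicone N A \<or> strongly_conformal N A"
  then show "\<exists>C f. C > 0 \<and> holder N f \<and> (\<forall>x\<in>Sig N. \<forall>n. \<bar>birkhoff f n x - ln (opnorm (M (prefix x n)))\<bar> \<le> C)"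
  proof
    assume "has_strongly_invariant_multicone N A"
    then obtain C where "invariant_cone N A C" using invariant_cone_of_multicone[OF inv_A] by blast
    then interpret cocycle_cone N A C by unfold_locales
    show ?thesis by (rule cone_imp_potential)
  next
    assume "strongly_conformal N A"
    then show ?thesis by (rule conformal_imp_potential)
  qed
next
  assume "\<exists>C f. C > 0 \<and> holder N f \<and> (\<forall>x\<in>Sig N. \<forall>n. \<bar>birkhoff f n x - ln (opnorm (M (prefix x n)))\<bar> \<le> C)"
  then obtain C f where "holder N f"
    "\<And>x n. x \<in> Sig N \<Longrightarrow> \<bar>birkhoff f n x - ln (opnorm (M (prefix x n)))\<bar> \<le> C" by blast
  then interpret potential N A f C by unfold_locales
  show "has_strongly_invariant_multicone N A \<or> strongly_conformal N A"
    by (rule potential_imp_multicone_or_conformal[OF irr])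
qed

end

theorem theorem2p9:
  fixes N :: nat and A :: "nat \<Rightarrow> real^2^2" and s :: real and \<mu> :: "(nat \<Rightarrow> nat) measure"
  assumes "N \<ge> 2"
    and "\<forall>i\<in>{1..N}. invertible (A i)"
    and "irreducible_tuple N A"
    and "s > 0"
    and "equilibrium N A s \<mu>"
  shows "((\<exists>\<phi>. holder N \<phi> \<and> gibbs N \<mu> \<phi>)
            \<longleftrightarrow> (has_strongly_invariant_multicone N A \<or> strongly_conformal N A))
       \<and> ((has_strongly_invariant_multicone N A \<or> strongly_conformal N A)
            \<longleftrightarrow> (\<exists>C f. C > 0 \<and> holder N f \<and>
                  (\<forall>x\<in>Sig N. \<forall>n. \<bar>birkhoff f n x - ln (opnorm (matword A (prefix x n)))\<bar> \<le> C)))"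
proof -
  interpret cocycle N A using assms(1,2) by unfold_locales auto
  show ?thesis
    using gibbs_iff_potential[OF assms(3-5)] multicone_or_conformal_iff_potential[OF assms(3)] by simp
qed

end
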